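(* Let $L>0$, let $0=\mathsf{v}_1<\mathsf{v}_2<\mathsf{v}_3<\dots$ be a strictly increasing sequence in $[0,L)$ with $\sum_{n=1}^{\infty}(\mathsf{v}_{n+1}-\mathsf{v}_n)=L$, and let $\sigma=(\sigma_n)_{n\in\mathbb{N}}\subset[0,\infty)$ with $(\sigma_n)_{n\in\mathbb{N}}\in\ell^1(\mathbb{N})$. Let $\lambda_n(\sigma)$ and $\lambda_n(0)$, $n\in\mathbb{N}$, denote the eigenvalues of the operators $H_\sigma$ and $H_0$ (the latter corresponding to the zero sequence), respectively. Then $$\lim_{N\to\infty}\frac{1}{N}\sum_{n=1}^{N}\bigl(\lambda_n(\sigma)-\lambda_n(0)\bigr)=\frac{2\sigma_1}{L}+\frac{\sum_{n=2}^{\infty}\sigma_n}{L}.$$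
   Context: Let $I=[0,L]$. For a sequence $\sigma=(\sigma_n)_{n\in\mathbb{N}}\subset[0,\infty)$, consider on $L^2(I)$ the quadratic form $h^{\sigma}[\varphi]=\int_I|\varphi'|^2\,\mathrm{d}x+\sum_{n=1}^{\infty}\sigma_n|\varphi(\mathsf{v}_n)|^2$ with form domain $\mathcal{D}_\sigma=\{\varphi\in H^1(I): h^\sigma[\varphi]<\infty\}$ (functions in $H^1(I)$ are identified with their continuous representatives). This form is densely defined, closed and non-negative, and $H_\sigma$ denotes the unique self-adjoint operator associated with it; informally $H_\sigma=-\frac{\mathrm{d}^2}{\mathrm{d}x^2}+\sum_{n=1}^\infty\sigma_n\delta(x-\mathsf{v}_n)$. The operator $H_\sigma$ has purely discrete spectrum, and its eigenvalues, counted with multiplicity, are written $0\le\lambda_1(\sigma)\le\lambda_2(\sigma)\le\dots$. For $\sigma=0$, $H_0$ is the Neumann Laplacian on $[0,L]$. *)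

theory Defs
  imports "HOL-Analysis.Analysis" "HOL-Library.Function_Algebras"
begin

text \<open>
  Functions on \<open>I = [0, L]\<close> are modelled as functions \<open>real \<Rightarrow> complex\<close>. Sequences indexed by
  \<open>1, 2, 3, \<dots>\<close> in the literature are indexed from 0 here, so that \<open>v 0\<close>, \<open>\<sigma> 0\<close> and the
  eigenvalue with index 0 are the first ones.
\<close>

definition L2 :: "real \<Rightarrow> (real \<Rightarrow> complex) set" where
  "L2 L = {f \<in> borel_measurable (lebesgue_on {0..L}).
             integrable (lebesgue_on {0..L}) (\<lambda>x. (cmod (f x))\<^sup>2)}"

definition L2_inner :: "real \<Rightarrow> (real \<Rightarrow> complex) \<Rightarrow> (real \<Rightarrow> complex) \<Rightarrow> complex" where
  "L2_inner L f g = (LINT x|lebesgue_on {0..L}. f x * cnj (g x))"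

text \<open>
  The test functions for weak derivatives are those in \<open>C\<^sub>c\<^sup>1(0, L)\<close>, as in Brezis' textbook.
  The support is bounded, so that a closed support inside \<open>(0, L)\<close> is compact.
\<close>

definition test_functions :: "real \<Rightarrow> (real \<Rightarrow> real) set" where
  "test_functions L = {\<eta>. \<eta> C1_differentiable_on UNIV \<and> closure {x. \<eta> x \<noteq> 0} \<subseteq> {0<..<L}}"

definition has_weak_deriv :: "real \<Rightarrow> (real \<Rightarrow> complex) \<Rightarrow> (real \<Rightarrow> complex) \<Rightarrow> bool" where
  "has_weak_deriv L \<phi> g \<longleftrightarrow>
     (\<forall>\<eta>\<in>test_functions L.
        (LINT x|lebesgue_on {0..L}. \<phi> x * complex_of_real (vector_derivative \<eta> (at x)))
        = - (LINT x|lebesgue_on {0..L}. g x * complex_of_real (\<eta> x)))"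

text \<open>
  Elements of \<open>H\<^sup>1(I)\<close> are represented by their continuous representatives on \<open>I\<close>. Fixing the
  value 0 outside \<open>I\<close> makes the representing function unique, so that linear independence and
  dimension are those of functions on \<open>I\<close>.
\<close>

definition H1 :: "real \<Rightarrow> (real \<Rightarrow> complex) set" where
  "H1 L = {\<phi>. continuous_on {0..L} \<phi> \<and> (\<forall>x. x \<notin> {0..L} \<longrightarrow> \<phi> x = 0) \<and>
              (\<exists>g\<in>L2 L. has_weak_deriv L \<phi> g)}"

text \<open>Weak derivatives are unique almost everywhere, so the choice does not affect integrals.\<close>

definition weak_deriv :: "real \<Rightarrow> (real \<Rightarrow> complex) \<Rightarrow> real \<Rightarrow> complex" where
  "weak_deriv L \<phi> = (SOME g. g \<in> L2 L \<and> has_weak_deriv L \<phi> g)"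

definition quad_form ::
  "real \<Rightarrow> (nat \<Rightarrow> real) \<Rightarrow> (nat \<Rightarrow> real) \<Rightarrow> (real \<Rightarrow> complex) \<Rightarrow> ennreal" where
  "quad_form L v \<sigma> \<phi> =
     (\<integral>\<^sup>+ x. ennreal ((cmod (weak_deriv L \<phi> x))\<^sup>2) \<partial>lebesgue_on {0..L})
     + (\<Sum>n. ennreal (\<sigma> n * (cmod (\<phi> (v n)))\<^sup>2))"

definition form_domain :: "real \<Rightarrow> (nat \<Rightarrow> real) \<Rightarrow> (nat \<Rightarrow> real) \<Rightarrow> (real \<Rightarrow> complex) set" where
  "form_domain L v \<sigma> = {\<phi> \<in> H1 L. quad_form L v \<sigma> \<phi> < \<infinity>}"

text \<open>The sesquilinear form obtained from \<open>quad_form\<close> by polarization.\<close>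

definition sesq_form ::
  "real \<Rightarrow> (nat \<Rightarrow> real) \<Rightarrow> (nat \<Rightarrow> real) \<Rightarrow> (real \<Rightarrow> complex) \<Rightarrow> (real \<Rightarrow> complex) \<Rightarrow> complex" where
  "sesq_form L v \<sigma> \<phi> \<psi> =
     L2_inner L (weak_deriv L \<phi>) (weak_deriv L \<psi>)
     + (\<Sum>n. complex_of_real (\<sigma> n) * (\<phi> (v n) * cnj (\<psi> (v n))))"

text \<open>
  The graph of the self-adjoint operator \<open>H\<^sub>\<sigma>\<close> that the representation theorem for closed forms
  associates with the form: \<open>H\<^sub>\<sigma> \<phi> = f\<close> iff \<open>\<phi>\<close> lies in the form domain and
  \<open>h\<^sup>\<sigma>(\<phi>, \<psi>) = \<langle>f, \<psi>\<rangle>\<close> for all \<open>\<psi>\<close> in the form domain. Here \<open>f\<close> is determined almost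
  everywhere, that is, as an element of \<open>L\<^sup>2(I)\<close>.
\<close>

definition delta_op ::
  "real \<Rightarrow> (nat \<Rightarrow> real) \<Rightarrow> (nat \<Rightarrow> real) \<Rightarrow> ((real \<Rightarrow> complex) \<times> (real \<Rightarrow> complex)) set" where
  "delta_op L v \<sigma> =
     {(\<phi>, f). \<phi> \<in> form_domain L v \<sigma> \<and> f \<in> L2 L \<and>
              (\<forall>\<psi>\<in>form_domain L v \<sigma>. sesq_form L v \<sigma> \<phi> \<psi> = L2_inner L f \<psi>)}"

definition eigenspace ::
  "real \<Rightarrow> (nat \<Rightarrow> real) \<Rightarrow> (nat \<Rightarrow> real) \<Rightarrow> real \<Rightarrow> (real \<Rightarrow> complex) set" where
  "eigenspace L v \<sigma> t = {\<phi>. (\<phi>, \<lambda>x. complex_of_real t * \<phi> x) \<in> delta_op L v \<sigma>}"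

interpretation cfun: vector_space "\<lambda>(c::complex) (f::real \<Rightarrow> complex) x. c * f x"
  by unfold_locales (simp_all add: fun_eq_iff algebra_simps)

text \<open>
  \<open>l\<close> lists the eigenvalues of \<open>H\<^sub>\<sigma>\<close> in nondecreasing order, each repeated according to its
  multiplicity. Numbers that are not eigenvalues have a zero eigenspace and are not listed. The
  value 0 of \<open>cfun.dim\<close> on infinite-dimensional spaces plays no role, because the spectrum is
  purely discrete and all eigenspaces are finite-dimensional.
\<close>

definition eigenvalue_enum ::
  "real \<Rightarrow> (nat \<Rightarrow> real) \<Rightarrow> (nat \<Rightarrow> real) \<Rightarrow> (nat \<Rightarrow> real) \<Rightarrow> bool" where
  "eigenvalue_enum L v \<sigma> l \<longleftrightarrow>
     mono l \<and>
     (\<forall>t. finite {n. l n = t} \<and> card {n. l n = t} = cfun.dim (eigenspace L v \<sigma> t))"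

definition eigval :: "real \<Rightarrow> (nat \<Rightarrow> real) \<Rightarrow> (nat \<Rightarrow> real) \<Rightarrow> nat \<Rightarrow> real" where
  "eigval L v \<sigma> = (THE l. eigenvalue_enum L v \<sigma> l)"

end

theory Submission
  imports Defs
begin

text \<open>
  Between two sites a solution of \<open>-\<phi>'' = k\<^sup>2 \<phi>\<close> is trigonometric, and at the site \<open>v n\<close> its slope
  jumps by \<open>\<sigma> n * \<phi> (v n)\<close>. Write \<open>\<phi>'/k + \<i> \<phi> = r cis \<theta>\<close> with the Pruefer angle \<open>\<theta>\<close>. The angle starts
  at \<open>pi/2\<close> (Neumann condition at 0), grows at rate \<open>k\<close> between sites, and is turned back at a site by an
  explicit amount, called \<open>kick\<close> below, that lies in \<open>[-\<sigma> n/k, 0]\<close> and equals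
  \<open>-(\<sigma> n/k) sin\<^sup>2 \<theta>\<close> to first order. The Neumann condition at \<open>L\<close> says that the cosine of the final angle
  vanishes. Larger \<open>k\<close> means faster rotation and weaker kicks, so the final angle is strictly increasing in
  \<open>k\<close> (\<open>final_angle_strict_mono\<close>); it is also continuous and nonnegative. Hence, if there
  is an interaction at all, the eigenvalue with index \<open>n\<close> is \<open>k\<^sub>n\<^sup>2\<close>, where the final angle of \<open>k\<^sub>n\<close> is \<open>pi/2 + n pi\<close>.

  Without interactions the final angle is \<open>k L + pi/2\<close>. With them it falls short of this by the
  \<open>deficit\<close>, the total of all kicks. Thus \<open>k\<^sub>n L = n pi + deficit k\<^sub>n\<close>, the deficit tends to 0, and
  the eigenvalue gap is \<open>(2/L) k\<^sub>n deficit k\<^sub>n\<close> up to a null sequence (\<open>eigenvalue_gap\<close>). The share of site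
  \<open>j\<close> in \<open>k\<^sub>n deficit k\<^sub>n\<close> lies in \<open>[0, \<sigma> j]\<close> and approaches \<open>\<sigma> j cos\<^sup>2 (n pi v j/L)\<close> for large \<open>n\<close>.
  The averages over \<open>n\<close> of the squared cosine tend to \<open>1/2\<close> at the sites in the interior of the interval but
  to 1 at the site 0, which explains the factor 2 in front of \<open>\<sigma> 0\<close>. Summability of \<open>\<sigma>\<close> allows the
  averages to be taken under the sum over the sites (\<open>average_total_shift\<close>).

  The operator is given by a form on weakly differentiable functions, and the link to the angle is as follows.
  Multiplying with cutoffs turns the definition of the weak derivative into integration by parts on
  subintervals with boundary terms (\<open>weak_deriv_integration_by_parts\<close>). Testing the eigenvalue equation with
  \<open>sin (k max 0 (y - x))\<close> then yields an integral equation for the eigenfunction that has, up to a factor,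
  only one solution \<open>sol k\<close> (\<open>eigenfunction_eq_sol\<close>); it is an eigenfunction iff its slope at \<open>L\<close>
  vanishes. So positive eigenvalues are simple, and the eigenvalues in increasing order are determined
  by their multiplicities (\<open>eigenvalue_enum_unique\<close>).
\<close>

section \<open>Weak derivatives on an interval\<close>

lemma C1_differentiable_onI:
  assumes "\<And>x. (f has_real_derivative f' x) (at x)" "continuous_on UNIV f'"
  shows "f C1_differentiable_on UNIV"
  using assms unfolding C1_differentiable_on_def has_real_derivative_iff_has_vector_derivative by blast

lemma continuous_integrable_on_Icc:
  fixes f :: "real \<Rightarrow> 'a::euclidean_space"
  assumes "continuous_on {0..L} f" shows "integrable (lebesgue_on {0..L}) f"
  using continuous_imp_integrable_real[OF assms] .

lemma measurable_Icc:
  fixes f :: "real \<Rightarrow> 'a::euclidean_space"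
  assumes "continuous_on {0..L} f" shows "f \<in> borel_measurable (lebesgue_on {0..L})"
  using continuous_imp_measurable_on_sets_lebesgue[OF assms] by simp

lemma indicator_Icc_measurable:
  "(indicator {a..b} :: real \<Rightarrow> real) \<in> borel_measurable (lebesgue_on S)"
  by (intro measurable_restrict_space1 borel_measurable_indicator) simp

lemma integrable_mult_bounded:
  fixes g u :: "'a \<Rightarrow> complex"
  assumes "integrable M g" "u \<in> borel_measurable M" "\<And>x. x \<in> space M \<Longrightarrow> cmod (u x) \<le> C"
  shows "integrable M (\<lambda>x. g x * u x)"
proof (rule Bochner_Integration.integrable_bound[where f = "\<lambda>x. C * cmod (g x)"])
  show "integrable M (\<lambda>x. C * cmod (g x))" using assms(1) by simp
  show "(\<lambda>x. g x * u x) \<in> borel_measurable M" using assms by measurable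
  show "AE x in M. norm (g x * u x) \<le> norm (C * cmod (g x))"
  proof (rule AE_I2)
    fix x assume "x \<in> space M"
    then have "cmod (u x) \<le> \<bar>C\<bar>" using assms(3) by fastforce
    then show "norm (g x * u x) \<le> norm (C * cmod (g x))"
      by (simp add: norm_mult abs_mult) (metis mult.commute mult_right_mono norm_ge_zero)
  qed
qed

text \<open>
  Test functions have to be continuously differentiable only once, so cutoffs can be built from \<open>t * \<bar>t\<bar>\<close>: the
  piecewise linear bump \<open>hat\<close> is a second difference of \<open>\<bar>t\<bar> / 2\<close>, and \<open>smooth_step\<close>, the same second difference
  of \<open>t * \<bar>t\<bar> / 4\<close>, is an antiderivative of it.
\<close>

definition hat :: "real \<Rightarrow> real" where "hat t = (\<bar>t - 1\<bar> + \<bar>t + 1\<bar> - 2 * \<bar>t\<bar>) / 2"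

definition smooth_step :: "real \<Rightarrow> real" where
  "smooth_step t = ((t - 1) * \<bar>t - 1\<bar> + (t + 1) * \<bar>t + 1\<bar> - 2 * (t * \<bar>t\<bar>)) / 4"

lemma DERIV_times_abs: "((\<lambda>t::real. t * \<bar>t\<bar>) has_real_derivative 2 * \<bar>t\<bar>) (at t)"
proof (cases "t = 0")
  case True
  have "((\<lambda>h::real. \<bar>h\<bar>) \<longlongrightarrow> 0) (at 0)" by (rule tendsto_eq_intros refl)+ simp
  then have "((\<lambda>h::real. h * \<bar>h\<bar> / h) \<longlongrightarrow> 0) (at 0)"
    by (rule Lim_transform_eventually) (auto simp: eventually_at_filter)
  then show ?thesis using True by (simp add: DERIV_def)
next
  case False
  then consider "t > 0" | "t < 0" by linarith
  then show ?thesis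
  proof cases
    case 1
    have "((\<lambda>t::real. t * t) has_real_derivative 2 * \<bar>t\<bar>) (at t)"
      using 1 by (auto intro!: derivative_eq_intros)
    then show ?thesis
      by (rule has_field_derivative_transform_within_open[of _ _ _ "{0<..}"]) (use 1 in auto)
  next
    case 2
    have "((\<lambda>t::real. t * (- t)) has_real_derivative 2 * \<bar>t\<bar>) (at t)"
      using 2 by (auto intro!: derivative_eq_intros)
    then show ?thesis
      by (rule has_field_derivative_transform_within_open[of _ _ _ "{..<0}"]) (use 2 in auto)
  qed
qed

lemma DERIV_smooth_step: "(smooth_step has_real_derivative hat t) (at t)"
proof -
  have "((\<lambda>t::real. (t - 1) * \<bar>t - 1\<bar>) has_real_derivative 2 * \<bar>t - 1\<bar>) (at t)"
       "((\<lambda>t::real. (t + 1) * \<bar>t + 1\<bar>) has_real_derivative 2 * \<bar>t + 1\<bar>) (at t)"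
    using DERIV_chain2[where f = "\<lambda>t::real. t * \<bar>t\<bar>" and g = "\<lambda>t. t - 1" and Db = 1 and x = t, OF DERIV_times_abs]
          DERIV_chain2[where f = "\<lambda>t::real. t * \<bar>t\<bar>" and g = "\<lambda>t. t + 1" and Db = 1 and x = t, OF DERIV_times_abs]
    by (simp_all add: DERIV_diff[OF DERIV_ident DERIV_const, simplified] DERIV_add[OF DERIV_ident DERIV_const, simplified])
  from DERIV_cdivide[OF DERIV_diff[OF DERIV_add[OF this] DERIV_cmult[OF DERIV_times_abs[of t], of 2]], of 4]
  have "(smooth_step has_real_derivative (2 * \<bar>t - 1\<bar> + 2 * \<bar>t + 1\<bar> - 2 * (2 * \<bar>t\<bar>)) / 4) (at t)"
    by (simp only: smooth_step_def[abs_def])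
  moreover have "(2 * \<bar>t - 1\<bar> + 2 * \<bar>t + 1\<bar> - 2 * (2 * \<bar>t\<bar>)) / 4 = hat t"
    by (simp add: hat_def field_simps)
  ultimately show ?thesis by simp
qed

lemma smooth_step_left:
  assumes "t \<le> -1" shows "smooth_step t = - 1/2"
proof -
  have "\<bar>t - 1\<bar> = 1 - t" "\<bar>t + 1\<bar> = - 1 - t" "\<bar>t\<bar> = - t" using assms by auto
  then show ?thesis by (simp add: smooth_step_def algebra_simps)
qed

lemma smooth_step_right:
  assumes "t \<ge> 1" shows "smooth_step t = 1/2"
proof -
  have "\<bar>t - 1\<bar> = t - 1" "\<bar>t + 1\<bar> = t + 1" "\<bar>t\<bar> = t" using assms by auto
  then show ?thesis by (simp add: smooth_step_def algebra_simps)
qed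

lemma hat_nonneg: "hat t \<ge> 0"
  by (auto simp: hat_def abs_if)

lemma hat_outside: assumes "\<bar>t\<bar> \<ge> 1" shows "hat t = 0"
proof -
  from assms consider "t \<ge> 1" | "t \<le> -1" by linarith
  then show ?thesis by cases (auto simp: hat_def)
qed

lemma continuous_hat [continuous_intros]:
  "continuous_on A f \<Longrightarrow> continuous_on A (\<lambda>x. hat (f x))"
  unfolding hat_def by (intro continuous_intros) auto

lemma smooth_step_mono: "s \<le> t \<Longrightarrow> smooth_step s \<le> smooth_step t"
  by (rule DERIV_nonneg_imp_nondecreasing) (use DERIV_smooth_step hat_nonneg in blast)+

lemma smooth_step_bounds: "- 1/2 \<le> smooth_step t" "smooth_step t \<le> 1/2"
  using smooth_step_mono[of "min t (-1)" t] smooth_step_mono[of t "max t 1"]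
    smooth_step_left[of "min t (-1)"] smooth_step_right[of "max t 1"] by auto

text \<open>
  An approximate identity. Since the densities are supported in shrinking neighbourhoods of \<open>a\<close>, the error is
  at most the oscillation of \<open>F\<close> there. The point \<open>a\<close> may be an end of the interval; the whole mass is then
  on one side of it.
\<close>

lemma approximate_delta:
  fixes F :: "real \<Rightarrow> complex"
  assumes F: "continuous_on {0..L} F" and a: "a \<in> {0..L}"
    and cont: "\<And>n. continuous_on {0..L} (\<rho> n)" and nonneg: "\<And>n x. \<rho> n x \<ge> 0"
    and mass: "\<And>n. (LINT x|lebesgue_on {0..L}. \<rho> n x) = 1"
    and supp: "\<And>n x. \<bar>x - a\<bar> > r n \<Longrightarrow> \<rho> n x = 0" and r: "r \<longlonglongrightarrow> (0::real)"
  shows "(\<lambda>n. LINT x|lebesgue_on {0..L}. F x * of_real (\<rho> n x)) \<longlonglongrightarrow> F a"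
proof (rule LIMSEQ_I)
  let ?M = "lebesgue_on {0..L}"
  fix e :: real assume e: "e > 0"
  from F a have "\<exists>d>0. \<forall>x\<in>{0..L}. dist x a < d \<longrightarrow> dist (F x) (F a) < e / 2"
    using e half_gt_zero unfolding continuous_on_iff by blast
  then obtain d where d: "d > 0" "\<And>x. x \<in> {0..L} \<Longrightarrow> \<bar>x - a\<bar> < d \<Longrightarrow> cmod (F x - F a) < e / 2"
    by (auto simp: dist_norm)
  obtain N where N: "\<And>n. n \<ge> N \<Longrightarrow> norm (r n - 0) < d" using LIMSEQ_D[OF r d(1)] by blast
  show "\<exists>N. \<forall>n\<ge>N. norm ((LINT x|?M. F x * of_real (\<rho> n x)) - F a) < e"
  proof (intro exI allI impI)
    fix n assume n: "n \<ge> N"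
    have ir: "integrable ?M (\<rho> n)" using cont by (rule continuous_integrable_on_Icc)
    have irc: "integrable ?M (\<lambda>x. complex_of_real (\<rho> n x))"
      by (intro continuous_integrable_on_Icc continuous_intros cont)
    have iF: "integrable ?M (\<lambda>x. F x * of_real (\<rho> n x))"
      by (intro continuous_integrable_on_Icc continuous_intros F cont)
    have "(LINT x|?M. F x * of_real (\<rho> n x)) - F a
        = (LINT x|?M. F x * of_real (\<rho> n x)) - F a * (LINT x|?M. complex_of_real (\<rho> n x))"
      using mass[of n] by simp
    also have "\<dots> = (LINT x|?M. (F x - F a) * of_real (\<rho> n x))"
      using iF irc by (simp add: left_diff_distrib)
    finally have eq: "(LINT x|?M. F x * of_real (\<rho> n x)) - F a = \<dots>" .
    have "cmod \<dots> \<le> (LINT x|?M. cmod ((F x - F a) * of_real (\<rho> n x)))"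
      by (rule integral_norm_bound)
    also have "\<dots> \<le> (LINT x|?M. e / 2 * \<rho> n x)"
    proof (rule integral_mono)
      show "integrable ?M (\<lambda>x. cmod ((F x - F a) * of_real (\<rho> n x)))"
        by (intro continuous_integrable_on_Icc continuous_intros F cont)
      show "integrable ?M (\<lambda>x. e / 2 * \<rho> n x)" using ir by simp
      fix x assume "x \<in> space ?M"
      then have x: "x \<in> {0..L}" by simp
      show "cmod ((F x - F a) * of_real (\<rho> n x)) \<le> e / 2 * \<rho> n x"
      proof (cases "\<bar>x - a\<bar> < d")
        case True
        then show ?thesis using d(2)[OF x] nonneg[of n x]
          unfolding norm_mult norm_of_real using e by (intro mult_mono) auto
      next
        case False
        then have "\<bar>x - a\<bar> > r n" using N[OF n] by auto
        then show ?thesis using supp by simp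
      qed
    qed
    also have "\<dots> = e / 2" using mass[of n] by simp
    also have "\<dots> < e" using e by simp
    finally show "norm ((LINT x|?M. F x * of_real (\<rho> n x)) - F a) < e" unfolding eq .
  qed
qed

lemma integral_of_derivative_Icc:
  fixes F :: "real \<Rightarrow> real"
  assumes "a \<le> b" "\<And>x. (F has_real_derivative f x) (at x)" "continuous_on UNIV f"
  shows "(LINT x|lebesgue_on {a..b}. f x) = F b - F a"
proof -
  have "(f has_integral (F b - F a)) {a..b}"
    using assms(1,2) by (intro fundamental_theorem_of_calculus)
      (auto simp: has_real_derivative_iff_has_vector_derivative intro: has_vector_derivative_at_within)
  moreover have "(f has_integral (LINT x|lebesgue_on {a..b}. f x)) {a..b}"
    by (intro has_integral_integral_lebesgue_on continuous_imp_integrable_real continuous_on_subset[OF assms(3)]) auto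
  ultimately show ?thesis by (rule has_integral_unique[symmetric])
qed

text \<open>
  The definition of the weak derivative is applied to \<open>u\<close> times a cutoff that converges to the indicator of
  \<open>[a, b]\<close>. The derivative of the cutoff is an approximate delta at \<open>a\<close> minus one at \<open>b\<close>, and these
  produce the boundary terms. The cutoff vanishes near \<open>a\<close> and near \<open>b\<close>, so that the product is a test
  function even for \<open>a = 0\<close> or \<open>b = L\<close>.
\<close>

lemma weak_deriv_integration_by_parts:
  fixes \<psi> g :: "real \<Rightarrow> complex" and u u' :: "real \<Rightarrow> real"
  assumes \<psi>: "continuous_on {0..L} \<psi>" and g: "integrable (lebesgue_on {0..L}) g"
    and weak: "has_weak_deriv L \<psi> g"
    and ab: "0 \<le> a" "a < b" "b \<le> L"
    and u: "\<And>x. (u has_real_derivative u' x) (at x)" and u': "continuous_on UNIV u'"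
  shows "(LINT x|lebesgue_on {0..L}. g x * of_real (u x * indicator {a..b} x))
       = \<psi> b * u b - \<psi> a * u a - (LINT x|lebesgue_on {0..L}. \<psi> x * of_real (u' x * indicator {a..b} x))"
proof -
  let ?M = "lebesgue_on {0..L}"
  \<comment> \<open>The cutoff rises around \<open>a + 2 \<epsilon>\<close> and falls around \<open>b - 2 \<epsilon>\<close>. Since \<open>4 \<epsilon> \<le> b - a\<close>, the rise is
      not centred to the right of the fall, and the cutoff is nonnegative.\<close>
  define \<epsilon> where "\<epsilon> n = (b - a) / (4 * real (Suc n))" for n
  have \<epsilon>: "\<epsilon> n > 0" "4 * \<epsilon> n \<le> b - a" for n
  proof -
    show "\<epsilon> n > 0" using ab by (simp add: \<epsilon>_def)
    have "4 * \<epsilon> n = (b - a) / real (Suc n)" by (simp only: \<epsilon>_def times_divide_eq_right mult_divide_mult_cancel_left_if) simp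
    also have "\<dots> \<le> (b - a) / 1" using ab by (intro divide_left_mono) auto
    finally show "4 * \<epsilon> n \<le> b - a" by simp
  qed
  have \<epsilon>0: "\<epsilon> \<longlonglongrightarrow> 0"
  proof -
    have "(\<lambda>n. (b - a) / 4 * (1 / real (Suc n))) \<longlonglongrightarrow> (b - a) / 4 * 0"
      by (intro tendsto_mult tendsto_const LIMSEQ_Suc[OF lim_1_over_n])
    then show ?thesis by (simp add: \<epsilon>_def[abs_def])
  qed
  define up where "up n x = hat ((x - a) / \<epsilon> n - 2) / \<epsilon> n" for n x
  define down where "down n x = hat ((x - b) / \<epsilon> n + 2) / \<epsilon> n" for n x
  define cut where "cut n x = smooth_step ((x - a) / \<epsilon> n - 2) - smooth_step ((x - b) / \<epsilon> n + 2)" for n x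
  have dup: "((\<lambda>x. smooth_step ((x - a) / \<epsilon> n - 2)) has_real_derivative up n x) (at x)" for n x
  proof -
    have "((\<lambda>x. (x - a) / \<epsilon> n - 2) has_real_derivative 1 / \<epsilon> n) (at x)"
      using \<epsilon>(1)[of n] by (auto intro!: derivative_eq_intros)
    from DERIV_chain2[OF DERIV_smooth_step this] show ?thesis by (simp add: up_def)
  qed
  have ddown: "((\<lambda>x. smooth_step ((x - b) / \<epsilon> n + 2)) has_real_derivative down n x) (at x)" for n x
  proof -
    have "((\<lambda>x. (x - b) / \<epsilon> n + 2) has_real_derivative 1 / \<epsilon> n) (at x)"
      using \<epsilon>(1)[of n] by (auto intro!: derivative_eq_intros)
    from DERIV_chain2[OF DERIV_smooth_step this] show ?thesis by (simp add: down_def)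
  qed
  have cont_up: "continuous_on A (up n)" and cont_down: "continuous_on A (down n)" for A n
    unfolding up_def[abs_def] down_def[abs_def] using \<epsilon>(1)[of n] by (auto intro!: continuous_intros)
  have cont_cut: "continuous_on A (cut n)" for A n
    unfolding cut_def[abs_def]
    by (intro continuous_on_diff DERIV_continuous_on[OF DERIV_subset[OF dup]] DERIV_continuous_on[OF DERIV_subset[OF ddown]]) auto
  have cont_u: "continuous_on A u" for A
    by (intro DERIV_continuous_on[OF DERIV_subset[OF u]]) auto
  have cont_u': "continuous_on A u'" for A using u' continuous_on_subset by blast
  have cut_bounds: "0 \<le> cut n x" "cut n x \<le> 1" for n x
  proof -
    have "4 \<le> (b - a) / \<epsilon> n" using \<epsilon>[of n] by (simp add: pos_le_divide_eq)
    then have "(x - b) / \<epsilon> n + 2 \<le> (x - a) / \<epsilon> n - 2" by (simp add: diff_divide_distrib)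
    from smooth_step_mono[OF this] show "0 \<le> cut n x" by (simp add: cut_def)
    show "cut n x \<le> 1"
      using smooth_step_bounds[of "(x - a) / \<epsilon> n - 2"] smooth_step_bounds[of "(x - b) / \<epsilon> n + 2"]
      by (simp add: cut_def)
  qed
  have cut_outside: "cut n x = 0" if "x \<le> a + \<epsilon> n \<or> x \<ge> b - \<epsilon> n" for n x
    using that
  proof
    assume "x \<le> a + \<epsilon> n"
    then have "(x - a) / \<epsilon> n - 2 \<le> -1" "(x - b) / \<epsilon> n + 2 \<le> -1" using \<epsilon>[of n] by (auto simp: field_simps)
    then show ?thesis by (simp add: cut_def smooth_step_left)
  next
    assume "x \<ge> b - \<epsilon> n"
    then have "(x - a) / \<epsilon> n - 2 \<ge> 1" "(x - b) / \<epsilon> n + 2 \<ge> 1" using \<epsilon>[of n] by (auto simp: field_simps)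
    then show ?thesis by (simp add: cut_def smooth_step_right)
  qed
  have cut_inside: "cut n x = 1" if "a + 3 * \<epsilon> n \<le> x" "x \<le> b - 3 * \<epsilon> n" for n x
  proof -
    have "(x - a) / \<epsilon> n - 2 \<ge> 1" "(x - b) / \<epsilon> n + 2 \<le> -1" using \<epsilon>[of n] that by (auto simp: field_simps)
    then show ?thesis by (simp add: cut_def smooth_step_right smooth_step_left)
  qed
  have cut_lim: "(\<lambda>n. cut n x) \<longlonglongrightarrow> indicator {a..b} x" if "x \<noteq> a" "x \<noteq> b" for x
  proof (cases "x \<in> {a..b}")
    case True
    then have x: "a < x" "x < b" using that by auto
    have t3: "(\<lambda>n. 3 * \<epsilon> n) \<longlonglongrightarrow> 3 * 0" by (intro tendsto_mult tendsto_const \<epsilon>0)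
    have "eventually (\<lambda>n. 3 * \<epsilon> n < x - a) sequentially" "eventually (\<lambda>n. 3 * \<epsilon> n < b - x) sequentially"
      using order_tendstoD(2)[OF t3] x by auto
    then have "eventually (\<lambda>n. cut n x = indicator {a..b} x) sequentially"
      by eventually_elim (use True in \<open>auto intro!: cut_inside\<close>)
    then show ?thesis by (rule tendsto_eventually)
  next
    case False
    then have "cut n x = 0" for n using \<epsilon>(1)[of n] by (intro cut_outside) auto
    then show ?thesis using False by simp
  qed
  have test: "(\<lambda>x. u x * cut n x) \<in> test_functions L" for n
  proof -
    have "(\<lambda>x. u x * cut n x) C1_differentiable_on UNIV"
    proof (rule C1_differentiable_onI)
      show "((\<lambda>x. u x * cut n x) has_real_derivative u' x * cut n x + (up n x - down n x) * u x) (at x)" for x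
        unfolding cut_def by (rule DERIV_mult[OF u DERIV_diff[OF dup ddown]])
      show "continuous_on UNIV (\<lambda>x. u' x * cut n x + (up n x - down n x) * u x)"
        by (intro continuous_intros cont_u cont_u' cont_cut cont_up cont_down)
    qed
    moreover have "closure {x. u x * cut n x \<noteq> 0} \<subseteq> {a + \<epsilon> n .. b - \<epsilon> n}"
    proof (rule closure_minimal)
      show "{x. u x * cut n x \<noteq> 0} \<subseteq> {a + \<epsilon> n .. b - \<epsilon> n}"
      proof
        fix x assume "x \<in> {x. u x * cut n x \<noteq> 0}"
        then have "\<not> (x \<le> a + \<epsilon> n \<or> x \<ge> b - \<epsilon> n)" using cut_outside[of x n] by auto
        then show "x \<in> {a + \<epsilon> n .. b - \<epsilon> n}" by simp
      qed
    qed simp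
    moreover have "{a + \<epsilon> n .. b - \<epsilon> n} \<subseteq> {0<..<L}" using \<epsilon>(1)[of n] ab by auto
    ultimately show ?thesis unfolding test_functions_def by blast
  qed
  have vd: "vector_derivative (\<lambda>x. u x * cut n x) (at x) = u' x * cut n x + (up n x - down n x) * u x" for n x
    by (rule vector_derivative_at)
      (use DERIV_mult[OF u DERIV_diff[OF dup ddown]] in \<open>simp add: cut_def has_real_derivative_iff_has_vector_derivative\<close>)
  have key: "(LINT x|?M. \<psi> x * of_real (u' x * cut n x)) + (LINT x|?M. \<psi> x * u x * of_real (up n x))
      - (LINT x|?M. \<psi> x * u x * of_real (down n x)) = - (LINT x|?M. g x * of_real (u x * cut n x))" for n
  proof -
    have i: "integrable ?M (\<lambda>x. \<psi> x * of_real (u' x * cut n x))"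
      "integrable ?M (\<lambda>x. \<psi> x * u x * of_real (up n x))" "integrable ?M (\<lambda>x. \<psi> x * u x * of_real (down n x))"
      by (intro continuous_integrable_on_Icc continuous_intros \<psi> cont_u cont_u' cont_cut cont_up cont_down)+
    have "(LINT x|?M. \<psi> x * of_real (vector_derivative (\<lambda>x. u x * cut n x) (at x)))
        = (LINT x|?M. \<psi> x * of_real (u' x * cut n x) + \<psi> x * u x * of_real (up n x) - \<psi> x * u x * of_real (down n x))"
      unfolding vd by (rule Bochner_Integration.integral_cong) (auto simp: algebra_simps)
    also have "\<dots> = (LINT x|?M. \<psi> x * of_real (u' x * cut n x)) + (LINT x|?M. \<psi> x * u x * of_real (up n x))
      - (LINT x|?M. \<psi> x * u x * of_real (down n x))" using i by simp
    finally show ?thesis using weak[unfolded has_weak_deriv_def, rule_format, OF test[of n]] by simp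
  qed
  have cont_F: "continuous_on {0..L} (\<lambda>x. \<psi> x * complex_of_real (u x))"
    by (intro continuous_intros \<psi> cont_u)
  have r0: "(\<lambda>n. 3 * \<epsilon> n) \<longlonglongrightarrow> 0" using tendsto_mult[OF tendsto_const[of 3] \<epsilon>0] by simp
  have lim_up: "(\<lambda>n. LINT x|?M. \<psi> x * u x * of_real (up n x)) \<longlonglongrightarrow> \<psi> a * u a"
  proof -
    have mem: "a \<in> {0..L}" using ab by auto
    have nonneg: "0 \<le> up n x" for n x using \<epsilon>(1)[of n] by (simp add: up_def hat_nonneg)
    have mass: "(LINT x|?M. up n x) = 1" for n
    proof -
      have "4 \<le> (L - a) / \<epsilon> n" using \<epsilon>[of n] ab by (simp add: pos_le_divide_eq)
      moreover have "(0 - a) / \<epsilon> n \<le> 0" using \<epsilon>(1)[of n] ab by (intro divide_nonpos_pos) auto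
      ultimately have "(L - a) / \<epsilon> n - 2 \<ge> 1" "(0 - a) / \<epsilon> n - 2 \<le> -1" by linarith+
      then show ?thesis
        using integral_of_derivative_Icc[OF _ dup cont_up, of 0 L n] ab
        by (simp add: smooth_step_left smooth_step_right)
    qed
    have supp: "up n x = 0" if "3 * \<epsilon> n < \<bar>x - a\<bar>" for n x
    proof -
      have "3 \<le> \<bar>(x - a) / \<epsilon> n\<bar>" using \<epsilon>(1)[of n] that by (simp add: abs_divide pos_le_divide_eq)
      then have "\<bar>(x - a) / \<epsilon> n - 2\<bar> \<ge> 1" by linarith
      then show ?thesis by (simp add: up_def hat_outside)
    qed
    show ?thesis
      by (rule approximate_delta[where \<rho> = up and r = "\<lambda>n. 3 * \<epsilon> n", OF cont_F mem cont_up nonneg mass supp r0])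
  qed
  have lim_down: "(\<lambda>n. LINT x|?M. \<psi> x * u x * of_real (down n x)) \<longlonglongrightarrow> \<psi> b * u b"
  proof -
    have mem: "b \<in> {0..L}" using ab by auto
    have nonneg: "0 \<le> down n x" for n x using \<epsilon>(1)[of n] by (simp add: down_def hat_nonneg)
    have mass: "(LINT x|?M. down n x) = 1" for n
    proof -
      have "0 \<le> (L - b) / \<epsilon> n" using \<epsilon>(1)[of n] ab by (intro divide_nonneg_pos) auto
      moreover have "4 \<le> (b - 0) / \<epsilon> n" using \<epsilon>[of n] ab by (simp add: pos_le_divide_eq)
      ultimately have "(L - b) / \<epsilon> n + 2 \<ge> 1" "(0 - b) / \<epsilon> n + 2 \<le> -1" by (auto simp: minus_divide_left[symmetric])
      then show ?thesis
        using integral_of_derivative_Icc[OF _ ddown cont_down, of 0 L n] ab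
        by (simp add: smooth_step_left smooth_step_right)
    qed
    have supp: "down n x = 0" if "3 * \<epsilon> n < \<bar>x - b\<bar>" for n x
    proof -
      have "3 \<le> \<bar>(x - b) / \<epsilon> n\<bar>" using \<epsilon>(1)[of n] that by (simp add: abs_divide pos_le_divide_eq)
      then have "\<bar>(x - b) / \<epsilon> n + 2\<bar> \<ge> 1" by linarith
      then show ?thesis by (simp add: down_def hat_outside)
    qed
    show ?thesis
      by (rule approximate_delta[where \<rho> = down and r = "\<lambda>n. 3 * \<epsilon> n", OF cont_F mem cont_down nonneg mass supp r0])
  qed
  have lim_cut: "(\<lambda>n. LINT x|?M. f x * of_real (w x * cut n x)) \<longlonglongrightarrow> (LINT x|?M. f x * of_real (w x * indicator {a..b} x))"
    if f: "integrable ?M f" and w: "continuous_on {0..L} w" for f :: "real \<Rightarrow> complex" and w :: "real \<Rightarrow> real"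
  proof -
    have "\<exists>C. \<forall>x\<in>{0..L}. \<bar>w x\<bar> \<le> C"
      using compact_imp_bounded[OF compact_continuous_image[OF w compact_Icc]] by (simp add: bounded_iff)
    then obtain C where C: "\<And>x. x \<in> {0..L} \<Longrightarrow> \<bar>w x\<bar> \<le> C" by blast
    have m: "w \<in> borel_measurable ?M" "f \<in> borel_measurable ?M" "cut n \<in> borel_measurable ?M" for n
      using w f measurable_Icc cont_cut by auto
    have mi: "(indicator {a..b} :: real \<Rightarrow> real) \<in> borel_measurable ?M"
      by (rule indicator_Icc_measurable)
    show ?thesis
    proof (rule integral_dominated_convergence[where w = "\<lambda>x. C * cmod (f x)"])
      show "(\<lambda>x. f x * of_real (w x * indicator {a..b} x)) \<in> borel_measurable ?M"
        using m mi by measurable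
      show "(\<lambda>x. f x * of_real (w x * cut n x)) \<in> borel_measurable ?M" for n
        using m(1,2) m(3)[of n] by measurable
      show "integrable ?M (\<lambda>x. C * cmod (f x))" using f by simp
      have "AE x in ?M. x \<notin> {a, b}"
        using ab by (intro AE_not_in) (auto simp: null_sets_restrict_space)
      then show "AE x in ?M. (\<lambda>n. f x * of_real (w x * cut n x)) \<longlonglongrightarrow> f x * of_real (w x * indicator {a..b} x)"
        by eventually_elim (auto intro!: tendsto_intros cut_lim)
      show "AE x in ?M. cmod (f x * of_real (w x * cut n x)) \<le> C * cmod (f x)" for n
      proof (rule AE_I2)
        fix x assume "x \<in> space ?M"
        then have "\<bar>w x\<bar> * \<bar>cut n x\<bar> \<le> C * 1"
          using C[of x] cut_bounds[of n x] by (intro mult_mono) auto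
        then show "cmod (f x * of_real (w x * cut n x)) \<le> C * cmod (f x)"
          using mult_left_mono[of "\<bar>w x\<bar> * \<bar>cut n x\<bar>" "C * 1" "cmod (f x)"]
          by (simp add: norm_mult mult.commute)
      qed
    qed
  qed
  have "(\<lambda>n. (LINT x|?M. \<psi> x * of_real (u' x * cut n x)) + (LINT x|?M. \<psi> x * u x * of_real (up n x))
      - (LINT x|?M. \<psi> x * u x * of_real (down n x)))
    \<longlonglongrightarrow> (LINT x|?M. \<psi> x * of_real (u' x * indicator {a..b} x)) + \<psi> a * u a - \<psi> b * u b"
    by (intro tendsto_intros lim_up lim_down lim_cut continuous_integrable_on_Icc \<psi> cont_u')
  moreover have "(\<lambda>n. - (LINT x|?M. g x * of_real (u x * cut n x)))
     \<longlonglongrightarrow> - (LINT x|?M. g x * of_real (u x * indicator {a..b} x))"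
    by (intro tendsto_intros lim_cut g cont_u)
  ultimately have "(LINT x|?M. \<psi> x * of_real (u' x * indicator {a..b} x)) + \<psi> a * u a - \<psi> b * u b
      = - (LINT x|?M. g x * of_real (u x * indicator {a..b} x))"
    unfolding key by (rule LIMSEQ_unique)
  then show ?thesis by (simp add: algebra_simps eq_neg_iff_add_eq_0)
qed

lemma of_real_indicator_Icc_measurable:
  "(\<lambda>x. complex_of_real (indicator {a..b::real} x)) \<in> borel_measurable (lebesgue_on S)"
proof (rule measurable_compose[where g = complex_of_real, OF indicator_Icc_measurable])
  show "complex_of_real \<in> borel_measurable borel"
    by (intro borel_measurable_continuous_onI continuous_on_of_real continuous_on_id)
qed

text \<open>
  By Lebesgue's differentiation theorem, the averages of \<open>h\<close> over \<open>[x, x + t]\<close> tend to \<open>h x\<close> for almost every \<open>x\<close>.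
\<close>

lemma AE_eq_0_if_integral_intervals_eq_0:
  fixes h :: "real \<Rightarrow> complex"
  assumes h: "integrable (lebesgue_on {0..L}) h"
    and zero: "\<And>a b. 0 \<le> a \<Longrightarrow> a < b \<Longrightarrow> b \<le> L \<Longrightarrow>
      (LINT x|lebesgue_on {0..L}. h x * of_real (indicator {a..b} x)) = 0"
  shows "AE x in lebesgue_on {0..L}. h x = 0"
proof -
  define F where "F x = (if x \<in> {0..L} then h x else 0)" for x
  have "h integrable_on {0..L}" using h by (rule integrable_on_lebesgue_on) simp
  then have "F integrable_on UNIV" unfolding F_def[abs_def] by (simp only: integrable_restrict_UNIV)
  then have "F integrable_on cbox a b" for a b using integrable_on_subcbox by blast
  then obtain N where N: "negligible N" "\<And>x e. x \<notin> N \<Longrightarrow> 0 < e \<Longrightarrow>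
     \<exists>d>0. \<forall>t. 0 < t \<and> t < d \<longrightarrow> norm (integral (cbox x (x + t *\<^sub>R One)) F /\<^sub>R t ^ DIM(real) - F x) < e"
    using integrable_ccontinuous_explicit[of F] by blast
  have int0: "integral {a..b} F = 0" if "0 \<le> a" "a < b" "b \<le> L" for a b
  proof -
    have "integrable (lebesgue_on {0..L}) (\<lambda>x. h x * of_real (indicator {a..b} x))"
      by (rule integrable_mult_bounded[OF h, where C = 1])
         (simp_all add: of_real_indicator_Icc_measurable split: split_indicator)
    from has_integral_integral_lebesgue_on[OF this]
    have "((\<lambda>x. h x * of_real (indicator {a..b} x)) has_integral 0) {0..L}" by (simp add: zero that)
    then have "((\<lambda>x. if x \<in> {a..b} then F x else 0) has_integral 0) {0..L}"
      by (rule has_integral_eq[rotated]) (auto simp: F_def)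
    then have "(F has_integral 0) {a..b}" using that by (subst (asm) has_integral_restrict) auto
    then show ?thesis by (rule integral_unique)
  qed
  have F0: "F x = 0" if "x \<notin> N" "0 < x" "x < L" for x
  proof -
    have "norm (F x) < e" if "e > 0" for e
    proof -
      obtain d where d: "d > 0" "\<And>t. 0 < t \<Longrightarrow> t < d \<Longrightarrow>
        norm (integral (cbox x (x + t *\<^sub>R One)) F /\<^sub>R t ^ DIM(real) - F x) < e"
        using N(2)[OF \<open>x \<notin> N\<close> \<open>e > 0\<close>] by blast
      define t where "t = min (d / 2) (L - x)"
      have t: "0 < t" "t < d" "x + t \<le> L" using d(1) \<open>x < L\<close> by (auto simp: t_def)
      have "integral {x..x + t} F = 0" using t \<open>0 < x\<close> by (intro int0) auto
      then show ?thesis using d(2)[OF t(1,2)] by simp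
    qed
    then have "\<not> 0 < norm (F x)" by blast
    then show ?thesis by simp
  qed
  have "negligible (N \<union> {0, L})" using N(1) by simp
  then have "N \<union> {0, L} \<in> null_sets lebesgue" by (simp only: negligible_iff_null_sets)
  then have "AE x in lebesgue. x \<notin> N \<union> {0, L}" by (rule AE_not_in)
  then have "AE x in lebesgue. x \<in> {0..L} \<longrightarrow> h x = 0"
  proof eventually_elim
    case (elim x)
    then show ?case using F0[of x] by (auto simp: F_def)
  qed
  then show ?thesis by (subst AE_restrict_space_iff) auto
qed

lemma finite_measure_Icc: "finite_measure (lebesgue_on {0..L::real})"
  by (rule finite_measure_lebesgue_on) auto

lemma L2_imp_integrable:
  assumes "f \<in> L2 L" shows "integrable (lebesgue_on {0..L}) f"
proof -
  interpret finite_measure "lebesgue_on {0..L}" by (rule finite_measure_Icc)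
  have sq: "integrable (lebesgue_on {0..L}) (\<lambda>x. (cmod (f x))\<^sup>2)" and m: "f \<in> borel_measurable (lebesgue_on {0..L})"
    using assms by (auto simp: L2_def)
  show ?thesis
  proof (rule Bochner_Integration.integrable_bound[OF _ m])
    show "integrable (lebesgue_on {0..L}) (\<lambda>x. 1 + (cmod (f x))\<^sup>2)" using sq by simp
    show "AE x in lebesgue_on {0..L}. norm (f x) \<le> norm (1 + (cmod (f x))\<^sup>2)"
    proof (rule AE_I2)
      fix x
      have "0 \<le> (cmod (f x) - 1)\<^sup>2" by simp
      then have "2 * cmod (f x) \<le> 1 + (cmod (f x))\<^sup>2" by (simp add: power2_diff)
      then show "norm (f x) \<le> norm (1 + (cmod (f x))\<^sup>2)" using norm_ge_zero[of "f x"] unfolding real_norm_def by linarith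
    qed
  qed
qed

lemma continuous_imp_L2:
  assumes "continuous_on {0..L} f" shows "f \<in> L2 L"
  unfolding L2_def using assms
  by (auto intro!: continuous_integrable_on_Icc measurable_Icc continuous_intros)

lemma bounded_imp_L2:
  assumes m: "f \<in> borel_measurable (lebesgue_on {0..L})" and C: "\<And>x. x \<in> {0..L} \<Longrightarrow> cmod (f x) \<le> C"
  shows "f \<in> L2 L"
proof -
  interpret finite_measure "lebesgue_on {0..L}" by (rule finite_measure_Icc)
  have "integrable (lebesgue_on {0..L}) (\<lambda>x. (cmod (f x))\<^sup>2)"
  proof (rule integrable_const_bound[where B = "C\<^sup>2"])
    show "AE x in lebesgue_on {0..L}. norm ((cmod (f x))\<^sup>2) \<le> C\<^sup>2"
      using C by (intro AE_I2) (auto intro!: power_mono)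
    show "(\<lambda>x. (cmod (f x))\<^sup>2) \<in> borel_measurable (lebesgue_on {0..L})" using m by measurable
  qed
  then show ?thesis using m by (simp add: L2_def)
qed

lemma H1_weak_deriv:
  assumes "\<phi> \<in> H1 L"
  shows "weak_deriv L \<phi> \<in> L2 L" "has_weak_deriv L \<phi> (weak_deriv L \<phi>)"
proof -
  have "\<exists>g. g \<in> L2 L \<and> has_weak_deriv L \<phi> g" using assms by (auto simp: H1_def)
  from someI_ex[OF this] show "weak_deriv L \<phi> \<in> L2 L" "has_weak_deriv L \<phi> (weak_deriv L \<phi>)"
    unfolding weak_deriv_def by auto
qed

lemma weak_deriv_unique_AE:
  assumes \<psi>: "continuous_on {0..L} \<psi>"
    and "integrable (lebesgue_on {0..L}) g1" "has_weak_deriv L \<psi> g1"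
    and "integrable (lebesgue_on {0..L}) g2" "has_weak_deriv L \<psi> g2"
  shows "AE x in lebesgue_on {0..L}. g1 x = g2 x"
proof -
  have "AE x in lebesgue_on {0..L}. g1 x - g2 x = 0"
  proof (rule AE_eq_0_if_integral_intervals_eq_0)
    show "integrable (lebesgue_on {0..L}) (\<lambda>x. g1 x - g2 x)" using assms by simp
    fix a b assume ab: "0 \<le> a" "a < b" "b \<le> L"
    have i: "integrable (lebesgue_on {0..L}) (\<lambda>x. g x * of_real (indicator {a..b} x))"
      if "integrable (lebesgue_on {0..L}) g" for g :: "real \<Rightarrow> complex"
      by (rule integrable_mult_bounded[OF that, where C = 1])
         (simp_all add: of_real_indicator_Icc_measurable split: split_indicator)
    have "(LINT x|lebesgue_on {0..L}. g1 x * of_real (indicator {a..b} x))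
        = (LINT x|lebesgue_on {0..L}. g2 x * of_real (indicator {a..b} x))"
      using weak_deriv_integration_by_parts[OF \<psi> assms(2,3) ab, of "\<lambda>_. 1" "\<lambda>_. 0"]
        weak_deriv_integration_by_parts[OF \<psi> assms(4,5) ab, of "\<lambda>_. 1" "\<lambda>_. 0"] by simp
    then show "(LINT x|lebesgue_on {0..L}. (g1 x - g2 x) * of_real (indicator {a..b} x)) = 0"
      using i[OF assms(2)] i[OF assms(4)] by (simp add: left_diff_distrib)
  qed
  then show ?thesis by simp
qed

lemma weak_deriv_AE_eq:
  assumes "\<phi> \<in> H1 L" "g \<in> L2 L" "has_weak_deriv L \<phi> g"
  shows "AE x in lebesgue_on {0..L}. weak_deriv L \<phi> x = g x"
  using assms H1_weak_deriv[OF assms(1)]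
  by (intro weak_deriv_unique_AE[of L \<phi>]) (auto simp: H1_def intro: L2_imp_integrable)

lemma L2_inner_AE_cong:
  assumes "f \<in> L2 L" "f' \<in> L2 L" "g \<in> L2 L" "g' \<in> L2 L"
    and "AE x in lebesgue_on {0..L}. f x = f' x" "AE x in lebesgue_on {0..L}. g x = g' x"
  shows "L2_inner L f g = L2_inner L f' g'"
  unfolding L2_inner_def
proof (rule integral_cong_AE)
  show "(\<lambda>x. f x * cnj (g x)) \<in> borel_measurable (lebesgue_on {0..L})"
    "(\<lambda>x. f' x * cnj (g' x)) \<in> borel_measurable (lebesgue_on {0..L})"
    using assms(1-4) by (auto simp: L2_def intro!: borel_measurable_times
        measurable_compose[OF _ borel_measurable_continuous_onI[OF continuous_on_cnj[OF continuous_on_id]]])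
  show "AE x in lebesgue_on {0..L}. f x * cnj (g x) = f' x * cnj (g' x)"
    using assms(5,6) by eventually_elim simp
qed

lemma continuous_bounded_Icc:
  fixes \<phi> :: "real \<Rightarrow> complex"
  assumes "continuous_on {0..L} \<phi>"
  obtains C where "C \<ge> 0" "\<And>x. x \<in> {0..L} \<Longrightarrow> cmod (\<phi> x) \<le> C"
proof -
  have "\<exists>C. \<forall>x\<in>{0..L}. cmod (\<phi> x) \<le> C"
    using compact_imp_bounded[OF compact_continuous_image[OF assms compact_Icc]] by (simp add: bounded_iff)
  then obtain C where "\<And>x. x \<in> {0..L} \<Longrightarrow> cmod (\<phi> x) \<le> C" by blast
  then show thesis using that[of "max C 0"] by (simp add: le_max_iff_disj)
qed

text \<open>
  Functions in \<open>H\<^sup>1\<close> are bounded and the strengths are summable, so the interaction energy is always finite: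
  the form domain is the same for all chains.
\<close>

lemma form_domain_eq_H1:
  assumes "\<And>n. v n \<in> {0..L}" "\<And>n. \<sigma> n \<ge> 0" "summable \<sigma>"
  shows "form_domain L v \<sigma> = H1 L"
proof -
  have "quad_form L v \<sigma> \<phi> < \<infinity>" if \<phi>: "\<phi> \<in> H1 L" for \<phi>
  proof -
    have "integrable (lebesgue_on {0..L}) (\<lambda>x. (cmod (weak_deriv L \<phi> x))\<^sup>2)"
      using H1_weak_deriv(1)[OF \<phi>] by (simp add: L2_def)
    then have 1: "(\<integral>\<^sup>+ x. ennreal ((cmod (weak_deriv L \<phi> x))\<^sup>2) \<partial>lebesgue_on {0..L}) < \<infinity>"
      by (simp add: integrable_iff_bounded)
    have "continuous_on {0..L} \<phi>" using \<phi> by (simp add: H1_def)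
    from continuous_bounded_Icc[OF this] obtain C where C: "C \<ge> 0" "\<And>x. x \<in> {0..L} \<Longrightarrow> cmod (\<phi> x) \<le> C"
      by metis
    have "summable (\<lambda>n. \<sigma> n * (cmod (\<phi> (v n)))\<^sup>2)"
    proof (rule summable_comparison_test')
      show "summable (\<lambda>n. \<sigma> n * C\<^sup>2)" using assms(3) by (rule summable_mult2)
      show "norm (\<sigma> n * (cmod (\<phi> (v n)))\<^sup>2) \<le> \<sigma> n * C\<^sup>2" for n
        using C(2)[OF assms(1)[of n]] assms(2)[of n]
        by (auto simp: abs_mult intro!: mult_left_mono power_mono)
    qed
    then have "(\<Sum>n. ennreal (\<sigma> n * (cmod (\<phi> (v n)))\<^sup>2)) = ennreal (\<Sum>n. \<sigma> n * (cmod (\<phi> (v n)))\<^sup>2)"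
      using assms(2) by (intro suminf_ennreal2) auto
    then show ?thesis using 1 by (simp add: quad_form_def ennreal_add_eq_top less_top[symmetric])
  qed
  then show ?thesis by (auto simp: form_domain_def)
qed

lemma eigenspace_eq:
  assumes "\<And>n. v n \<in> {0..L}" "\<And>n. \<sigma> n \<ge> 0" "summable \<sigma>"
  shows "eigenspace L v \<sigma> t = {\<phi> \<in> H1 L. \<forall>\<psi>\<in>H1 L. sesq_form L v \<sigma> \<phi> \<psi> = of_real t * L2_inner L \<phi> \<psi>}"
proof -
  have "(\<lambda>x. complex_of_real t * \<phi> x) \<in> L2 L" if "\<phi> \<in> H1 L" for \<phi>
    using that by (intro continuous_imp_L2 continuous_intros) (simp add: H1_def)
  moreover have "L2_inner L (\<lambda>x. complex_of_real t * \<phi> x) \<psi> = of_real t * L2_inner L \<phi> \<psi>" for \<phi> \<psi>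
    by (simp add: L2_inner_def mult.assoc)
  ultimately show ?thesis
    unfolding eigenspace_def delta_op_def form_domain_eq_H1[OF assms] by auto
qed

text \<open>
  The form can be evaluated with explicit weak derivatives instead of the chosen ones, because weak
  derivatives agree almost everywhere.
\<close>

lemma sesq_form_eq:
  assumes "\<phi> \<in> H1 L" "g \<in> L2 L" "has_weak_deriv L \<phi> g"
    and "\<psi> \<in> H1 L" "h \<in> L2 L" "has_weak_deriv L \<psi> h"
  shows "sesq_form L v \<sigma> \<phi> \<psi> = L2_inner L g h + (\<Sum>n. of_real (\<sigma> n) * (\<phi> (v n) * cnj (\<psi> (v n))))"
  unfolding sesq_form_def
  using L2_inner_AE_cong[OF H1_weak_deriv(1)[OF assms(1)] assms(2) H1_weak_deriv(1)[OF assms(4)] assms(5)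
     weak_deriv_AE_eq[OF assms(1-3)] weak_deriv_AE_eq[OF assms(4-6)]] by simp

lemma has_weak_deriv_cnj:
  assumes "has_weak_deriv L \<psi> h" shows "has_weak_deriv L (\<lambda>x. cnj (\<psi> x)) (\<lambda>x. cnj (h x))"
  unfolding has_weak_deriv_def
proof
  fix \<eta> assume "\<eta> \<in> test_functions L"
  then have "cnj (LINT x|lebesgue_on {0..L}. \<psi> x * complex_of_real (vector_derivative \<eta> (at x)))
        = cnj (- (LINT x|lebesgue_on {0..L}. h x * complex_of_real (\<eta> x)))"
    using assms unfolding has_weak_deriv_def by metis
  then show "(LINT x|lebesgue_on {0..L}. cnj (\<psi> x) * complex_of_real (vector_derivative \<eta> (at x)))
        = - (LINT x|lebesgue_on {0..L}. cnj (h x) * complex_of_real (\<eta> x))"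
    by (simp flip: Bochner_Integration.integral_cnj)
qed

lemma test_function_facts:
  assumes "\<eta> \<in> test_functions L"
  obtains \<eta>' where "\<And>x. (\<eta> has_real_derivative \<eta>' x) (at x)" "continuous_on UNIV \<eta>'"
    "\<And>x. vector_derivative \<eta> (at x) = \<eta>' x" "\<And>x. x \<le> 0 \<or> x \<ge> L \<Longrightarrow> \<eta> x = 0"
proof -
  from assms obtain \<eta>' where 1: "\<And>x. (\<eta> has_vector_derivative \<eta>' x) (at x)" "continuous_on UNIV \<eta>'"
    by (auto simp: test_functions_def C1_differentiable_on_def)
  have sub: "{x. \<eta> x \<noteq> 0} \<subseteq> {0<..<L}"
  proof (rule subset_trans[OF closure_subset])
    show "closure {x. \<eta> x \<noteq> 0} \<subseteq> {0<..<L}" using assms by (simp add: test_functions_def)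
  qed
  show thesis
  proof (rule that[of \<eta>'])
    show "(\<eta> has_real_derivative \<eta>' x) (at x)" for x
      using 1(1) by (simp add: has_real_derivative_iff_has_vector_derivative)
    show "vector_derivative \<eta> (at x) = \<eta>' x" for x using 1(1) by (rule vector_derivative_at)
    show "\<eta> x = 0" if "x \<le> 0 \<or> x \<ge> L" for x
    proof (rule ccontr)
      assume "\<eta> x \<noteq> 0"
      then have "x \<in> {0<..<L}" using sub by blast
      then show False using that by auto
    qed
  qed (rule 1(2))
qed

lemma C1_has_weak_deriv:
  assumes L: "L > 0" and \<eta>: "\<And>x. (\<eta> has_real_derivative \<eta>' x) (at x)" "continuous_on UNIV \<eta>'"
  shows "has_weak_deriv L (\<lambda>x. of_real (\<eta> x)) (\<lambda>x. of_real (\<eta>' x))"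
  unfolding has_weak_deriv_def
proof
  fix \<zeta> assume "\<zeta> \<in> test_functions L"
  from test_function_facts[OF this] obtain \<zeta>' where \<zeta>: "\<And>x. (\<zeta> has_real_derivative \<zeta>' x) (at x)" "continuous_on UNIV \<zeta>'"
    "\<And>x. vector_derivative \<zeta> (at x) = \<zeta>' x" "\<And>x. x \<le> 0 \<or> x \<ge> L \<Longrightarrow> \<zeta> x = 0"
    by metis
  have c: "continuous_on A \<eta>" "continuous_on A \<zeta>" "continuous_on A \<eta>'" "continuous_on A \<zeta>'" for A
    using DERIV_continuous_on[OF DERIV_subset[OF \<eta>(1)], of A] DERIV_continuous_on[OF DERIV_subset[OF \<zeta>(1)], of A]
      continuous_on_subset[OF \<eta>(2)] continuous_on_subset[OF \<zeta>(2)] by auto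
  have "(LINT x|lebesgue_on {0..L}. \<eta>' x * \<zeta> x + \<zeta>' x * \<eta> x) = \<eta> L * \<zeta> L - \<eta> 0 * \<zeta> 0"
    by (rule integral_of_derivative_Icc[where F = "\<lambda>x. \<eta> x * \<zeta> x"])
      (use L in \<open>auto intro!: DERIV_mult \<eta> \<zeta>(1) continuous_intros c\<close>)
  also have "\<dots> = 0" using \<zeta>(4) by simp
  also have "(LINT x|lebesgue_on {0..L}. \<eta>' x * \<zeta> x + \<zeta>' x * \<eta> x)
     = (LINT x|lebesgue_on {0..L}. \<eta>' x * \<zeta> x) + (LINT x|lebesgue_on {0..L}. \<eta> x * \<zeta>' x)"
    by (subst Bochner_Integration.integral_add)
      (auto intro!: continuous_integrable_on_Icc continuous_intros c simp: mult.commute)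
  finally have "(LINT x|lebesgue_on {0..L}. \<eta> x * \<zeta>' x) = - (LINT x|lebesgue_on {0..L}. \<eta>' x * \<zeta> x)" by simp
  then have "complex_of_real (LINT x|lebesgue_on {0..L}. \<eta> x * \<zeta>' x) = - complex_of_real (LINT x|lebesgue_on {0..L}. \<eta>' x * \<zeta> x)"
    by simp
  then show "(LINT x|lebesgue_on {0..L}. of_real (\<eta> x) * complex_of_real (vector_derivative \<zeta> (at x)))
        = - (LINT x|lebesgue_on {0..L}. of_real (\<eta>' x) * complex_of_real (\<zeta> x))"
    unfolding \<zeta>(3) by (simp flip: integral_complex_of_real of_real_mult)
qed

text \<open>
  A jump of the truncated function inside \<open>(0, L)\<close> would contribute a point mass to its derivative, so \<open>u\<close> has to
  vanish at the ends of \<open>[a, b]\<close> that lie in the interior. Jumps at 0 and \<open>L\<close> are invisible to test functions.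
\<close>

lemma truncated_has_weak_deriv:
  assumes L: "L > 0" and ab: "0 \<le> a" "a < b" "b \<le> L"
    and u: "\<And>x. (u has_real_derivative u' x) (at x)" "continuous_on UNIV u'"
    and bd: "a = 0 \<or> u a = 0" "b = L \<or> u b = 0"
  shows "has_weak_deriv L (\<lambda>x. of_real (u x * indicator {a..b} x)) (\<lambda>x. of_real (u' x * indicator {a..b} x))"
  unfolding has_weak_deriv_def
proof
  fix \<eta> assume "\<eta> \<in> test_functions L"
  from test_function_facts[OF this] obtain \<eta>' where \<eta>: "\<And>x. (\<eta> has_real_derivative \<eta>' x) (at x)" "continuous_on UNIV \<eta>'"
    "\<And>x. vector_derivative \<eta> (at x) = \<eta>' x" "\<And>x. x \<le> 0 \<or> x \<ge> L \<Longrightarrow> \<eta> x = 0"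
    by metis
  have c: "continuous_on A \<eta>" "continuous_on A \<eta>'" for A
    using DERIV_continuous_on[OF DERIV_subset[OF \<eta>(1)], of A] continuous_on_subset[OF \<eta>(2)] by auto
  have "(LINT x|lebesgue_on {0..L}. of_real (\<eta>' x) * of_real (u x * indicator {a..b} x))
       = of_real (\<eta> b) * of_real (u b) - of_real (\<eta> a) * of_real (u a)
         - (LINT x|lebesgue_on {0..L}. complex_of_real (\<eta> x) * of_real (u' x * indicator {a..b} x))"
    by (rule weak_deriv_integration_by_parts[OF _ _ C1_has_weak_deriv[OF L \<eta>(1,2)] ab u])
      (auto intro!: continuous_integrable_on_Icc continuous_intros c)
  moreover have "complex_of_real (\<eta> b) * of_real (u b) = 0" "complex_of_real (\<eta> a) * of_real (u a) = 0"
    using bd \<eta>(4)[of 0] \<eta>(4)[of L] by auto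
  ultimately show "(LINT x|lebesgue_on {0..L}. of_real (u x * indicator {a..b} x) * complex_of_real (vector_derivative \<eta> (at x)))
        = - (LINT x|lebesgue_on {0..L}. of_real (u' x * indicator {a..b} x) * complex_of_real (\<eta> x))"
    unfolding \<eta>(3) by (simp add: mult.commute)
qed

lemma has_weak_deriv_cmult:
  assumes "has_weak_deriv L \<psi> h" shows "has_weak_deriv L (\<lambda>x. c * \<psi> x) (\<lambda>x. c * h x)"
  using assms by (simp add: has_weak_deriv_def mult.assoc)

lemma sums_integral_bounded:
  fixes h :: "real \<Rightarrow> complex" and f :: "nat \<Rightarrow> real \<Rightarrow> complex"
  assumes h: "integrable (lebesgue_on {0..L}) h"
    and m: "\<And>n. f n \<in> borel_measurable (lebesgue_on {0..L})"
    and bd: "\<And>n x. x \<in> {0..L} \<Longrightarrow> cmod (f n x) \<le> B n" and B: "summable B"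
  shows "(\<lambda>n. LINT x|lebesgue_on {0..L}. h x * f n x) sums (LINT x|lebesgue_on {0..L}. h x * (\<Sum>n. f n x))"
proof -
  let ?M = "lebesgue_on {0..L}"
  have i: "integrable ?M (\<lambda>x. h x * f n x)" for n
    by (rule integrable_mult_bounded[OF h m]) (use bd in auto)
  have sf: "summable (\<lambda>n. norm (f n x))" if "x \<in> {0..L}" for x
    by (rule summable_comparison_test'[OF B]) (use bd[OF that] in auto)
  have "(\<lambda>n. LINT x|?M. h x * f n x) sums (LINT x|?M. (\<Sum>n. h x * f n x))"
  proof (rule sums_integral[OF i])
    show "AE x in ?M. summable (\<lambda>n. norm (h x * f n x))"
    proof (rule AE_I2)
      fix x assume "x \<in> space ?M"
      then have "summable (\<lambda>n. norm (h x) * norm (f n x))" by (intro summable_mult sf) auto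
      then show "summable (\<lambda>n. norm (h x * f n x))" by (simp add: norm_mult)
    qed
    show "summable (\<lambda>n. LINT x|?M. norm (h x * f n x))"
    proof (rule summable_comparison_test')
      show "summable (\<lambda>n. (LINT x|?M. norm (h x)) * B n)" by (rule summable_mult[OF B])
      show "norm (LINT x|?M. norm (h x * f n x)) \<le> (LINT x|?M. norm (h x)) * B n" for n
      proof -
        have "(LINT x|?M. norm (h x * f n x)) \<le> (LINT x|?M. norm (h x) * B n)"
          using h bd[of _ n] by (intro integral_mono[OF integrable_norm[OF i]]) (auto simp: norm_mult intro!: mult_left_mono)
        then show ?thesis by simp
      qed
    qed
  qed
  also have "(LINT x|?M. (\<Sum>n. h x * f n x)) = (LINT x|?M. h x * (\<Sum>n. f n x))"
    by (intro Bochner_Integration.integral_cong refl suminf_mult summable_norm_cancel[OF sf]) simp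
  finally show ?thesis .
qed

lemma one_has_weak_deriv:
  assumes "L > 0"
  shows "has_weak_deriv L (\<lambda>x. if x \<in> {0..L} then c else 0) (\<lambda>_. 0)"
proof -
  have "has_weak_deriv L (\<lambda>x. of_real (1 * indicator {0..L} x)) (\<lambda>x. of_real (0 * indicator {0..L} x))"
    by (rule truncated_has_weak_deriv[OF assms]) (use assms in \<open>auto intro!: derivative_eq_intros\<close>)
  from has_weak_deriv_cmult[OF this, of c] show ?thesis
    by (simp add: indicator_def of_bool_def if_distrib cong: if_cong)
qed

lemma const_in_H1:
  assumes "L > 0" shows "(\<lambda>x. if x \<in> {0..L} then c else 0) \<in> H1 L"
proof -
  have "(\<lambda>_. 0) \<in> L2 L" by (intro continuous_imp_L2 continuous_intros)
  moreover have "continuous_on {0..L} (\<lambda>x. if x \<in> {0..L} then c else 0)"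
    by (rule continuous_on_eq[OF continuous_on_const]) auto
  ultimately show ?thesis using one_has_weak_deriv[OF assms] by (auto simp: H1_def)
qed

lemma L2_cmult: "f \<in> L2 L \<Longrightarrow> (\<lambda>x. c * f x) \<in> L2 L"
  by (auto simp: L2_def norm_mult power_mult_distrib)

lemma H1_cmult: assumes "\<phi> \<in> H1 L" shows "(\<lambda>x. c * \<phi> x) \<in> H1 L"
proof -
  obtain g where g: "g \<in> L2 L" "has_weak_deriv L \<phi> g" using H1_weak_deriv[OF assms] by blast
  show ?thesis using L2_cmult[OF g(1), of c] assms has_weak_deriv_cmult[OF g(2), of c]
    by (auto simp: H1_def intro!: continuous_on_mult continuous_on_const)
qed

lemma L2_inner_self: "L2_inner L f f = of_real (LINT x|lebesgue_on {0..L}. (cmod (f x))\<^sup>2)"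
  unfolding L2_inner_def by (simp flip: complex_norm_square integral_complex_of_real)

lemma eigenspace_zero_dim:
  assumes "eigenspace L v \<sigma> t = {\<lambda>_. 0}" shows "cfun.dim (eigenspace L v \<sigma> t) = 0"
  by (rule cfun.dim_unique[of "{}"]) (auto simp: assms zero_fun_def cfun.independent_empty)

lemma eigenspace_line_dim:
  assumes "eigenspace L v \<sigma> t = {\<lambda>x. c * f x |c. True}" "f \<noteq> (\<lambda>_. 0)"
  shows "cfun.dim (eigenspace L v \<sigma> t) = 1"
proof (rule cfun.dim_unique[of "{f}"])
  show "{f} \<subseteq> eigenspace L v \<sigma> t" unfolding assms(1) by (auto intro!: exI[of _ 1])
  show "eigenspace L v \<sigma> t \<subseteq> cfun.span {f}"
    unfolding assms(1) using cfun.span_scale[OF cfun.span_base[of f "{f}"]] by auto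
  show "\<not> cfun.dependent {f}" using assms(2) by (simp add: cfun.dependent_single zero_fun_def)
qed simp

section \<open>Enumerations of eigenvalues\<close>

text \<open>
  At the first index where two enumerations differ, the smaller of the two values occurs more often in
  one enumeration than in the other: in the latter all its occurrences come before this index, where the two agree.
\<close>

lemma eigenvalue_enum_unique:
  assumes "eigenvalue_enum L v \<sigma> l" "eigenvalue_enum L v \<sigma> l'" shows "l = l'"
proof -
  have no_less: "\<not> l n < l' n"
    if e: "eigenvalue_enum L v \<sigma> l" "eigenvalue_enum L v \<sigma> l'" and agree: "\<And>m. m < n \<Longrightarrow> l m = l' m" for l l' n
  proof
    assume less: "l n < l' n"
    have mono: "mono l'" and fin: "finite {m. l m = l n}"
      and card: "card {m. l m = l n} = card {m. l' m = l n}"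
      using e by (auto simp: eigenvalue_enum_def)
    have "m < n" if "l' m = l n" for m
      using that less monoD[OF mono, of n m] by (cases "n \<le> m") auto
    then have "{m. l' m = l n} \<subseteq> {m. l m = l n} - {n}" using agree by fastforce
    then have "card {m. l' m = l n} \<le> card ({m. l m = l n} - {n})" using fin by (intro card_mono) auto
    also have "\<dots> < card {m. l m = l n}" using fin by (intro card_Diff1_less) auto
    finally show False using card by simp
  qed
  have "l n = l' n" for n
  proof (induction n rule: less_induct)
    case (less n)
    then show ?case using no_less[OF assms, of n] no_less[OF assms(2,1), of n] by (metis linorder_neqE)
  qed
  then show ?thesis by auto
qed

lemma eigval_eqI: "eigenvalue_enum L v \<sigma> l \<Longrightarrow> eigval L v \<sigma> = l"
  unfolding eigval_def by (rule the_equality) (auto intro: eigenvalue_enum_unique)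

section \<open>The jump of the Pruefer angle at a point interaction\<close>

text \<open>
  A point interaction of strength \<open>\<sigma>\<close> maps the state \<open>\<phi>'/k + \<i> \<phi> = r cis \<theta>\<close> to \<open>r (cis \<theta> + s sin \<theta>)\<close> with
  \<open>s = \<sigma>/k\<close>, that is, it multiplies the state by \<open>kick_factor s \<theta>\<close>. The modulus of this factor is the change of the
  amplitude.
\<close>

definition kick_factor :: "real \<Rightarrow> real \<Rightarrow> complex" where
  "kick_factor s \<theta> = 1 + complex_of_real (s * sin \<theta>) * cis (- \<theta>)"

text \<open>
  The change of the angle. The factor never meets the negative real axis, so the principal branch makes the change a
  continuous function of \<open>s \<ge> 0\<close> and \<open>\<theta>\<close>, and no multiples of \<open>2 pi\<close> have to be tracked.
\<close>

definition kick :: "real \<Rightarrow> real \<Rightarrow> real" where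
  "kick s \<theta> = Im (Ln (kick_factor s \<theta>))"

lemma kick_factor_Re: "Re (kick_factor s \<theta>) = 1 + s * sin \<theta> * cos \<theta>"
  and kick_factor_Im: "Im (kick_factor s \<theta>) = - (s * (sin \<theta>)\<^sup>2)"
  by (simp_all add: kick_factor_def power2_eq_square)

lemma kick_factor_not_nonpos:
  assumes "s \<ge> 0" shows "kick_factor s \<theta> \<notin> \<real>\<^sub>\<le>\<^sub>0"
  using assms by (auto simp: complex_nonpos_Reals_iff kick_factor_Re kick_factor_Im)

lemma kick_factor_nz: "s \<ge> 0 \<Longrightarrow> kick_factor s \<theta> \<noteq> 0"
  using kick_factor_not_nonpos[of s \<theta>] by auto

lemma norm_kick_factor_sq:
  "(cmod (kick_factor s \<theta>))\<^sup>2 = 1 + 2 * s * sin \<theta> * cos \<theta> + s\<^sup>2 * (sin \<theta>)\<^sup>2"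
proof -
  have "(cmod (kick_factor s \<theta>))\<^sup>2 = 1 + 2 * s * sin \<theta> * cos \<theta> + s\<^sup>2 * (sin \<theta>)\<^sup>2 * ((sin \<theta>)\<^sup>2 + (cos \<theta>)\<^sup>2)"
    unfolding cmod_power2 kick_factor_Re kick_factor_Im by algebra
  then show ?thesis by simp
qed

lemma cis_times_kick_factor: "cis \<theta> * kick_factor s \<theta> = cis \<theta> + complex_of_real (s * sin \<theta>)"
  by (simp add: kick_factor_def algebra_simps cis_mult)

lemma abs_sin_le_norm_kick_factor: "\<bar>sin \<theta>\<bar> \<le> cmod (kick_factor s \<theta>)"
proof -
  have "\<bar>sin \<theta>\<bar> = \<bar>Im (cis \<theta> * kick_factor s \<theta>)\<bar>" by (simp add: cis_times_kick_factor)
  also have "\<dots> \<le> cmod (cis \<theta> * kick_factor s \<theta>)" by (rule abs_Im_le_cmod)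
  finally show ?thesis by (simp add: norm_mult)
qed

lemma norm_kick_factor_le:
  assumes "s \<ge> 0" shows "cmod (kick_factor s \<theta>) \<le> 1 + s"
proof -
  have "cmod (kick_factor s \<theta>) \<le> 1 + s * \<bar>sin \<theta>\<bar>"
    unfolding kick_factor_def using assms
    by (intro order_trans[OF norm_triangle_ineq]) (simp add: norm_mult)
  also have "\<dots> \<le> 1 + s" using assms by (simp add: mult_left_le)
  finally show ?thesis .
qed

text \<open>
  The interaction leaves the imaginary part of the state unchanged, so it is undone by an interaction of
  strength \<open>-s\<close>, whose norm is at most \<open>1 + s\<close>.
\<close>

lemma norm_kick_factor_ge:
  assumes "s \<ge> 0" shows "1 \<le> (1 + s) * cmod (kick_factor s \<theta>)"
proof -
  define z where "z = cis \<theta> * kick_factor s \<theta>"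
  have z: "cmod z = cmod (kick_factor s \<theta>)" by (simp add: z_def norm_mult)
  have "cis \<theta> = z - of_real (s * Im z)"
    by (simp add: z_def cis_times_kick_factor)
  then have "1 \<le> cmod z + cmod (of_real (s * Im z))"
    using norm_triangle_ineq4[of z "of_real (s * Im z)"] by (metis norm_cis)
  also have "cmod (of_real (s * Im z)) \<le> s * cmod z"
    unfolding norm_of_real abs_mult using assms by (simp add: mult_left_mono abs_Im_le_cmod)
  finally show ?thesis unfolding z by (simp add: algebra_simps)
qed

lemma kick_factor_polar:
  assumes "s \<ge> 0"
  shows "kick_factor s \<theta> = complex_of_real (cmod (kick_factor s \<theta>)) * cis (kick s \<theta>)"
  using kick_factor_nz[OF assms, of \<theta>] unfolding kick_def
  by (metis Arg_eq_Im_Ln cis_conv_exp mult.commute mult.right_neutral rcis_cmod_Arg rcis_def)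

lemma kick_0 [simp]: "kick s 0 = 0" and kick_strength_0 [simp]: "kick 0 \<theta> = 0"
  by (simp_all add: kick_def kick_factor_def)

text \<open>
  The interaction acts on states as a shear, which preserves area; so the derivative of the induced map of angles
  is the inverse square of the radial stretching.
\<close>

lemma has_derivative_kick_angle:
  assumes "s \<ge> 0"
  shows "((\<lambda>\<theta>. \<theta> + kick s \<theta>) has_real_derivative 1 / (cmod (kick_factor s \<theta>))\<^sup>2) (at \<theta>)"
proof -
  let ?f = "kick_factor s \<theta>"
  have d: "((\<lambda>\<theta>. kick_factor s \<theta>) has_vector_derivative (complex_of_real s * cis (- 2 * \<theta>))) (at \<theta>)"
  proof -
    have "((\<lambda>\<theta>. 1 + s * sin \<theta> * cos \<theta>) has_real_derivative s * cos (2 * \<theta>)) (at \<theta>)"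
      unfolding cos_double
      by (auto intro!: derivative_eq_intros simp: power2_eq_square algebra_simps)
    moreover have "((\<lambda>\<theta>. - (s * (sin \<theta>)\<^sup>2)) has_real_derivative - (s * sin (2 * \<theta>))) (at \<theta>)"
      unfolding sin_double
      by (auto intro!: derivative_eq_intros simp: power2_eq_square algebra_simps)
    ultimately have "((\<lambda>\<theta>. of_real (1 + s * sin \<theta> * cos \<theta>) + \<i> * of_real (- (s * (sin \<theta>)\<^sup>2)))
      has_vector_derivative (of_real (s * cos (2 * \<theta>)) + \<i> * of_real (- (s * sin (2 * \<theta>))))) (at \<theta>)"
      by (intro has_vector_derivative_add has_vector_derivative_mult_right has_vector_derivative_of_real)
        (auto simp: has_real_derivative_iff_has_vector_derivative)
    moreover have "(\<lambda>\<theta>. of_real (1 + s * sin \<theta> * cos \<theta>) + \<i> * of_real (- (s * (sin \<theta>)\<^sup>2))) = kick_factor s"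
      by (simp add: fun_eq_iff complex_eq_iff kick_factor_Re kick_factor_Im)
    moreover have "of_real (s * cos (2 * \<theta>)) + \<i> * of_real (- (s * sin (2 * \<theta>))) = complex_of_real s * cis (- 2 * \<theta>)"
      by (simp add: complex_eq_iff)
    ultimately show ?thesis by simp
  qed
  have nz: "?f \<noteq> 0" using assms by (rule kick_factor_nz)
  have "((\<lambda>\<theta>. Ln (kick_factor s \<theta>)) has_vector_derivative (complex_of_real s * cis (- 2 * \<theta>)) * (1 / ?f)) (at \<theta>)"
    using field_vector_diff_chain_at[OF d, of Ln "1 / ?f"] has_field_derivative_Ln[OF kick_factor_not_nonpos[OF assms]]
    by (simp add: o_def inverse_eq_divide)
  from bounded_linear.has_vector_derivative[OF bounded_linear_Im this]
  have "((\<lambda>\<theta>. kick s \<theta>) has_real_derivative Im (complex_of_real s * cis (- 2 * \<theta>) * (1 / ?f))) (at \<theta>)"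
    by (simp add: kick_def has_real_derivative_iff_has_vector_derivative)
  moreover have "Im (complex_of_real s * cis (- 2 * \<theta>) * (1 / ?f)) = 1 / (cmod ?f)\<^sup>2 - 1"
  proof -
    have "complex_of_real s * cis (- 2 * \<theta>) * (1 / ?f)
        = complex_of_real s * cis (- 2 * \<theta>) * cnj ?f / of_real ((cmod ?f)\<^sup>2)"
      by (subst complex_div_cnj) simp
    moreover have "Im (complex_of_real s * cis (- 2 * \<theta>) * cnj ?f) = 1 - (cmod ?f)\<^sup>2"
    proof -
      have "Im (complex_of_real s * cis (- 2 * \<theta>) * cnj ?f)
         = s * cos (2*\<theta>) * (s * (sin \<theta>)\<^sup>2) - s * sin (2*\<theta>) * (1 + s * sin \<theta> * cos \<theta>)"
        by (simp add: kick_factor_Re kick_factor_Im algebra_simps)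
      also have "\<dots> = - 2 * s * sin \<theta> * cos \<theta> - s\<^sup>2 * (sin \<theta>)\<^sup>2 * ((sin \<theta>)\<^sup>2 + (cos \<theta>)\<^sup>2)"
        unfolding cos_double sin_double by algebra
      finally show ?thesis unfolding norm_kick_factor_sq by simp
    qed
    ultimately show ?thesis using nz by (simp add: Im_divide_of_real diff_divide_distrib)
  qed
  ultimately have "((\<lambda>\<theta>. kick s \<theta>) has_real_derivative 1 / (cmod ?f)\<^sup>2 - 1) (at \<theta>)" by simp
  from DERIV_add[OF DERIV_ident this] show ?thesis by simp
qed

text \<open>
  The derivative is minus the squared sine of the angle after the interaction.
\<close>

lemma has_derivative_kick_strength:
  assumes "s \<ge> 0"
  shows "((\<lambda>s. kick s \<theta>) has_real_derivative - ((sin \<theta>)\<^sup>2 / (cmod (kick_factor s \<theta>))\<^sup>2)) (at s)"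
proof -
  let ?f = "kick_factor s \<theta>"
  have d: "((\<lambda>s. kick_factor s \<theta>) has_vector_derivative (complex_of_real (sin \<theta>) * cis (- \<theta>))) (at s)"
    unfolding kick_factor_def
    by (auto intro!: derivative_eq_intros simp: scaleR_conv_of_real)
  have nz: "?f \<noteq> 0" using assms by (rule kick_factor_nz)
  have "((\<lambda>s. Ln (kick_factor s \<theta>)) has_vector_derivative (complex_of_real (sin \<theta>) * cis (- \<theta>)) * (1 / ?f)) (at s)"
    using field_vector_diff_chain_at[OF d, of Ln "1 / ?f"] has_field_derivative_Ln[OF kick_factor_not_nonpos[OF assms]]
    by (simp add: o_def inverse_eq_divide)
  from bounded_linear.has_vector_derivative[OF bounded_linear_Im this]
  have "((\<lambda>s. kick s \<theta>) has_real_derivative Im (complex_of_real (sin \<theta>) * cis (- \<theta>) * (1 / ?f))) (at s)"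
    by (simp add: kick_def has_real_derivative_iff_has_vector_derivative)
  moreover have "Im (complex_of_real (sin \<theta>) * cis (- \<theta>) * (1 / ?f)) = - ((sin \<theta>)\<^sup>2 / (cmod ?f)\<^sup>2)"
  proof -
    have "complex_of_real (sin \<theta>) * cis (- \<theta>) * (1 / ?f)
        = complex_of_real (sin \<theta>) * cis (- \<theta>) * cnj ?f / of_real ((cmod ?f)\<^sup>2)"
      by (subst complex_div_cnj) simp
    moreover have "Im (complex_of_real (sin \<theta>) * cis (- \<theta>) * cnj ?f) = - ((sin \<theta>)\<^sup>2)"
      by (simp add: kick_factor_Re kick_factor_Im) algebra
    ultimately show ?thesis using nz by (simp add: Im_divide_of_real)
  qed
  ultimately show ?thesis by simp
qed

lemma kick_mean_value:
  assumes "s \<ge> 0"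
  obtains r where "0 \<le> r" "r \<le> s" "kick s \<theta> = - (s * ((sin \<theta>)\<^sup>2 / (cmod (kick_factor r \<theta>))\<^sup>2))"
proof (cases "s = 0")
  case True then show ?thesis using that[of 0] by simp
next
  case False
  then have "0 < s" using assms by simp
  from MVT2[OF this has_derivative_kick_strength[of _ \<theta>]]
  obtain z where "0 < z" "z < s" "kick s \<theta> - kick 0 \<theta> = (s - 0) * - ((sin \<theta>)\<^sup>2 / (cmod (kick_factor z \<theta>))\<^sup>2)"
    by auto
  then show ?thesis using that[of z] by simp
qed

lemma sin_sq_ratio_le_1:
  assumes "r \<ge> 0" shows "(sin \<theta>)\<^sup>2 / (cmod (kick_factor r \<theta>))\<^sup>2 \<le> 1"
proof -
  have "(sin \<theta>)\<^sup>2 \<le> (cmod (kick_factor r \<theta>))\<^sup>2"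
    using power_mono[OF abs_sin_le_norm_kick_factor[of \<theta> r], of 2] by simp
  then show ?thesis using kick_factor_nz[OF assms] by (simp add: divide_le_eq)
qed

lemma kick_nonpos: "s \<ge> 0 \<Longrightarrow> kick s \<theta> \<le> 0"
  by (rule kick_mean_value[of s \<theta>]) auto

lemma kick_ge: assumes "s \<ge> 0" shows "- s \<le> kick s \<theta>"
proof -
  obtain r where r: "0 \<le> r" "kick s \<theta> = - (s * ((sin \<theta>)\<^sup>2 / (cmod (kick_factor r \<theta>))\<^sup>2))"
    using kick_mean_value[OF assms] by metis
  have "s * ((sin \<theta>)\<^sup>2 / (cmod (kick_factor r \<theta>))\<^sup>2) \<le> s * 1"
    using assms sin_sq_ratio_le_1[OF r(1)] by (intro mult_left_mono)
  then show ?thesis using r by simp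
qed

text \<open>
  By the mean value theorem in \<open>s\<close>, since the squared modulus of \<open>kick_factor r \<theta>\<close> differs from 1 by at
  most \<open>r (2 + r)\<close>.
\<close>

lemma kick_first_order:
  assumes "s \<ge> 0" shows "\<bar>kick s \<theta> + s * (sin \<theta>)\<^sup>2\<bar> \<le> s\<^sup>2 * (2 + s)"
proof -
  obtain r where r: "0 \<le> r" "r \<le> s" "kick s \<theta> = - (s * ((sin \<theta>)\<^sup>2 / (cmod (kick_factor r \<theta>))\<^sup>2))"
    using kick_mean_value[OF assms] by metis
  let ?m = "(cmod (kick_factor r \<theta>))\<^sup>2" let ?q = "(sin \<theta>)\<^sup>2 / ?m"
  have m: "?m > 0" using kick_factor_nz[OF r(1)] by simp
  have e: "kick s \<theta> + s * (sin \<theta>)\<^sup>2 = s * (?q * (?m - 1))"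
    using m r(3) by (simp add: field_simps)
  have "\<bar>?m - 1\<bar> \<le> r * (2 + r)"
  proof -
    have "\<bar>2 * r * (sin \<theta> * cos \<theta>)\<bar> \<le> 2 * r * 1"
      unfolding abs_mult using r(1) by (intro mult_mono) (auto intro: mult_le_one)
    moreover have "r\<^sup>2 * (sin \<theta>)\<^sup>2 \<le> r\<^sup>2 * 1" by (intro mult_left_mono) (auto simp: abs_square_le_1)
    moreover have "r\<^sup>2 * (sin \<theta>)\<^sup>2 \<ge> 0" by simp
    moreover have "?m - 1 = 2 * r * (sin \<theta> * cos \<theta>) + r\<^sup>2 * (sin \<theta>)\<^sup>2"
      unfolding norm_kick_factor_sq by simp
    moreover have "r * (2 + r) = 2 * r * 1 + r\<^sup>2 * 1" by (simp add: power2_eq_square algebra_simps)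
    ultimately show ?thesis by linarith
  qed
  also have "\<dots> \<le> s * (2 + s)" using r by (intro mult_mono) auto
  finally have "\<bar>?q * (?m - 1)\<bar> \<le> 1 * (s * (2 + s))"
    unfolding abs_mult using sin_sq_ratio_le_1[OF r(1)] by (intro mult_mono) auto
  then have "s * \<bar>?q * (?m - 1)\<bar> \<le> s * (s * (2 + s))" using assms by (intro mult_left_mono) auto
  then show ?thesis unfolding e using assms by (simp add: abs_mult power2_eq_square mult.assoc)
qed

lemma kick_strength_antimono:
  assumes "0 \<le> s" "s \<le> s'" shows "kick s' \<theta> \<le> kick s \<theta>"
  using assms(2)
proof (rule DERIV_nonpos_imp_nonincreasing)
  fix x assume "s \<le> x" "x \<le> s'"
  then show "\<exists>y. ((\<lambda>s. kick s \<theta>) has_real_derivative y) (at x) \<and> y \<le> 0"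
    using has_derivative_kick_strength[of x \<theta>] assms(1)
    by (intro exI[of _ "- ((sin \<theta>)\<^sup>2 / (cmod (kick_factor x \<theta>))\<^sup>2)"]) auto
qed

text \<open>
  Monotonicity of the angle map with an explicit rate. The rate keeps the final angle strictly
  monotone after infinitely many interactions.
\<close>

lemma kick_angle_expansion:
  assumes "s \<ge> 0" "\<theta> \<le> \<theta>'"
  shows "(\<theta>' - \<theta>) / (1 + s)\<^sup>2 \<le> (\<theta>' + kick s \<theta>') - (\<theta> + kick s \<theta>)"
proof (cases "\<theta> = \<theta>'")
  case False
  then have "\<theta> < \<theta>'" using assms by simp
  from MVT2[OF this has_derivative_kick_angle[OF assms(1)]]
  obtain z where z: "(\<theta>' + kick s \<theta>') - (\<theta> + kick s \<theta>) = (\<theta>' - \<theta>) * (1 / (cmod (kick_factor s z))\<^sup>2)"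
    by auto
  have "1 / (1 + s)\<^sup>2 \<le> 1 / (cmod (kick_factor s z))\<^sup>2"
    using norm_kick_factor_le[OF assms(1), of z] kick_factor_nz[OF assms(1), of z]
    by (intro divide_left_mono power_mono mult_pos_pos) auto
  then have "(\<theta>' - \<theta>) * (1 / (1 + s)\<^sup>2) \<le> (\<theta>' - \<theta>) * (1 / (cmod (kick_factor s z))\<^sup>2)"
    using assms by (intro mult_left_mono) auto
  then show ?thesis using z by simp
qed simp

lemma continuous_on_kick:
  fixes A :: "real set"
  assumes "continuous_on A s" "continuous_on A \<theta>" "\<And>x. x \<in> A \<Longrightarrow> s x \<ge> 0"
  shows "continuous_on A (\<lambda>x. kick (s x) (\<theta> x))"
proof -
  have "continuous_on A (\<lambda>x. kick_factor (s x) (\<theta> x))"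
    unfolding kick_factor_def cis_conv_exp by (intro continuous_intros assms)
  then show ?thesis unfolding kick_def
    using kick_factor_not_nonpos assms(3) by (intro continuous_intros continuous_on_Ln) auto
qed

section \<open>The Pruefer angle along a chain of point interactions\<close>

text \<open>
  The site \<open>v n\<close> carries the strength \<open>\<sigma> n\<close>. Since the sites are ordered like the natural numbers, a solution can be
  continued from one site to the next by recursion, starting at \<open>v 0 = 0\<close>.
\<close>

locale delta_chain =
  fixes L :: real and v \<sigma> :: "nat \<Rightarrow> real"
  assumes L_pos: "L > 0" and v0: "v 0 = 0" and v_mono: "strict_mono v"
    and v_range: "\<And>n. v n \<in> {0..<L}"
    and \<sigma>_nonneg: "\<And>n. \<sigma> n \<ge> 0" and \<sigma>_summable: "summable \<sigma>"
begin

text \<open>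
  The state \<open>\<phi>'/k + \<i> \<phi>\<close> of the solution just before the site \<open>n\<close>, multiplied by \<open>cis (- k * v n)\<close>. Free
  propagation over a length \<open>x\<close> multiplies the state by \<open>cis (k * x)\<close>, so this quantity changes at the sites only.
  The start value is the state with value 1 and slope 0.
\<close>

primrec amp :: "real \<Rightarrow> nat \<Rightarrow> complex" where
  "amp k 0 = \<i>"
| "amp k (Suc n) = amp k n + of_real (\<sigma> n / k * Im (cis (k * v n) * amp k n)) * cis (- (k * v n))"

definition site_value :: "real \<Rightarrow> nat \<Rightarrow> real" where
  "site_value k n = Im (cis (k * v n) * amp k n)"

text \<open>
  The argument of \<open>amp\<close>, followed continuously from \<open>pi/2\<close>.
\<close>

primrec phase :: "real \<Rightarrow> nat \<Rightarrow> real" where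
  "phase k 0 = pi / 2"
| "phase k (Suc n) = phase k n + kick (\<sigma> n / k) (phase k n + k * v n)"

text \<open>
  The Pruefer angle just before the site \<open>n\<close>.
\<close>

definition angle :: "real \<Rightarrow> nat \<Rightarrow> real" where
  "angle k n = phase k n + k * v n"

definition final_angle :: "real \<Rightarrow> real" where
  "final_angle k = k * L + pi / 2 + (\<Sum>n. kick (\<sigma> n / k) (angle k n))"

lemma strength_nonneg: "k > 0 \<Longrightarrow> \<sigma> n / k \<ge> 0" using \<sigma>_nonneg by simp

lemma summable_strength: "summable (\<lambda>n. \<sigma> n / k)" using \<sigma>_summable by (rule summable_divide)

lemma phase_eq_sum: "phase k n = pi / 2 + (\<Sum>j<n. kick (\<sigma> j / k) (angle k j))"
  by (induction n) (auto simp: angle_def)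

lemma summable_kick:
  assumes "k > 0" shows "summable (\<lambda>n. kick (\<sigma> n / k) (angle k n))"
proof (rule summable_comparison_test'[OF summable_strength])
  show "norm (kick (\<sigma> n / k) (angle k n)) \<le> \<sigma> n / k" for n
    using kick_nonpos[OF strength_nonneg[OF assms]] kick_ge[OF strength_nonneg[OF assms]]
    by (simp add: abs_le_iff minus_le_iff)
qed

lemma phase_tendsto:
  assumes "k > 0" shows "phase k \<longlonglongrightarrow> final_angle k - k * L"
proof -
  have "(\<lambda>n. pi / 2 + (\<Sum>j<n. kick (\<sigma> j / k) (angle k j))) \<longlonglongrightarrow> pi / 2 + (\<Sum>j. kick (\<sigma> j / k) (angle k j))"
    by (intro tendsto_intros summable_LIMSEQ summable_kick assms)
  then show ?thesis by (simp add: phase_eq_sum[abs_def] final_angle_def)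
qed

lemma amp_Suc_factor:
  assumes "amp k n = of_real r * cis (phase k n)"
  shows "amp k (Suc n) = of_real r * cis (phase k n) * kick_factor (\<sigma> n / k) (angle k n)"
proof -
  have "cis (k * v n) * amp k n = of_real r * cis (angle k n)"
    unfolding assms by (simp add: angle_def cis_mult mult.left_commute add.commute)
  then have "Im (cis (k * v n) * amp k n) = r * sin (angle k n)" by simp
  then have "amp k (Suc n) = of_real r * cis (phase k n) + of_real (\<sigma> n / k * (r * sin (angle k n))) * cis (- (k * v n))"
    using assms by simp
  also have "cis (- (k * v n)) = cis (phase k n) * cis (- angle k n)"
    by (simp add: angle_def cis_mult)
  finally show ?thesis by (simp add: kick_factor_def algebra_simps)
qed

lemma amp_polar:
  assumes "k > 0" shows "amp k n = of_real (cmod (amp k n)) * cis (phase k n)"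
proof (induction n)
  case 0 then show ?case by (simp add: cis_conv_exp complex_eq_iff Re_exp Im_exp)
next
  case (Suc n)
  let ?f = "kick_factor (\<sigma> n / k) (angle k n)"
  have 1: "amp k (Suc n) = of_real (cmod (amp k n)) * cis (phase k n) * ?f"
    by (rule amp_Suc_factor[OF Suc])
  have "cmod (amp k (Suc n)) = cmod (amp k n) * cmod ?f" unfolding 1 by (simp add: norm_mult)
  moreover have "amp k (Suc n) = of_real (cmod (amp k n) * cmod ?f) * (cis (phase k n) * cis (kick (\<sigma> n / k) (angle k n)))"
    unfolding 1 by (subst kick_factor_polar[OF strength_nonneg[OF assms]]) simp
  ultimately show ?case by (simp add: cis_mult angle_def)
qed

lemma norm_amp_Suc:
  assumes "k > 0"
  shows "cmod (amp k (Suc n)) = cmod (amp k n) * cmod (kick_factor (\<sigma> n / k) (angle k n))"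
  unfolding amp_Suc_factor[OF amp_polar[OF assms]] by (simp add: norm_mult)

lemma norm_amp_le:
  assumes "k > 0" shows "cmod (amp k n) \<le> exp (\<Sum>n. \<sigma> n / k)"
proof -
  have "cmod (amp k n) \<le> exp (\<Sum>j<n. \<sigma> j / k)"
  proof (induction n)
    case (Suc n)
    have "cmod (amp k (Suc n)) \<le> exp (\<Sum>j<n. \<sigma> j / k) * (1 + \<sigma> n / k)"
      unfolding norm_amp_Suc[OF assms]
      using Suc norm_kick_factor_le[OF strength_nonneg[OF assms]] by (intro mult_mono) auto
    also have "\<dots> \<le> exp (\<Sum>j<n. \<sigma> j / k) * exp (\<sigma> n / k)"
      by (intro mult_left_mono exp_ge_add_one_self) auto
    finally show ?case by (simp add: exp_add)
  qed simp
  also have "\<dots> \<le> exp (\<Sum>n. \<sigma> n / k)"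
    by (simp add: sum_le_suminf[OF summable_strength] strength_nonneg[OF assms])
  finally show ?thesis .
qed

lemma norm_amp_ge:
  assumes "k > 0" shows "cmod (amp k n) \<ge> exp (- (\<Sum>n. \<sigma> n / k))"
proof -
  have "cmod (amp k n) \<ge> exp (- (\<Sum>j<n. \<sigma> j / k))"
  proof (induction n)
    case (Suc n)
    let ?m = "cmod (kick_factor (\<sigma> n / k) (angle k n))"
    have "1 \<le> (1 + \<sigma> n / k) * ?m" by (rule norm_kick_factor_ge[OF strength_nonneg[OF assms]])
    also have "\<dots> \<le> exp (\<sigma> n / k) * ?m" by (intro mult_right_mono exp_ge_add_one_self) auto
    finally have m: "exp (- (\<sigma> n / k)) \<le> ?m" by (simp add: exp_minus field_simps)
    have "exp (- (\<Sum>j<Suc n. \<sigma> j / k)) = exp (- (\<Sum>j<n. \<sigma> j / k)) * exp (- (\<sigma> n / k))"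
      by (simp flip: exp_add)
    also have "\<dots> \<le> cmod (amp k n) * ?m" using Suc m by (intro mult_mono) auto
    finally show ?case unfolding norm_amp_Suc[OF assms] .
  qed simp
  moreover have "exp (- (\<Sum>n. \<sigma> n / k)) \<le> exp (- (\<Sum>j<n. \<sigma> j / k))"
    by (simp add: sum_le_suminf[OF summable_strength] strength_nonneg[OF assms])
  ultimately show ?thesis by linarith
qed

lemma abs_site_le: assumes "k > 0" shows "\<bar>site_value k n\<bar> \<le> exp (\<Sum>n. \<sigma> n / k)"
proof -
  have "\<bar>site_value k n\<bar> \<le> cmod (cis (k * v n) * amp k n)" unfolding site_value_def by (rule abs_Im_le_cmod)
  also have "\<dots> \<le> exp (\<Sum>n. \<sigma> n / k)" using norm_amp_le[OF assms] by (simp add: norm_mult)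
  finally show ?thesis .
qed

lemma summable_site: assumes "k > 0" shows "summable (\<lambda>n. \<bar>\<sigma> n * site_value k n\<bar>)"
proof (rule summable_comparison_test')
  show "summable (\<lambda>n. \<sigma> n * exp (\<Sum>n. \<sigma> n / k))" using \<sigma>_summable by (rule summable_mult2)
  show "norm \<bar>\<sigma> n * site_value k n\<bar> \<le> \<sigma> n * exp (\<Sum>n. \<sigma> n / k)" for n
    using abs_site_le[OF assms] \<sigma>_nonneg by (auto simp: abs_mult intro!: mult_left_mono)
qed

lemma amp_eq_sum: "amp k n = \<i> + (\<Sum>j<n. of_real (\<sigma> j / k * site_value k j) * cis (- (k * v j)))"
  by (induction n) (auto simp: site_value_def)

lemma site_eq: "site_value k n = cos (k * v n) + (\<Sum>j<n. \<sigma> j / k * site_value k j * sin (k * (v n - v j)))"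
proof -
  have "cis (k * v n) * amp k n = cis (k * v n) * \<i> + (\<Sum>j<n. of_real (\<sigma> j / k * site_value k j) * cis (k * (v n - v j)))"
    unfolding amp_eq_sum distrib_left sum_distrib_left
    by (intro arg_cong2[where f = "(+)"] sum.cong refl)
      (simp add: mult.left_commute[of "cis _"] cis_mult right_diff_distrib)
  then show ?thesis by (simp add: site_value_def)
qed

text \<open>
  The left derivative at \<open>L\<close>, divided by \<open>k\<close>, of the solution with value 1 and slope 0 at 0.
\<close>

definition end_slope :: "real \<Rightarrow> real" where
  "end_slope k = - sin (k * L) + (\<Sum>n. \<sigma> n / k * site_value k n * cos (k * (L - v n)))"

lemma summable_coeff:
  assumes "k > 0" shows "summable (\<lambda>n. \<bar>\<sigma> n / k * site_value k n\<bar>)"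
  using summable_divide[OF summable_site[OF assms], of k] assms by (simp add: abs_mult)

lemma summable_end_slope:
  assumes "k > 0" shows "summable (\<lambda>n. \<sigma> n / k * site_value k n * cos (k * (L - v n)))"
proof (rule summable_comparison_test'[OF summable_coeff[OF assms]])
  show "norm (\<sigma> n / k * site_value k n * cos (k * (L - v n))) \<le> \<bar>\<sigma> n / k * site_value k n\<bar>" for n
    unfolding real_norm_def abs_mult[of _ "cos _"] by (rule mult_left_le) auto
qed

text \<open>
  The slope is the limit of the real parts of the states, which are the modulus of \<open>amp\<close> times a cosine whose limit
  is that of the final angle. The moduli stay between two positive constants because the strengths are summable.
\<close>

lemma end_slope_eq_0_iff:
  assumes k: "k > 0" shows "end_slope k = 0 \<longleftrightarrow> cos (final_angle k) = 0"
proof -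
  have re_sum: "Re (cis (k * L) * amp k n) = - sin (k * L) + (\<Sum>j<n. \<sigma> j / k * site_value k j * cos (k * (L - v j)))" for n
  proof -
    have "cis (k * L) * amp k n = cis (k * L) * \<i> + (\<Sum>j<n. of_real (\<sigma> j / k * site_value k j) * cis (k * (L - v j)))"
      unfolding amp_eq_sum distrib_left sum_distrib_left
      by (intro arg_cong2[where f = "(+)"] sum.cong refl)
        (simp add: mult.left_commute[of "cis _"] cis_mult right_diff_distrib)
    then show ?thesis by simp
  qed
  have lim1: "(\<lambda>n. Re (cis (k * L) * amp k n)) \<longlonglongrightarrow> end_slope k"
    unfolding end_slope_def re_sum by (intro tendsto_intros summable_LIMSEQ summable_end_slope[OF k])
  have re: "Re (cis (k * L) * amp k n) = cmod (amp k n) * cos (phase k n + k * L)" for n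
  proof -
    have "cis (k * L) * amp k n = of_real (cmod (amp k n)) * cis (phase k n + k * L)"
      by (subst amp_polar[OF k]) (simp add: mult.left_commute[of "cis _"] cis_mult add.commute)
    then show ?thesis by simp
  qed
  have lim2: "(\<lambda>n. cos (phase k n + k * L)) \<longlonglongrightarrow> cos (final_angle k)"
    using tendsto_cos[OF tendsto_add[OF phase_tendsto[OF k] tendsto_const[of "k * L"]]] by simp
  show ?thesis
  proof
    assume "cos (final_angle k) = 0"
    then have "(\<lambda>n. cos (phase k n + k * L)) \<longlonglongrightarrow> 0" using lim2 by simp
    then have "(\<lambda>n. cmod (amp k n) * cos (phase k n + k * L)) \<longlonglongrightarrow> 0"
      using norm_amp_le[OF k] by (intro lim_null_mult_left_bounded[where B = "exp (\<Sum>n. \<sigma> n / k)"]) auto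
    then show "end_slope k = 0" using lim1 unfolding re by (rule LIMSEQ_unique[rotated])
  next
    assume "end_slope k = 0"
    then have 0: "(\<lambda>n. cmod (amp k n) * cos (phase k n + k * L)) \<longlonglongrightarrow> 0" using lim1 unfolding re by simp
    have "(\<lambda>n. cos (phase k n + k * L)) \<longlonglongrightarrow> 0"
    proof (rule Lim_null_comparison)
      show "(\<lambda>n. exp (\<Sum>n. \<sigma> n / k) * norm (cmod (amp k n) * cos (phase k n + k * L))) \<longlonglongrightarrow> 0"
        using tendsto_mult[OF tendsto_const tendsto_norm[OF 0]] by simp
      have "norm (cos (phase k n + k * L)) \<le> exp (\<Sum>n. \<sigma> n / k) * norm (cmod (amp k n) * cos (phase k n + k * L))" for n
      proof -
        have "1 \<le> exp (\<Sum>n. \<sigma> n / k) * cmod (amp k n)"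
          using norm_amp_ge[OF k, of n] by (simp add: exp_minus field_simps)
        from mult_right_mono[OF this, of "norm (cos (phase k n + k * L))"]
        show ?thesis by (simp add: abs_mult mult.assoc)
      qed
      then show "\<forall>\<^sub>F n in sequentially. norm (cos (phase k n + k * L)) \<le> exp (\<Sum>n. \<sigma> n / k) * norm (cmod (amp k n) * cos (phase k n + k * L))"
        by simp
    qed
    then show "cos (final_angle k) = 0" using lim2 by (rule LIMSEQ_unique[rotated])
  qed
qed

lemma angle_expansion:
  assumes k: "0 < k" "k \<le> k'" and that: "angle k n \<le> angle k' n"
  shows "angle k' (Suc n) - angle k (Suc n) \<ge>
    (angle k' n - angle k n) / (1 + \<sigma> n / k)\<^sup>2 + (k' - k) * (v (Suc n) - v n)"
proof -
  have s: "0 \<le> \<sigma> n / k'" "\<sigma> n / k' \<le> \<sigma> n / k"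
    using k \<sigma>_nonneg[of n] by (auto intro!: divide_left_mono)
  have "(angle k' n - angle k n) / (1 + \<sigma> n / k)\<^sup>2
      \<le> (angle k' n + kick (\<sigma> n / k) (angle k' n)) - (angle k n + kick (\<sigma> n / k) (angle k n))"
    using k that by (intro kick_angle_expansion strength_nonneg)
  also have "\<dots> \<le> (angle k' n + kick (\<sigma> n / k') (angle k' n)) - (angle k n + kick (\<sigma> n / k) (angle k n))"
    using kick_strength_antimono[OF s, of "angle k' n"] by simp
  also have "\<dots> = angle k' (Suc n) - angle k (Suc n) - (k' - k) * (v (Suc n) - v n)"
    by (simp add: angle_def algebra_simps)
  finally show ?thesis by simp
qed

lemma v_Suc_pos: "v (Suc n) - v n > 0" using v_mono by (simp add: strict_mono_def)

text \<open>
  A larger \<open>k\<close> rotates faster and weakens the kicks, so the angles stay in order. The gap that is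
  gained on the first interval shrinks at the site \<open>j\<close> at most by the factor \<open>(1 + \<sigma> j/k)\<^sup>-\<^sup>2\<close>, and the product of
  these factors is bounded below.
\<close>

lemma angle_gap:
  assumes k: "0 < k" "k < k'"
  shows "angle k' (Suc n) - angle k (Suc n) \<ge> (k' - k) * (v 1 - v 0) * exp (- 2 * (\<Sum>n. \<sigma> n / k))"
proof -
  let ?c = "(k' - k) * (v 1 - v 0)"
  have c: "?c > 0" using k v_Suc_pos[of 0] by simp
  have le: "angle k n \<le> angle k' n" for n
  proof (induction n)
    case (Suc n)
    have "0 \<le> (angle k' n - angle k n) / (1 + \<sigma> n / k)\<^sup>2" using Suc by simp
    moreover have "0 \<le> (k' - k) * (v (Suc n) - v n)" using k v_Suc_pos[of n] by simp
    ultimately show ?case using angle_expansion[of k k' n] k Suc by linarith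
  qed (simp add: angle_def v0)
  have "angle k' (Suc n) - angle k (Suc n) \<ge> ?c * exp (- 2 * (\<Sum>j<Suc n. \<sigma> j / k))"
  proof (induction n)
    case 0
    have "0 \<le> \<sigma> 0 / k" using strength_nonneg k by simp
    then have "?c * exp (- 2 * (\<Sum>j<Suc 0. \<sigma> j / k)) \<le> ?c * 1" using c by (intro mult_left_mono) auto
    moreover have "angle k' 0 = angle k 0" by (simp add: angle_def v0)
    moreover from this have "?c \<le> angle k' (Suc 0) - angle k (Suc 0)"
      using angle_expansion[of k k' 0] k by simp
    ultimately show ?case by linarith
  next
    case (Suc n)
    let ?s = "\<sigma> (Suc n) / k" let ?d = "angle k' (Suc n) - angle k (Suc n)"
    have s: "?s \<ge> 0" using strength_nonneg k by simp
    have "exp (- 2 * ?s) \<le> 1 / (1 + ?s)\<^sup>2"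
    proof -
      have "(1 + ?s)\<^sup>2 \<le> (exp ?s)\<^sup>2" using s by (intro power_mono exp_ge_add_one_self) auto
      also have "\<dots> = exp (2 * ?s)" by (simp flip: exp_double)
      finally have "1 / exp (2 * ?s) \<le> 1 / (1 + ?s)\<^sup>2" using s by (intro divide_left_mono mult_pos_pos) auto
      then show ?thesis by (simp add: exp_minus divide_inverse)
    qed
    then have "?d * exp (- 2 * ?s) \<le> ?d * (1 / (1 + ?s)\<^sup>2)" using le[of "Suc n"] by (intro mult_left_mono) auto
    then have "?d * exp (- 2 * ?s) \<le> ?d / (1 + ?s)\<^sup>2" by simp
    moreover have "?c * exp (- 2 * (\<Sum>j<Suc n. \<sigma> j / k)) * exp (- 2 * ?s) \<le> ?d * exp (- 2 * ?s)"
      using Suc by (intro mult_right_mono) auto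
    moreover have "?c * exp (- 2 * (\<Sum>j<Suc (Suc n). \<sigma> j / k)) = ?c * exp (- 2 * (\<Sum>j<Suc n. \<sigma> j / k)) * exp (- 2 * ?s)"
      by (simp add: mult.assoc algebra_simps flip: exp_add)
    moreover have "0 \<le> (k' - k) * (v (Suc (Suc n)) - v (Suc n))" using k v_Suc_pos[of "Suc n"] by simp
    moreover have "?d / (1 + ?s)\<^sup>2 + (k' - k) * (v (Suc (Suc n)) - v (Suc n))
        \<le> angle k' (Suc (Suc n)) - angle k (Suc (Suc n))"
      using k le[of "Suc n"] by (intro angle_expansion) auto
    ultimately show ?case by linarith
  qed
  moreover have "(\<Sum>j<Suc n. \<sigma> j / k) \<le> (\<Sum>n. \<sigma> n / k)"
    using strength_nonneg k by (intro sum_le_suminf summable_strength) auto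
  then have "?c * exp (- 2 * (\<Sum>n. \<sigma> n / k)) \<le> ?c * exp (- 2 * (\<Sum>j<Suc n. \<sigma> j / k))"
    using c by (intro mult_left_mono) auto
  ultimately show ?thesis by linarith
qed

lemma final_angle_strict_mono:
  assumes k: "0 < k" "k < k'" shows "final_angle k < final_angle k'"
proof -
  let ?\<delta> = "(k' - k) * (v 1 - v 0) * exp (- 2 * (\<Sum>n. \<sigma> n / k))"
  have "?\<delta> > 0" using k v_Suc_pos[of 0] by simp
  moreover have "?\<delta> \<le> (final_angle k' - k' * L) - (final_angle k - k * L) + (k' - k) * L"
  proof (rule LIMSEQ_le_const)
    show "(\<lambda>n. phase k' (Suc n) - phase k (Suc n) + (k' - k) * L) \<longlonglongrightarrow> (final_angle k' - k' * L) - (final_angle k - k * L) + (k' - k) * L"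
      using k by (intro tendsto_intros LIMSEQ_Suc[OF phase_tendsto]) auto
    have "?\<delta> \<le> phase k' (Suc n) - phase k (Suc n) + (k' - k) * L" for n
    proof -
      have "(k' - k) * v (Suc n) \<le> (k' - k) * L" using k v_range[of "Suc n"] by (intro mult_left_mono) auto
      then show ?thesis using angle_gap[OF k, of n] by (simp add: angle_def algebra_simps del: phase.simps)
    qed
    then show "\<exists>N. \<forall>n\<ge>N. ?\<delta> \<le> phase k' (Suc n) - phase k (Suc n) + (k' - k) * L" by blast
  qed
  ultimately show ?thesis by (simp add: algebra_simps)
qed

section \<open>Eigenfunctions\<close>

text \<open>
  The solution that starts at the site \<open>n\<close> with slope \<open>k\<close>, cut off outside \<open>[v n, L]\<close>, and its derivative. On
  \<open>[0, L]\<close> it equals \<open>sin (k max 0 (x - v n))\<close>.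
\<close>

definition hinge :: "real \<Rightarrow> nat \<Rightarrow> real \<Rightarrow> real" where
  "hinge k n x = sin (k * (x - v n)) * indicator {v n..L} x"

definition hinge' :: "real \<Rightarrow> nat \<Rightarrow> real \<Rightarrow> real" where
  "hinge' k n x = k * cos (k * (x - v n)) * indicator {v n..L} x"

text \<open>
  Variation of constants: the jump \<open>\<sigma> n * \<phi> (v n)\<close> of the slope at the site \<open>n\<close> adds a multiple of the hinge at
  that site to the free solution \<open>cos (k x)\<close>.
\<close>

definition sol :: "real \<Rightarrow> real \<Rightarrow> complex" where
  "sol k x = (if x \<in> {0..L} then of_real (cos (k * x)) + (\<Sum>n. of_real (\<sigma> n / k * site_value k n) * of_real (hinge k n x)) else 0)"

definition sol' :: "real \<Rightarrow> real \<Rightarrow> complex" where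
  "sol' k x = of_real (- k * sin (k * x)) + (\<Sum>n. of_real (\<sigma> n / k * site_value k n) * of_real (hinge' k n x))"

lemma v_bounds: "0 \<le> v n" "v n < L" using v_range[of n] by auto

lemma hinge_sin_max: "x \<in> {0..L} \<Longrightarrow> hinge k n x = sin (k * max 0 (x - v n))"
  by (auto simp: hinge_def max_def)

lemma abs_hinge_le: "\<bar>hinge k n x\<bar> \<le> 1" "k \<ge> 0 \<Longrightarrow> \<bar>hinge' k n x\<bar> \<le> k"
  by (auto simp: hinge_def hinge'_def abs_mult indicator_def mult_left_le)

lemma hinge_continuous: "continuous_on {0..L} (hinge k n)"
proof -
  have "continuous_on {0..L} (\<lambda>x. sin (k * max 0 (x - v n)))" by (intro continuous_intros)
  then show ?thesis by (rule continuous_on_cong[THEN iffD1, rotated 2]) (auto simp: hinge_sin_max)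
qed

lemma hinge_measurable:
  "(\<lambda>x. complex_of_real (hinge k n x)) \<in> borel_measurable (lebesgue_on {0..L})"
  "(\<lambda>x. complex_of_real (hinge' k n x)) \<in> borel_measurable (lebesgue_on {0..L})"
proof -
  have "(\<lambda>x. complex_of_real (k * cos (k * (x - v n)))) \<in> borel_measurable (lebesgue_on {0..L})"
    by (intro measurable_Icc continuous_intros)
  from borel_measurable_times[OF this of_real_indicator_Icc_measurable]
  show "(\<lambda>x. complex_of_real (hinge' k n x)) \<in> borel_measurable (lebesgue_on {0..L})"
    by (simp add: hinge'_def)
  show "(\<lambda>x. complex_of_real (hinge k n x)) \<in> borel_measurable (lebesgue_on {0..L})"
    by (intro measurable_Icc continuous_intros hinge_continuous)
qed

lemma hinge_has_weak_deriv:
  "has_weak_deriv L (\<lambda>x. of_real (hinge k n x)) (\<lambda>x. of_real (hinge' k n x))"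
  unfolding hinge_def hinge'_def
  by (rule truncated_has_weak_deriv[OF L_pos]) (use v_bounds[of n] in \<open>auto intro!: derivative_eq_intros continuous_intros\<close>)

lemma hinge_green:
  assumes "continuous_on {0..L} \<psi>" "integrable (lebesgue_on {0..L}) h" "has_weak_deriv L \<psi> h"
  shows "(LINT x|lebesgue_on {0..L}. h x * of_real (hinge' k n x))
    = \<psi> L * of_real (k * cos (k * (L - v n))) - \<psi> (v n) * of_real k
      + of_real (k\<^sup>2) * (LINT x|lebesgue_on {0..L}. \<psi> x * of_real (hinge k n x))"
proof -
  have "(LINT x|lebesgue_on {0..L}. h x * of_real (k * cos (k * (x - v n)) * indicator {v n..L} x))
    = \<psi> L * of_real (k * cos (k * (L - v n))) - \<psi> (v n) * of_real (k * cos (k * (v n - v n)))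
     - (LINT x|lebesgue_on {0..L}. \<psi> x * of_real (- k\<^sup>2 * sin (k * (x - v n)) * indicator {v n..L} x))"
    by (rule weak_deriv_integration_by_parts[OF assms])
      (use v_bounds[of n] in \<open>auto intro!: derivative_eq_intros continuous_intros simp: power2_eq_square\<close>)
  also have "(LINT x|lebesgue_on {0..L}. \<psi> x * of_real (- k\<^sup>2 * sin (k * (x - v n)) * indicator {v n..L} x))
     = (LINT x|lebesgue_on {0..L}. - of_real (k\<^sup>2) * (\<psi> x * of_real (hinge k n x)))"
    by (rule Bochner_Integration.integral_cong) (simp_all add: hinge_def)
  also have "\<dots> = - of_real (k\<^sup>2) * (LINT x|lebesgue_on {0..L}. \<psi> x * of_real (hinge k n x))"
    by (rule Bochner_Integration.integral_mult_right_zero)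
  finally show ?thesis by (simp add: hinge'_def)
qed

context
  fixes k :: real assumes k: "k > 0"
begin

lemma coeff_hinge_bound:
  "cmod (of_real (\<sigma> n / k * site_value k n) * of_real (hinge k n x)) \<le> \<bar>\<sigma> n / k * site_value k n\<bar>"
  "cmod (of_real (\<sigma> n / k * site_value k n) * of_real (hinge' k n x)) \<le> \<bar>\<sigma> n / k * site_value k n\<bar> * k"
proof -
  show "cmod (of_real (\<sigma> n / k * site_value k n) * of_real (hinge k n x)) \<le> \<bar>\<sigma> n / k * site_value k n\<bar>"
    unfolding norm_mult[of _ "of_real (hinge k n x)"] norm_of_real
    by (rule mult_left_le[OF abs_hinge_le(1)]) simp
  show "cmod (of_real (\<sigma> n / k * site_value k n) * of_real (hinge' k n x)) \<le> \<bar>\<sigma> n / k * site_value k n\<bar> * k"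
    unfolding norm_mult[of _ "of_real (hinge' k n x)"] norm_of_real
    by (rule mult_left_mono[OF abs_hinge_le(2)]) (use k in auto)
qed

lemma summable_coeff_hinge: "summable (\<lambda>n. of_real (\<sigma> n / k * site_value k n) * of_real (hinge k n x) :: complex)"
  by (rule summable_norm_cancel, rule summable_comparison_test'[OF summable_coeff[OF k]]) (use coeff_hinge_bound in auto)

lemma sol_continuous: "continuous_on {0..L} (sol k)"
proof -
  have u: "uniform_limit {0..L} (\<lambda>n x. \<Sum>i<n. complex_of_real (\<sigma> i / k * site_value k i) * of_real (hinge k i x))
      (\<lambda>x. \<Sum>i. of_real (\<sigma> i / k * site_value k i) * of_real (hinge k i x)) sequentially"
    by (rule Weierstrass_m_test[OF _ summable_coeff[OF k]]) (rule coeff_hinge_bound)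
  have "continuous_on {0..L} (\<lambda>x. \<Sum>i. complex_of_real (\<sigma> i / k * site_value k i) * of_real (hinge k i x))"
    by (rule uniform_limit_theorem[OF _ u])
      (intro always_eventually allI continuous_on_sum continuous_on_mult continuous_on_const continuous_on_of_real hinge_continuous
        | simp)+
  then have "continuous_on {0..L} (\<lambda>x. of_real (cos (k * x)) + (\<Sum>i. complex_of_real (\<sigma> i / k * site_value k i) * of_real (hinge k i x)))"
    by (intro continuous_intros)
  then show ?thesis by (rule continuous_on_cong[THEN iffD1, rotated 2]) (auto simp: sol_def)
qed

lemma sol'_measurable: "sol' k \<in> borel_measurable (lebesgue_on {0..L})"
proof -
  have "(\<lambda>x. complex_of_real (- k * sin (k * x))) \<in> borel_measurable (lebesgue_on {0..L})"
    by (intro measurable_Icc continuous_intros)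
  then show ?thesis unfolding sol'_def[abs_def]
    by (intro borel_measurable_add borel_measurable_suminf borel_measurable_times borel_measurable_const hinge_measurable)
qed

lemma norm_sol'_le: "cmod (sol' k x) \<le> k + (\<Sum>n. \<bar>\<sigma> n / k * site_value k n\<bar> * k)"
proof -
  have "cmod (of_real (- k * sin (k * x))) \<le> k" using k unfolding norm_of_real abs_mult by (simp add: mult_left_le)
  moreover have "cmod (\<Sum>n. of_real (\<sigma> n / k * site_value k n) * of_real (hinge' k n x)) \<le> (\<Sum>n. \<bar>\<sigma> n / k * site_value k n\<bar> * k)"
    by (rule norm_suminf_le[OF coeff_hinge_bound(2) summable_mult2[OF summable_coeff[OF k]]])
  ultimately show ?thesis unfolding sol'_def by (intro order_trans[OF norm_triangle_ineq] add_mono)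
qed

lemma sol'_L2: "sol' k \<in> L2 L"
  by (rule bounded_imp_L2[OF sol'_measurable norm_sol'_le])

lemma integral_sol_expand:
  assumes h: "integrable (lebesgue_on {0..L}) h"
  shows "(\<lambda>n. of_real (\<sigma> n / k * site_value k n) * (LINT x|lebesgue_on {0..L}. h x * of_real (hinge k n x)))
      sums ((LINT x|lebesgue_on {0..L}. h x * sol k x) - (LINT x|lebesgue_on {0..L}. h x * of_real (cos (k * x))))"
    and "(\<lambda>n. of_real (\<sigma> n / k * site_value k n) * (LINT x|lebesgue_on {0..L}. h x * of_real (hinge' k n x)))
      sums ((LINT x|lebesgue_on {0..L}. h x * sol' k x) - (LINT x|lebesgue_on {0..L}. h x * of_real (- k * sin (k * x))))"
proof -
  let ?M = "lebesgue_on {0..L}" let ?c = "\<lambda>n. complex_of_real (\<sigma> n / k * site_value k n)"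
  have i: "integrable ?M (\<lambda>x. h x * of_real (cos (k * x)))" "integrable ?M (\<lambda>x. h x * of_real (- k * sin (k * x)))"
  proof -
    show "integrable ?M (\<lambda>x. h x * of_real (cos (k * x)))"
      by (rule integrable_mult_bounded[OF h, where C = 1]) (auto intro!: measurable_Icc continuous_intros)
    show "integrable ?M (\<lambda>x. h x * of_real (- k * sin (k * x)))"
      by (rule integrable_mult_bounded[OF h, where C = k])
        (use k in \<open>auto intro!: measurable_Icc continuous_intros simp: norm_mult mult_left_le\<close>)
  qed
  have j: "integrable ?M (\<lambda>x. h x * sol k x)" "integrable ?M (\<lambda>x. h x * sol' k x)"
  proof -
    from continuous_bounded_Icc[OF sol_continuous] obtain C where "\<And>x. x \<in> {0..L} \<Longrightarrow> cmod (sol k x) \<le> C"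
      by metis
    then show "integrable ?M (\<lambda>x. h x * sol k x)"
      by (intro integrable_mult_bounded[OF h]) (auto intro: measurable_Icc sol_continuous)
    show "integrable ?M (\<lambda>x. h x * sol' k x)"
      by (rule integrable_mult_bounded[OF h sol'_measurable norm_sol'_le])
  qed
  have "(\<lambda>n. LINT x|?M. h x * (?c n * of_real (hinge k n x))) sums (LINT x|?M. h x * (\<Sum>n. ?c n * of_real (hinge k n x)))"
    by (rule sums_integral_bounded[OF h _ coeff_hinge_bound(1) summable_coeff[OF k]])
       (intro borel_measurable_times borel_measurable_const hinge_measurable)
  also have "(LINT x|?M. h x * (\<Sum>n. ?c n * of_real (hinge k n x))) = (LINT x|?M. h x * sol k x - h x * of_real (cos (k * x)))"
    by (rule Bochner_Integration.integral_cong) (auto simp: sol_def algebra_simps)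
  also have "\<dots> = (LINT x|?M. h x * sol k x) - (LINT x|?M. h x * of_real (cos (k * x)))"
    using j i by simp
  also have "(\<lambda>n. LINT x|?M. h x * (?c n * of_real (hinge k n x))) = (\<lambda>n. ?c n * (LINT x|?M. h x * of_real (hinge k n x)))"
    by (simp add: mult.left_commute[of "h _"])
  finally show "(\<lambda>n. ?c n * (LINT x|?M. h x * of_real (hinge k n x)))
      sums ((LINT x|?M. h x * sol k x) - (LINT x|?M. h x * of_real (cos (k * x))))" .
  have "(\<lambda>n. LINT x|?M. h x * (?c n * of_real (hinge' k n x))) sums (LINT x|?M. h x * (\<Sum>n. ?c n * of_real (hinge' k n x)))"
    by (rule sums_integral_bounded[OF h _ coeff_hinge_bound(2) summable_mult2[OF summable_coeff[OF k]]])
       (intro borel_measurable_times borel_measurable_const hinge_measurable)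
  also have "(LINT x|?M. h x * (\<Sum>n. ?c n * of_real (hinge' k n x))) = (LINT x|?M. h x * sol' k x - h x * of_real (- k * sin (k * x)))"
    by (rule Bochner_Integration.integral_cong) (auto simp: sol'_def algebra_simps)
  also have "\<dots> = (LINT x|?M. h x * sol' k x) - (LINT x|?M. h x * of_real (- k * sin (k * x)))"
    using j i by simp
  also have "(\<lambda>n. LINT x|?M. h x * (?c n * of_real (hinge' k n x))) = (\<lambda>n. ?c n * (LINT x|?M. h x * of_real (hinge' k n x)))"
    by (simp add: mult.left_commute[of "h _"])
  finally show "(\<lambda>n. ?c n * (LINT x|?M. h x * of_real (hinge' k n x)))
      sums ((LINT x|?M. h x * sol' k x) - (LINT x|?M. h x * of_real (- k * sin (k * x))))" .
qed

lemma sol_has_weak_deriv: "has_weak_deriv L (sol k) (sol' k)"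
  unfolding has_weak_deriv_def
proof
  let ?M = "lebesgue_on {0..L}" let ?c = "\<lambda>n. complex_of_real (\<sigma> n / k * site_value k n)"
  fix \<eta> assume \<eta>T: "\<eta> \<in> test_functions L"
  from test_function_facts[OF this] obtain \<eta>' where \<eta>: "\<And>x. (\<eta> has_real_derivative \<eta>' x) (at x)" "continuous_on UNIV \<eta>'"
    "\<And>x. vector_derivative \<eta> (at x) = \<eta>' x" by metis
  have c: "continuous_on A \<eta>" "continuous_on A \<eta>'" for A
    using DERIV_continuous_on[OF DERIV_subset[OF \<eta>(1)], of A] continuous_on_subset[OF \<eta>(2)] by auto
  have i: "integrable ?M (\<lambda>x. complex_of_real (\<eta> x))" "integrable ?M (\<lambda>x. complex_of_real (\<eta>' x))"
    by (intro continuous_integrable_on_Icc continuous_intros c)+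
  have base: "(LINT x|?M. of_real (\<eta>' x) * of_real (cos (k * x))) = - (LINT x|?M. of_real (\<eta> x) * complex_of_real (- k * sin (k * x)))"
  proof -
    have "has_weak_deriv L (\<lambda>x. of_real (cos (k * x))) (\<lambda>x. of_real (- k * sin (k * x)))"
      by (rule C1_has_weak_deriv[OF L_pos]) (auto intro!: derivative_eq_intros continuous_intros)
    from this[unfolded has_weak_deriv_def, rule_format, OF \<eta>T] show ?thesis
      unfolding \<eta>(3) by (simp add: mult.commute)
  qed
  have "(\<lambda>n. ?c n * (LINT x|?M. of_real (\<eta>' x) * of_real (hinge k n x)))
      = (\<lambda>n. - (?c n * (LINT x|?M. of_real (\<eta> x) * of_real (hinge' k n x))))"
  proof
    fix n
    show "?c n * (LINT x|?M. of_real (\<eta>' x) * of_real (hinge k n x)) = - (?c n * (LINT x|?M. of_real (\<eta> x) * of_real (hinge' k n x)))"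
      using hinge_has_weak_deriv[of k n, unfolded has_weak_deriv_def, rule_format, OF \<eta>T]
      unfolding \<eta>(3) by (simp add: mult.commute)
  qed
  from sums_unique2[OF integral_sol_expand(1)[OF i(2), unfolded this] sums_minus[OF integral_sol_expand(2)[OF i(1)]]]
  have "(LINT x|?M. of_real (\<eta>' x) * sol k x) = - (LINT x|?M. of_real (\<eta> x) * sol' k x)"
    unfolding base by (simp add: algebra_simps)
  then show "(LINT x|?M. sol k x * complex_of_real (vector_derivative \<eta> (at x))) = - (LINT x|?M. sol' k x * of_real (\<eta> x))"
    unfolding \<eta>(3) by (simp add: mult.commute)
qed

lemma sol_H1: "sol k \<in> H1 L"
  unfolding H1_def using sol_continuous sol'_L2 sol_has_weak_deriv by (auto simp: sol_def)

lemma sol_at_site: "sol k (v n) = of_real (site_value k n)"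
proof -
  have z: "of_real (\<sigma> j / k * site_value k j) * complex_of_real (hinge k j (v n)) = 0" if "j \<notin> {..<n}" for j
  proof -
    have "v n \<le> v j" using that v_mono by (simp add: strict_mono_less_eq)
    then have "hinge k j (v n) = 0" using v_bounds[of n] by (subst hinge_sin_max) auto
    then show ?thesis by simp
  qed
  have "(\<Sum>j. of_real (\<sigma> j / k * site_value k j) * complex_of_real (hinge k j (v n)))
     = (\<Sum>j<n. of_real (\<sigma> j / k * site_value k j) * complex_of_real (hinge k j (v n)))"
    by (rule suminf_finite[OF _ z]) auto
  also have "\<dots> = (\<Sum>j<n. of_real (\<sigma> j / k * site_value k j * sin (k * (v n - v j))))"
  proof (rule sum.cong[OF refl])
    fix j assume "j \<in> {..<n}"
    then have "v j \<le> v n" using v_mono by (simp add: strict_mono_less_eq)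
    then have "hinge k j (v n) = sin (k * (v n - v j))" using v_bounds[of n] by (subst hinge_sin_max) auto
    then show "of_real (\<sigma> j / k * site_value k j) * complex_of_real (hinge k j (v n)) = of_real (\<sigma> j / k * site_value k j * sin (k * (v n - v j)))"
      by simp
  qed
  finally show ?thesis using v_bounds[of n] by (simp add: sol_def site_eq[of k n])
qed

text \<open>
  Green's identity. In every hinge, the boundary term at its own site cancels the interaction term of that site in the
  form, so only the boundary term at \<open>L\<close> survives, and it carries the slope of the solution there.
\<close>

lemma sol_green:
  assumes "continuous_on {0..L} \<psi>" "integrable (lebesgue_on {0..L}) h" "has_weak_deriv L \<psi> h"
  shows "(LINT x|lebesgue_on {0..L}. h x * sol' k x) + (\<Sum>n. of_real (\<sigma> n) * (sol k (v n) * \<psi> (v n)))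
     = of_real (k\<^sup>2) * (LINT x|lebesgue_on {0..L}. \<psi> x * sol k x) + of_real (k * end_slope k) * \<psi> L"
proof -
  let ?M = "lebesgue_on {0..L}" let ?c = "\<lambda>n. complex_of_real (\<sigma> n / k * site_value k n)"
  have \<psi>i: "integrable ?M \<psi>" using assms(1) by (rule continuous_integrable_on_Icc)
  have base: "(LINT x|?M. h x * of_real (- k * sin (k * x)))
      = \<psi> L * of_real (- k * sin (k * L)) + of_real (k\<^sup>2) * (LINT x|?M. \<psi> x * of_real (cos (k * x)))"
  proof -
    have "(LINT x|?M. h x * of_real (- k * sin (k * x) * indicator {0..L} x))
      = \<psi> L * of_real (- k * sin (k * L)) - \<psi> 0 * of_real (- k * sin (k * 0))
        - (LINT x|?M. \<psi> x * of_real (- k\<^sup>2 * cos (k * x) * indicator {0..L} x))"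
      by (rule weak_deriv_integration_by_parts[OF assms])
        (use L_pos in \<open>auto intro!: derivative_eq_intros continuous_intros simp: power2_eq_square\<close>)
    moreover have "(LINT x|?M. h x * of_real (- k * sin (k * x) * indicator {0..L} x)) = (LINT x|?M. h x * of_real (- k * sin (k * x)))"
      by (rule Bochner_Integration.integral_cong) auto
    moreover have "(LINT x|?M. \<psi> x * of_real (- k\<^sup>2 * cos (k * x) * indicator {0..L} x)) = (LINT x|?M. - of_real (k\<^sup>2) * (\<psi> x * of_real (cos (k * x))))"
      by (rule Bochner_Integration.integral_cong) auto
    moreover have "\<dots> = - of_real (k\<^sup>2) * (LINT x|?M. \<psi> x * of_real (cos (k * x)))"
      by (rule Bochner_Integration.integral_mult_right_zero)
    ultimately show ?thesis by simp
  qed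
  have term_eq: "?c n * (LINT x|?M. h x * of_real (hinge' k n x)) - of_real (k\<^sup>2) * (?c n * (LINT x|?M. \<psi> x * of_real (hinge k n x)))
      = \<psi> L * of_real (k * (\<sigma> n / k * site_value k n * cos (k * (L - v n)))) - of_real (\<sigma> n) * (sol k (v n) * \<psi> (v n))" for n
    unfolding hinge_green[OF assms] sol_at_site using k by (simp add: algebra_simps)
  have S1: "(\<lambda>n. \<psi> L * of_real (k * (\<sigma> n / k * site_value k n * cos (k * (L - v n))))) sums
     (\<psi> L * of_real (k * (end_slope k + sin (k * L))))"
  proof -
    have "(\<lambda>n. \<sigma> n / k * site_value k n * cos (k * (L - v n))) sums (end_slope k + sin (k * L))"
      using summable_sums[OF summable_end_slope[OF k]] by (simp add: end_slope_def)
    then show ?thesis by (intro sums_mult sums_of_real)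
  qed
  have "(\<lambda>n. \<psi> L * of_real (k * (\<sigma> n / k * site_value k n * cos (k * (L - v n)))) - of_real (\<sigma> n) * (sol k (v n) * \<psi> (v n))) sums
     ((LINT x|?M. h x * sol' k x) - (LINT x|?M. h x * of_real (- k * sin (k * x)))
       - of_real (k\<^sup>2) * ((LINT x|?M. \<psi> x * sol k x) - (LINT x|?M. \<psi> x * of_real (cos (k * x)))))"
    unfolding term_eq[symmetric]
    by (intro sums_diff sums_mult integral_sol_expand assms(2) \<psi>i)
  from sums_diff[OF S1 this]
  have "(\<lambda>n. of_real (\<sigma> n) * (sol k (v n) * \<psi> (v n))) sums (\<psi> L * of_real (k * (end_slope k + sin (k * L)))
     - ((LINT x|?M. h x * sol' k x) - (LINT x|?M. h x * of_real (- k * sin (k * x)))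
       - of_real (k\<^sup>2) * ((LINT x|?M. \<psi> x * sol k x) - (LINT x|?M. \<psi> x * of_real (cos (k * x))))))"
    by simp
  from sums_unique[OF this, symmetric] show ?thesis
    unfolding base by (simp add: algebra_simps)
qed

end

lemmas eigenspace_H1 = eigenspace_eq[of v L \<sigma>, OF _ \<sigma>_nonneg \<sigma>_summable]

lemma eigenspace_iff:
  "\<phi> \<in> eigenspace L v \<sigma> t \<longleftrightarrow>
    \<phi> \<in> H1 L \<and> (\<forall>\<psi>\<in>H1 L. sesq_form L v \<sigma> \<phi> \<psi> = of_real t * L2_inner L \<phi> \<psi>)"
  using v_bounds by (subst eigenspace_H1) (auto simp: less_imp_le)

text \<open>
  Testing the equation with the eigenfunction itself equates a sum of nonnegative terms with a nonpositive
  number, so all terms vanish; in particular the weak derivative is zero.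
\<close>

lemma nonpos_eigenfunction_constant:
  assumes \<phi>: "\<phi> \<in> eigenspace L v \<sigma> t" and t: "t \<le> 0"
  shows "\<phi> = (\<lambda>x. if x \<in> {0..L} then \<phi> 0 else 0)" "t * (cmod (\<phi> 0))\<^sup>2 = 0" "\<sigma> n * (cmod (\<phi> 0))\<^sup>2 = 0"
proof -
  let ?M = "lebesgue_on {0..L}" let ?g = "weak_deriv L \<phi>"
  have H: "\<phi> \<in> H1 L" using \<phi> by (simp add: eigenspace_iff)
  note g = H1_weak_deriv[OF H]
  have cont: "continuous_on {0..L} \<phi>" using H by (simp add: H1_def)
  from continuous_bounded_Icc[OF cont] obtain C where C: "C \<ge> 0" "\<And>x. x \<in> {0..L} \<Longrightarrow> cmod (\<phi> x) \<le> C"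
    by metis
  define S where "S = (\<Sum>n. \<sigma> n * (cmod (\<phi> (v n)))\<^sup>2)"
  have sm: "summable (\<lambda>n. \<sigma> n * (cmod (\<phi> (v n)))\<^sup>2)"
  proof (rule summable_comparison_test')
    show "summable (\<lambda>n. \<sigma> n * C\<^sup>2)" using \<sigma>_summable by (rule summable_mult2)
    show "norm (\<sigma> n * (cmod (\<phi> (v n)))\<^sup>2) \<le> \<sigma> n * C\<^sup>2" for n
      using C(2)[of "v n"] v_bounds[of n] \<sigma>_nonneg[of n]
      by (auto simp: abs_mult intro!: mult_left_mono power_mono)
  qed
  have "sesq_form L v \<sigma> \<phi> \<phi> = of_real (LINT x|?M. (cmod (?g x))\<^sup>2) + of_real S"
  proof -
    have "(\<Sum>n. complex_of_real (\<sigma> n) * (\<phi> (v n) * cnj (\<phi> (v n)))) = (\<Sum>n. of_real (\<sigma> n * (cmod (\<phi> (v n)))\<^sup>2))"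
      by (simp flip: complex_norm_square)
    also have "\<dots> = of_real S" unfolding S_def using suminf_of_real[OF sm, symmetric] by simp
    finally show ?thesis unfolding sesq_form_def L2_inner_self by simp
  qed
  moreover have "sesq_form L v \<sigma> \<phi> \<phi> = of_real t * of_real (LINT x|?M. (cmod (\<phi> x))\<^sup>2)"
    using \<phi> H unfolding L2_inner_self[symmetric] eigenspace_iff by blast
  ultimately have "complex_of_real ((LINT x|?M. (cmod (?g x))\<^sup>2) + S) = of_real (t * (LINT x|?M. (cmod (\<phi> x))\<^sup>2))"
    by simp
  then have eq: "(LINT x|?M. (cmod (?g x))\<^sup>2) + S = t * (LINT x|?M. (cmod (\<phi> x))\<^sup>2)"
    by (simp only: of_real_eq_iff)
  have nn: "(LINT x|?M. (cmod (?g x))\<^sup>2) \<ge> 0" "S \<ge> 0" "t * (LINT x|?M. (cmod (\<phi> x))\<^sup>2) \<le> 0"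
    unfolding S_def using \<sigma>_nonneg t by (auto intro!: suminf_nonneg sm mult_nonpos_nonneg integral_nonneg_AE)
  then have z: "(LINT x|?M. (cmod (?g x))\<^sup>2) = 0" "S = 0" "t * (LINT x|?M. (cmod (\<phi> x))\<^sup>2) = 0"
    using eq by linarith+
  have "AE x in ?M. (cmod (?g x))\<^sup>2 = 0"
    using z(1) g(1) by (subst integral_nonneg_eq_0_iff_AE[symmetric]) (auto simp: L2_def)
  then have AE0: "AE x in ?M. ?g x = 0" by simp
  have const: "\<phi> b = \<phi> 0" if b: "b \<in> {0..L}" for b
  proof (cases "b = 0")
    case False
    then have b': "0 < b" "b \<le> L" using b by auto
    have "(LINT x|?M. ?g x * of_real (1 * indicator {0..b} x)) = \<phi> b * of_real 1 - \<phi> 0 * of_real 1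
      - (LINT x|?M. \<phi> x * of_real (0 * indicator {0..b} x))"
      by (rule weak_deriv_integration_by_parts[OF cont L2_imp_integrable[OF g(1)] g(2)]) (use b' in auto)
    moreover have "(LINT x|?M. ?g x * of_real (1 * indicator {0..b} x)) = 0"
      by (rule integral_eq_zero_AE) (use AE0 in eventually_elim, simp)
    ultimately show ?thesis by simp
  qed simp
  show "\<phi> = (\<lambda>x. if x \<in> {0..L} then \<phi> 0 else 0)"
  proof
    fix x show "\<phi> x = (if x \<in> {0..L} then \<phi> 0 else 0)"
      using const[of x] H by (auto simp: H1_def)
  qed
  have "(LINT x|?M. (cmod (\<phi> x))\<^sup>2) = (LINT x|?M. (cmod (\<phi> 0))\<^sup>2)"
  proof (rule Bochner_Integration.integral_cong[OF refl])
    fix x assume "x \<in> space ?M"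
    then have "\<phi> x = \<phi> 0" by (intro const) simp
    then show "(cmod (\<phi> x))\<^sup>2 = (cmod (\<phi> 0))\<^sup>2" by simp
  qed
  also have "\<dots> = L * (cmod (\<phi> 0))\<^sup>2"
    using L_pos by (simp add: measure_restrict_space)
  finally show "t * (cmod (\<phi> 0))\<^sup>2 = 0" using z(3) L_pos by simp
  have "\<sigma> n * (cmod (\<phi> (v n)))\<^sup>2 = 0"
    using z(2) suminf_eq_zero_iff[OF sm] \<sigma>_nonneg unfolding S_def by simp
  then show "\<sigma> n * (cmod (\<phi> 0))\<^sup>2 = 0" using const[of "v n"] v_bounds[of n] by simp
qed

lemma zero_in_eigenspace: "(\<lambda>_. 0) \<in> eigenspace L v \<sigma> t"
proof -
  have "(\<lambda>_. 0) \<in> H1 L" using const_in_H1[OF L_pos, of 0] by simp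
  moreover have "has_weak_deriv L (\<lambda>_. 0) (\<lambda>_. 0)" using one_has_weak_deriv[OF L_pos, of 0] by simp
  moreover have "(\<lambda>_. 0) \<in> L2 L" by (intro continuous_imp_L2 continuous_intros)
  ultimately show ?thesis
    unfolding eigenspace_iff
  proof (intro conjI ballI)
    fix \<psi> assume "\<psi> \<in> H1 L"
    from sesq_form_eq[OF \<open>(\<lambda>_. 0) \<in> H1 L\<close> \<open>(\<lambda>_. 0) \<in> L2 L\<close> \<open>has_weak_deriv L (\<lambda>_. 0) (\<lambda>_. 0)\<close> this H1_weak_deriv[OF this]]
    show "sesq_form L v \<sigma> (\<lambda>_. 0) \<psi> = of_real t * L2_inner L (\<lambda>_. 0) \<psi>" by (simp add: L2_inner_def)
  qed
qed

lemma dim_eigenspace_nonpos: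
  assumes "t < 0 \<or> t = 0 \<and> (\<exists>n. \<sigma> n \<noteq> 0)"
  shows "cfun.dim (eigenspace L v \<sigma> t) = 0"
proof (rule eigenspace_zero_dim)
  have "\<phi> = (\<lambda>_. 0)" if \<phi>: "\<phi> \<in> eigenspace L v \<sigma> t" for \<phi>
  proof -
    have "t \<le> 0" using assms by auto
    note n = nonpos_eigenfunction_constant[OF \<phi> this]
    have "\<phi> 0 = 0" using assms n(2,3) by auto
    then show ?thesis by (subst n(1)) auto
  qed
  then show "eigenspace L v \<sigma> t = {\<lambda>_. 0}" using zero_in_eigenspace by auto
qed

lemma dim_eigenspace_free_0:
  assumes "\<And>n. \<sigma> n = 0" shows "cfun.dim (eigenspace L v \<sigma> 0) = 1"
proof (rule eigenspace_line_dim[where f = "\<lambda>x. if x \<in> {0..L} then 1 else 0"])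
  show "(\<lambda>x. if x \<in> {0..L} then 1 else 0) \<noteq> (\<lambda>_. 0 :: complex)"
    using L_pos by (auto simp: fun_eq_iff intro!: exI[of _ 0])
  have c: "(\<lambda>x. c * (if x \<in> {0..L} then 1 else 0)) = (\<lambda>x. if x \<in> {0..L} then c else 0)" for c :: complex
    by auto
  have "(\<lambda>x. if x \<in> {0..L} then c else 0) \<in> eigenspace L v \<sigma> 0" for c
  proof -
    have "(\<lambda>_. 0) \<in> L2 L" by (intro continuous_imp_L2 continuous_intros)
    show ?thesis
      unfolding eigenspace_iff
    proof (intro conjI ballI const_in_H1[OF L_pos])
      fix \<psi> assume "\<psi> \<in> H1 L"
      from sesq_form_eq[OF const_in_H1[OF L_pos] \<open>(\<lambda>_. 0) \<in> L2 L\<close> one_has_weak_deriv[OF L_pos] this H1_weak_deriv[OF this]]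
      show "sesq_form L v \<sigma> (\<lambda>x. if x \<in> {0..L} then c else 0) \<psi> = of_real 0 * L2_inner L (\<lambda>x. if x \<in> {0..L} then c else 0) \<psi>"
        by (simp add: L2_inner_def assms)
    qed
  qed
  moreover have "\<exists>c. \<phi> = (\<lambda>x. if x \<in> {0..L} then c else 0)" if "\<phi> \<in> eigenspace L v \<sigma> 0" for \<phi>
    using nonpos_eigenfunction_constant(1)[OF that] by blast
  ultimately show "eigenspace L v \<sigma> 0 = {\<lambda>x. c * (if x \<in> {0..L} then 1 else 0) |c. True}"
    unfolding c by blast
qed

context
  fixes k :: real assumes k: "k > 0"
begin

lemma sol_0: "sol k 0 = 1"
  using sol_at_site[OF k, of 0] by (simp add: v0 site_value_def)

lemma sesq_form_sol:
  assumes \<psi>: "\<psi> \<in> H1 L"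
  shows "sesq_form L v \<sigma> (\<lambda>x. c * sol k x) \<psi>
    = of_real (k\<^sup>2) * L2_inner L (\<lambda>x. c * sol k x) \<psi> + c * of_real (k * end_slope k) * cnj (\<psi> L)"
proof -
  let ?M = "lebesgue_on {0..L}"
  let ?h = "weak_deriv L \<psi>"
  note h = H1_weak_deriv[OF \<psi>]
  have "continuous_on {0..L} (\<lambda>x. cnj (\<psi> x))" using \<psi> by (auto simp: H1_def intro!: continuous_intros)
  from sol_green[OF k this _ has_weak_deriv_cnj[OF h(2)]]
  have green: "(LINT x|?M. cnj (?h x) * sol' k x) + (\<Sum>n. of_real (\<sigma> n) * (sol k (v n) * cnj (\<psi> (v n))))
     = of_real (k\<^sup>2) * (LINT x|?M. cnj (\<psi> x) * sol k x) + of_real (k * end_slope k) * cnj (\<psi> L)"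
    using L2_imp_integrable[OF h(1)] by simp
  have "(\<Sum>n. of_real (\<sigma> n) * ((c * sol k (v n)) * cnj (\<psi> (v n)))) = (\<Sum>n. c * (of_real (\<sigma> n) * (sol k (v n) * cnj (\<psi> (v n)))))"
    by (simp add: mult_ac)
  also have "\<dots> = c * (\<Sum>n. of_real (\<sigma> n) * (sol k (v n) * cnj (\<psi> (v n))))"
  proof (rule suminf_mult)
    from continuous_bounded_Icc[OF \<open>continuous_on {0..L} (\<lambda>x. cnj (\<psi> x))\<close>]
    obtain C where C: "C \<ge> 0" "\<And>x. x \<in> {0..L} \<Longrightarrow> cmod (cnj (\<psi> x)) \<le> C" by metis
    show "summable (\<lambda>n. of_real (\<sigma> n) * (sol k (v n) * cnj (\<psi> (v n))))"
    proof (rule summable_comparison_test')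
      show "summable (\<lambda>n. \<bar>\<sigma> n * site_value k n\<bar> * C)" by (rule summable_mult2[OF summable_site[OF k]])
      show "norm (complex_of_real (\<sigma> n) * (sol k (v n) * cnj (\<psi> (v n)))) \<le> \<bar>\<sigma> n * site_value k n\<bar> * C" for n
        using C(2)[of "v n"] v_bounds[of n] unfolding sol_at_site[OF k] norm_mult norm_of_real abs_mult mult.assoc
        by (intro mult_left_mono) auto
    qed
  qed
  finally have S: "(\<Sum>n. of_real (\<sigma> n) * ((c * sol k (v n)) * cnj (\<psi> (v n)))) = \<dots>" .
  have "sesq_form L v \<sigma> (\<lambda>x. c * sol k x) \<psi> = L2_inner L (\<lambda>x. c * sol' k x) ?h
     + (\<Sum>n. of_real (\<sigma> n) * ((c * sol k (v n)) * cnj (\<psi> (v n))))"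
    by (rule sesq_form_eq[OF H1_cmult[OF sol_H1[OF k]] L2_cmult[OF sol'_L2[OF k]]
      has_weak_deriv_cmult[OF sol_has_weak_deriv[OF k]] \<psi> h])
  also have "L2_inner L (\<lambda>x. c * sol' k x) ?h = c * (LINT x|?M. cnj (?h x) * sol' k x)"
    unfolding L2_inner_def by (simp add: mult.assoc mult.commute[of "sol' k _"])
  also have "c * (LINT x|?M. cnj (?h x) * sol' k x) + (\<Sum>n. of_real (\<sigma> n) * ((c * sol k (v n)) * cnj (\<psi> (v n))))
     = c * (of_real (k\<^sup>2) * (LINT x|?M. cnj (\<psi> x) * sol k x) + of_real (k * end_slope k) * cnj (\<psi> L))"
    unfolding S green[symmetric] by (simp add: distrib_left)
  also have "c * (LINT x|?M. cnj (\<psi> x) * sol k x) = L2_inner L (\<lambda>x. c * sol k x) \<psi>"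
    unfolding L2_inner_def by (simp add: mult.assoc mult.commute[of "sol k _"])
  then have "c * (of_real (k\<^sup>2) * (LINT x|?M. cnj (\<psi> x) * sol k x) + of_real (k * end_slope k) * cnj (\<psi> L))
     = of_real (k\<^sup>2) * L2_inner L (\<lambda>x. c * sol k x) \<psi> + c * of_real (k * end_slope k) * cnj (\<psi> L)"
    by (simp add: distrib_left mult.left_commute mult.assoc)
  finally show ?thesis .
qed

text \<open>
  The test function \<open>sin (k max 0 (y - x))\<close> solves the equation to the left of \<open>y\<close>. Integration by parts therefore
  leaves only the values of the eigenfunction at 0, at \<open>y\<close> and at the sites to the left of \<open>y\<close>.
\<close>

lemma eigenfunction_integral_equation:
  assumes \<phi>: "\<phi> \<in> eigenspace L v \<sigma> (k\<^sup>2)" and y: "0 < y" "y \<le> L"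
  shows "of_real k * \<phi> y = of_real (k * cos (k * y)) * \<phi> 0 + (\<Sum>n. of_real (\<sigma> n) * (\<phi> (v n) * of_real (hinge k n y)))"
proof -
  let ?M = "lebesgue_on {0..L}"
  let ?g = "weak_deriv L \<phi>"
  have H: "\<phi> \<in> H1 L" using \<phi> by (simp add: eigenspace_iff)
  note g = H1_weak_deriv[OF H]
  define \<psi> where "\<psi> x = complex_of_real (sin (k * (y - x)) * indicator {0..y} x)" for x
  define h where "h x = complex_of_real (- k * cos (k * (y - x)) * indicator {0..y} x)" for x
  have wd: "has_weak_deriv L \<psi> h"
    unfolding \<psi>_def[abs_def] h_def[abs_def]
    by (rule truncated_has_weak_deriv[OF L_pos]) (use y in \<open>auto intro!: derivative_eq_intros continuous_intros\<close>)
  have hL2: "h \<in> L2 L"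
  proof (rule bounded_imp_L2)
    have "(\<lambda>x. complex_of_real (- k * cos (k * (y - x)))) \<in> borel_measurable ?M"
      by (intro measurable_Icc continuous_intros)
    from borel_measurable_times[OF this of_real_indicator_Icc_measurable, of 0 y]
    show "h \<in> borel_measurable ?M" by (simp add: h_def[abs_def])
    show "cmod (h x) \<le> k" for x
      unfolding h_def norm_of_real abs_mult using k by (auto simp: indicator_def mult_left_le)
  qed
  have "continuous_on {0..L} \<psi>"
  proof (rule continuous_on_eq)
    show "continuous_on {0..L} (\<lambda>x. complex_of_real (sin (k * max 0 (y - x))))" by (intro continuous_intros)
    show "complex_of_real (sin (k * max 0 (y - x))) = \<psi> x" if "x \<in> {0..L}" for x
      using that by (auto simp: \<psi>_def max_def indicator_def)
  qed
  then have \<psi>H: "\<psi> \<in> H1 L" unfolding H1_def using wd hL2 y by (auto simp: \<psi>_def)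
  have ibp: "(LINT x|?M. ?g x * h x) = - of_real k * \<phi> y + of_real (k * cos (k * y)) * \<phi> 0
     + of_real (k\<^sup>2) * (LINT x|?M. \<phi> x * \<psi> x)"
  proof -
    have "(LINT x|?M. ?g x * of_real (- k * cos (k * (y - x)) * indicator {0..y} x))
       = \<phi> y * of_real (- k * cos (k * (y - y))) - \<phi> 0 * of_real (- k * cos (k * (y - 0)))
         - (LINT x|?M. \<phi> x * of_real (- k\<^sup>2 * sin (k * (y - x)) * indicator {0..y} x))"
      by (rule weak_deriv_integration_by_parts[OF _ L2_imp_integrable[OF g(1)] g(2)])
        (use y H in \<open>auto simp: H1_def power2_eq_square intro!: derivative_eq_intros continuous_intros\<close>)
    also have "(LINT x|?M. \<phi> x * of_real (- k\<^sup>2 * sin (k * (y - x)) * indicator {0..y} x))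
       = (LINT x|?M. - of_real (k\<^sup>2) * (\<phi> x * \<psi> x))"
      by (rule Bochner_Integration.integral_cong) (simp_all add: \<psi>_def)
    also have "\<dots> = - of_real (k\<^sup>2) * (LINT x|?M. \<phi> x * \<psi> x)" by (rule Bochner_Integration.integral_mult_right_zero)
    finally show ?thesis unfolding h_def by (simp add: algebra_simps)
  qed
  define S where "S = (\<Sum>n. complex_of_real (\<sigma> n) * (\<phi> (v n) * of_real (hinge k n y)))"
  have "sesq_form L v \<sigma> \<phi> \<psi> = of_real (k\<^sup>2) * L2_inner L \<phi> \<psi>"
    using \<phi> \<psi>H unfolding eigenspace_iff by blast
  moreover have "sesq_form L v \<sigma> \<phi> \<psi> = L2_inner L ?g h + (\<Sum>n. of_real (\<sigma> n) * (\<phi> (v n) * cnj (\<psi> (v n))))"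
    by (rule sesq_form_eq[OF H g \<psi>H hL2 wd])
  moreover have "L2_inner L ?g h = (LINT x|?M. ?g x * h x)" "L2_inner L \<phi> \<psi> = (LINT x|?M. \<phi> x * \<psi> x)"
    by (simp_all add: L2_inner_def h_def \<psi>_def)
  moreover have "cnj (\<psi> (v n)) = of_real (hinge k n y)" for n
    using y v_bounds[of n] by (auto simp: \<psi>_def hinge_def indicator_def)
  ultimately have "(LINT x|?M. ?g x * h x) + S = of_real (k\<^sup>2) * (LINT x|?M. \<phi> x * \<psi> x)"
    by (simp add: S_def)
  then have "of_real k * \<phi> y = of_real (k * cos (k * y)) * \<phi> 0 + S"
    unfolding ibp by (simp add: algebra_simps)
  then show ?thesis by (simp only: S_def)
qed

text \<open>
  The integral equation expresses the value at \<open>y\<close> by the values at 0 and at the sites to the left of \<open>y\<close>. So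
  it fixes the values at the sites by induction, and then all values.
\<close>

lemma eigenfunction_eq_sol:
  assumes \<phi>: "\<phi> \<in> eigenspace L v \<sigma> (k\<^sup>2)"
  shows "\<phi> = (\<lambda>x. \<phi> 0 * sol k x)"
proof -
  have site_eq: "\<phi> y = \<phi> 0 * sol k y"
    if y: "0 < y" "y \<le> L" and agree: "\<And>n. v n < y \<Longrightarrow> \<phi> (v n) = \<phi> 0 * of_real (site_value k n)" for y
  proof -
    have "of_real (\<sigma> n) * (\<phi> (v n) * of_real (hinge k n y)) = of_real k * \<phi> 0 * (of_real (\<sigma> n / k * site_value k n) * of_real (hinge k n y))" for n
    proof (cases "v n < y")
      case True then show ?thesis using k by (simp add: agree)
    next
      case False
      then have "hinge k n y = 0" using y v_bounds[of n] by (subst hinge_sin_max) auto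
      then show ?thesis by simp
    qed
    then have "(\<Sum>n. of_real (\<sigma> n) * (\<phi> (v n) * of_real (hinge k n y)))
       = (\<Sum>n. of_real k * \<phi> 0 * (of_real (\<sigma> n / k * site_value k n) * of_real (hinge k n y)))"
      by (simp only:)
    also have "\<dots> = of_real k * \<phi> 0 * (\<Sum>n. of_real (\<sigma> n / k * site_value k n) * of_real (hinge k n y))"
      by (rule suminf_mult[OF summable_coeff_hinge[OF k]])
    finally have S: "(\<Sum>n. of_real (\<sigma> n) * (\<phi> (v n) * of_real (hinge k n y))) = \<dots>" .
    have "sol k y = of_real (cos (k * y)) + (\<Sum>n. of_real (\<sigma> n / k * site_value k n) * of_real (hinge k n y))"
      using y by (simp add: sol_def)
    then have "of_real k * \<phi> y = of_real k * (\<phi> 0 * sol k y)"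
      unfolding eigenfunction_integral_equation[OF \<phi> y] S by (simp only: of_real_mult distrib_left mult_ac)
    then show ?thesis using k by simp
  qed
  have sites: "\<phi> (v n) = \<phi> 0 * of_real (site_value k n)" for n
  proof (induction n rule: less_induct)
    case (less n)
    show ?case
    proof (cases "n = 0")
      case True then show ?thesis by (simp add: v0 site_value_def)
    next
      case False
      then have "0 < v n" using v_mono v0 by (metis gr0I strict_mono_less)
      then have "\<phi> (v n) = \<phi> 0 * sol k (v n)"
        using v_bounds[of n] less v_mono by (intro site_eq) (auto simp: strict_mono_less)
      then show ?thesis by (simp add: sol_at_site[OF k])
    qed
  qed
  show ?thesis
  proof
    fix x
    consider "x \<notin> {0..L}" | "x = 0" | "0 < x" "x \<le> L" by force
    then show "\<phi> x = \<phi> 0 * sol k x"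
    proof cases
      case 1
      have "\<phi> \<in> H1 L" using \<phi> by (simp add: eigenspace_iff)
      then have "\<phi> x = 0" using 1 by (auto simp: H1_def)
      moreover have "sol k x = 0" using 1 by (auto simp: sol_def)
      ultimately show ?thesis by simp
    next
      case 2 then show ?thesis by (simp add: sol_0)
    next
      case 3 then show ?thesis using site_eq sites by blast
    qed
  qed
qed

text \<open>
  Every eigenfunction is a multiple of \<open>sol\<close>, and testing the equation with the constant 1 shows that the boundary
  term in Green's identity has to vanish.
\<close>

lemma eigenspace_pos:
  "eigenspace L v \<sigma> (k\<^sup>2) = {\<lambda>x. c * sol k x |c. c * of_real (end_slope k) = 0}"
proof (intro equalityI subsetI)
  fix \<phi> assume \<phi>: "\<phi> \<in> eigenspace L v \<sigma> (k\<^sup>2)"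
  let ?\<psi> = "\<lambda>x. if x \<in> {0..L} then 1 else 0 :: complex"
  have "sesq_form L v \<sigma> \<phi> ?\<psi> = of_real (k\<^sup>2) * L2_inner L \<phi> ?\<psi>"
    using \<phi> const_in_H1[OF L_pos] unfolding eigenspace_iff by blast
  then have "\<phi> 0 * of_real (k * end_slope k) * cnj (?\<psi> L) = 0"
    using sesq_form_sol[OF const_in_H1[OF L_pos, of 1], of "\<phi> 0"]
    unfolding eigenfunction_eq_sol[OF \<phi>, symmetric] by simp
  then show "\<phi> \<in> {\<lambda>x. c * sol k x |c. c * of_real (end_slope k) = 0}"
    using eigenfunction_eq_sol[OF \<phi>] k L_pos by auto
next
  fix \<phi> assume "\<phi> \<in> {\<lambda>x. c * sol k x |c. c * of_real (end_slope k) = 0}"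
  then obtain c where c: "\<phi> = (\<lambda>x. c * sol k x)" "c * of_real (end_slope k) = 0" by auto
  show "\<phi> \<in> eigenspace L v \<sigma> (k\<^sup>2)"
    unfolding eigenspace_iff c(1) using sesq_form_sol[of _ c] H1_cmult[OF sol_H1[OF k], of c] c(2) by auto
qed

lemma dim_eigenspace_pos:
  "cfun.dim (eigenspace L v \<sigma> (k\<^sup>2)) = (if cos (final_angle k) = 0 then 1 else 0)"
proof (cases "cos (final_angle k) = 0")
  case True
  then have "eigenspace L v \<sigma> (k\<^sup>2) = {\<lambda>x. c * sol k x |c. True}"
    using end_slope_eq_0_iff[OF k] by (simp add: eigenspace_pos)
  moreover have "sol k \<noteq> (\<lambda>_. 0)" using sol_0 by (metis zero_neq_one)
  ultimately show ?thesis using eigenspace_line_dim True by auto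
next
  case False
  then have "eigenspace L v \<sigma> (k\<^sup>2) = {\<lambda>_. 0}"
    using end_slope_eq_0_iff[OF k] by (auto simp: eigenspace_pos)
  then show ?thesis using eigenspace_zero_dim False by auto
qed

end

section \<open>Eigenvalues as squares of frequencies\<close>

lemma continuous_phase: "continuous_on {0<..} (\<lambda>k. phase k n)"
proof (induction n)
  case (Suc n)
  have "continuous_on {0<..} (\<lambda>k. kick (\<sigma> n / k) (phase k n + k * v n))"
    using strength_nonneg by (intro continuous_on_kick continuous_intros Suc) auto
  then show ?case using Suc by (auto intro: continuous_on_add)
qed simp

lemma continuous_final_angle:
  assumes "a > 0" shows "continuous_on {a..b} final_angle"
proof -
  have c: "continuous_on {a..b} (\<lambda>k. kick (\<sigma> n / k) (angle k n))" for n
    unfolding angle_def using assms strength_nonneg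
    by (intro continuous_on_kick continuous_intros continuous_on_subset[OF continuous_phase]) auto
  have u: "uniform_limit {a..b} (\<lambda>n k. \<Sum>i<n. kick (\<sigma> i / k) (angle k i)) (\<lambda>k. \<Sum>i. kick (\<sigma> i / k) (angle k i)) sequentially"
  proof (rule Weierstrass_m_test[OF _ summable_strength])
    fix n k assume k: "k \<in> {a..b}"
    then have k0: "k > 0" using assms by auto
    have "norm (kick (\<sigma> n / k) (angle k n)) \<le> \<sigma> n / k"
      using kick_nonpos[OF strength_nonneg[OF k0]] kick_ge[OF strength_nonneg[OF k0], of n "angle k n"]
      by (simp add: abs_le_iff minus_le_iff)
    also have "\<dots> \<le> \<sigma> n / a" using k assms \<sigma>_nonneg[of n] by (intro divide_left_mono) auto
    finally show "norm (kick (\<sigma> n / k) (angle k n)) \<le> \<sigma> n / a" .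
  qed
  have "continuous_on {a..b} (\<lambda>k. \<Sum>i. kick (\<sigma> i / k) (angle k i))"
    by (rule uniform_limit_theorem[OF _ u]) (auto intro!: always_eventually continuous_on_sum c)
  then show ?thesis unfolding final_angle_def[abs_def] by (intro continuous_intros)
qed

lemma angle_pos: assumes k: "k > 0" shows "angle k n > 0"
proof (induction n)
  case 0 then show ?case by (simp add: angle_def v0)
next
  case (Suc n)
  have s: "\<sigma> n / k \<ge> 0" using strength_nonneg[OF k] .
  have "0 < (angle k n - 0) / (1 + \<sigma> n / k)\<^sup>2" using Suc s by simp
  also have "\<dots> \<le> (angle k n + kick (\<sigma> n / k) (angle k n)) - (0 + kick (\<sigma> n / k) 0)"
    using Suc s by (intro kick_angle_expansion) auto
  also have "\<dots> = angle k (Suc n) - k * (v (Suc n) - v n)" by (simp add: angle_def algebra_simps)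
  finally show ?case using mult_pos_pos[OF k v_Suc_pos[of n]] by linarith
qed

text \<open>
  This excludes final angles \<open>pi/2 + n pi\<close> with negative \<open>n\<close>, so the eigenvalues can be numbered by natural numbers
  without a gap.
\<close>

lemma final_angle_nonneg: assumes k: "k > 0" shows "final_angle k \<ge> 0"
proof (rule LIMSEQ_le_const)
  show "(\<lambda>n. phase k n + k * L) \<longlonglongrightarrow> final_angle k"
    using tendsto_add[OF phase_tendsto[OF k] tendsto_const[of "k * L"]] by simp
  have "0 \<le> phase k n + k * L" for n
  proof -
    have "k * v n \<le> k * L" using k v_bounds[of n] by (intro mult_left_mono) auto
    then show ?thesis using angle_pos[OF k, of n] by (simp add: angle_def)
  qed
  then show "\<exists>N. \<forall>n\<ge>N. 0 \<le> phase k n + k * L" by blast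
qed

definition deficit :: "real \<Rightarrow> real" where "deficit k = (\<Sum>n. - kick (\<sigma> n / k) (angle k n))"

lemma final_angle_eq: assumes "k > 0" shows "final_angle k = k * L + pi / 2 - deficit k"
  unfolding final_angle_def deficit_def suminf_minus[OF summable_kick[OF assms]] by simp

lemma deficit_bounds: assumes k: "k > 0" shows "0 \<le> deficit k" "deficit k \<le> (\<Sum>n. \<sigma> n) / k"
proof -
  have sm: "summable (\<lambda>n. - kick (\<sigma> n / k) (angle k n))" by (rule summable_minus[OF summable_kick[OF k]])
  show "0 \<le> deficit k" unfolding deficit_def
    using kick_nonpos[OF strength_nonneg[OF k]] by (intro suminf_nonneg sm) simp
  have "deficit k \<le> (\<Sum>n. \<sigma> n / k)" unfolding deficit_def
    using kick_ge[OF strength_nonneg[OF k]] by (intro suminf_le sm summable_strength) (simp add: minus_le_iff)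
  also have "\<dots> = (\<Sum>n. \<sigma> n) / k" by (rule suminf_divide[OF \<sigma>_summable])
  finally show "deficit k \<le> (\<Sum>n. \<sigma> n) / k" .
qed

lemma partial_deficit_bounds:
  assumes k: "k > 0" shows "0 \<le> pi / 2 - phase k n" "pi / 2 - phase k n \<le> deficit k"
proof -
  have sm: "summable (\<lambda>n. - kick (\<sigma> n / k) (angle k n))" by (rule summable_minus[OF summable_kick[OF k]])
  have eq: "pi / 2 - phase k n = (\<Sum>j<n. - kick (\<sigma> j / k) (angle k j))"
    by (simp add: phase_eq_sum sum_negf)
  show "0 \<le> pi / 2 - phase k n" unfolding eq using kick_nonpos[OF strength_nonneg[OF k]] by (intro sum_nonneg) simp
  show "pi / 2 - phase k n \<le> deficit k" unfolding eq deficit_def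
    using kick_nonpos[OF strength_nonneg[OF k]] by (intro sum_le_suminf sm) auto
qed

text \<open>
  For small \<open>k\<close> a site of positive strength acts almost like a wall. If the final angle were not below \<open>pi/2\<close>, all kicks
  together would be at most \<open>k L\<close>, and the angle would stay near \<open>pi/2\<close>. But there an interaction of large
  relative strength \<open>\<sigma> j/k\<close> turns the angle by a large amount.
\<close>

lemma final_angle_below_half_pi:
  assumes j: "\<sigma> j > 0" obtains k where "k > 0" "final_angle k < pi / 2"
proof (rule ccontr)
  assume not: "\<not> thesis"
  \<comment> \<open>The bound \<open>k L \<le> pi/6\<close> on the deficit will keep the angles before and after the kick in
      \<open>[pi/3, 2 pi/3]\<close>, where the sine is at least \<open>sqrt 3 / 2\<close>; the relative strength is at least 2.\<close>
  define k where "k = min (pi / (6 * L)) (\<sigma> j / 2)"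
  have k: "k > 0" using j L_pos by (simp add: k_def)
  have kL: "k * L \<le> pi / 6"
  proof -
    have "k * L \<le> pi / (6 * L) * L" using L_pos by (intro mult_right_mono) (auto simp: k_def)
    then show ?thesis using L_pos by simp
  qed
  have s2: "\<sigma> j / k \<ge> 2" using k by (simp add: pos_le_divide_eq k_def)
  have s: "\<sigma> j / k \<ge> 0" using s2 by simp
  have "final_angle k \<ge> pi / 2" using not that k by (meson not_le)
  then have def_le: "deficit k \<le> pi / 6" using final_angle_eq[OF k] kL by linarith
  define \<theta> where "\<theta> = angle k j"
  define a where "a = - kick (\<sigma> j / k) \<theta>"
  have a: "0 \<le> a" "a \<le> pi / 6"
  proof -
    show "0 \<le> a" using kick_nonpos[OF s] by (simp add: a_def)
    have sm: "summable (\<lambda>n. - kick (\<sigma> n / k) (angle k n))" by (rule summable_minus[OF summable_kick[OF k]])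
    have "a \<le> (\<Sum>n. - kick (\<sigma> n / k) (angle k n))"
      using sum_le_suminf[OF sm, of "{j}"] kick_nonpos[OF strength_nonneg[OF k]] by (simp add: a_def \<theta>_def)
    then show "a \<le> pi / 6" using def_le by (simp add: deficit_def)
  qed
  have th: "pi / 3 \<le> \<theta> - a" "\<theta> \<le> 2 * pi / 3"
  proof -
    have kv: "0 \<le> k * v j" "k * v j \<le> k * L" using k v_bounds[of j] by (auto intro: mult_left_mono)
    have "phase k (Suc j) = \<theta> - k * v j - a" by (simp add: a_def \<theta>_def angle_def)
    then show "pi / 3 \<le> \<theta> - a" using partial_deficit_bounds(2)[OF k, of "Suc j"] def_le kv by linarith
    show "\<theta> \<le> 2 * pi / 3" using partial_deficit_bounds(1)[OF k, of j] kv kL by (simp add: \<theta>_def angle_def)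
  qed
  have sin_ge: "sin x \<ge> sqrt 3 / 2" if "pi / 3 \<le> x" "x \<le> 2 * pi / 3" for x
  proof (cases "x \<le> pi / 2")
    case True
    then have "sin (pi / 3) \<le> sin x" using that by (intro sin_monotone_2pi_le) auto
    then show ?thesis by (simp add: sin_60)
  next
    case False
    then have "sin (pi / 3) \<le> sin (pi - x)" using that by (intro sin_monotone_2pi_le) auto
    then show ?thesis by (simp add: sin_60)
  qed
  let ?f = "kick_factor (\<sigma> j / k) \<theta>"
  have f: "?f = of_real (cmod ?f) * cis (- a)" using kick_factor_polar[OF s, of \<theta>] by (simp add: a_def)
  \<comment> \<open>Imaginary parts in polar form, before and after multiplication by \<open>cis \<theta>\<close>: the first equation makes the
      modulus of the factor at least 3, the second one makes it at most \<open>2 / sqrt 3\<close>.\<close>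
  have "Im ?f = - (cmod ?f * sin a)" by (subst f) simp
  then have 1: "cmod ?f * sin a = \<sigma> j / k * (sin \<theta>)\<^sup>2" by (simp add: kick_factor_Im)
  have "cis \<theta> * ?f = of_real (cmod ?f) * cis (\<theta> - a)"
    by (subst f) (simp add: cis_mult mult.left_commute)
  then have "Im (cis \<theta> * ?f) = cmod ?f * sin (\<theta> - a)" by simp
  then have 2: "cmod ?f * sin (\<theta> - a) = sin \<theta>" by (simp add: cis_times_kick_factor)
  have r3: "sqrt 3 / 2 > (0::real)" by simp
  have sT: "sin (\<theta> - a) \<ge> sqrt 3 / 2" by (rule sin_ge) (use th a in linarith)+
  have s\<theta>: "sin \<theta> \<ge> sqrt 3 / 2" by (rule sin_ge) (use th a in linarith)+
  have "cmod ?f * (sqrt 3 / 2) \<le> cmod ?f * sin (\<theta> - a)" using sT by (intro mult_left_mono) auto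
  also have "\<dots> \<le> 1" unfolding 2 by simp
  finally have f_le: "cmod ?f * (sqrt 3 / 2) \<le> 1" .
  have sina: "0 \<le> sin a" "sin a \<le> 1 / 2"
  proof -
    show "0 \<le> sin a" using a by (intro sin_ge_zero) auto
    have "sin a \<le> sin (pi / 6)" using a by (intro sin_monotone_2pi_le) auto
    then show "sin a \<le> 1 / 2" by (simp add: sin_30)
  qed
  have "2 * (sqrt 3 / 2)\<^sup>2 \<le> \<sigma> j / k * (sin \<theta>)\<^sup>2" using s2 s\<theta> r3 by (intro mult_mono power_mono) auto
  then have "3 / 2 \<le> cmod ?f * sin a" unfolding 1 by (simp add: power_divide)
  also have "\<dots> \<le> cmod ?f * (1 / 2)" using sina by (intro mult_left_mono) auto
  finally have "cmod ?f \<ge> 3" by simp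
  then have "3 * (sqrt 3 / 2) \<le> cmod ?f * (sqrt 3 / 2)" by (intro mult_right_mono) auto
  then have "3 * (sqrt 3 / 2) \<le> 1" using f_le by linarith
  moreover have "sqrt 3 \<ge> (1::real)" by simp
  ultimately show False by linarith
qed

text \<open>
  By the intermediate value theorem. For \<open>n = 0\<close> some interaction has to be present: without one the final
  angle \<open>k L + pi/2\<close> exceeds \<open>pi/2\<close> for all \<open>k > 0\<close>.
\<close>

lemma frequency_exists:
  assumes "n > 0 \<or> (\<exists>j. \<sigma> j \<noteq> 0)"
  shows "\<exists>k>0. final_angle k = pi / 2 + real n * pi"
proof -
  obtain a where a: "a > 0" "final_angle a \<le> pi / 2 + real n * pi"
  proof (cases "n > 0")
    case True
    have k: "pi / (2 * L) > 0" using L_pos by simp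
    have "final_angle (pi / (2 * L)) \<le> pi / (2 * L) * L + pi / 2" using final_angle_eq[OF k] deficit_bounds(1)[OF k] by linarith
    also have "\<dots> = pi / 2 + 1 * (pi / 2)" using L_pos by simp
    also have "\<dots> \<le> pi / 2 + real n * pi" using True pi_gt_zero by (intro add_left_mono mult_mono) auto
    finally show ?thesis using that k by blast
  next
    case False
    then obtain j where "\<sigma> j \<noteq> 0" using assms by auto
    then have "\<sigma> j > 0" using \<sigma>_nonneg[of j] by simp
    then obtain k where "k > 0" "final_angle k < pi / 2" by (rule final_angle_below_half_pi)
    then show ?thesis using that[of k] False by simp
  qed
  define S where "S = (\<Sum>n. \<sigma> n)"
  have S: "S \<ge> 0" unfolding S_def using \<sigma>_nonneg \<sigma>_summable by (intro suminf_nonneg)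
  define b where "b = max a (max 1 ((real n * pi + S) / L))"
  have b: "b > 0" "a \<le> b" "b \<ge> 1" "(real n * pi + S) / L \<le> b" by (auto simp: b_def)
  have "real n * pi + S \<le> b * L" using b(4) L_pos by (simp add: pos_divide_le_eq)
  moreover have "deficit b \<le> S"
  proof -
    have "S / b \<le> S / 1" using b S by (intro divide_left_mono) auto
    then show ?thesis using deficit_bounds(2)[OF b(1)] by (simp add: S_def)
  qed
  ultimately have "pi / 2 + real n * pi \<le> final_angle b" unfolding final_angle_eq[OF b(1)] by linarith
  from IVT'[OF a(2) this b(2) continuous_final_angle[OF a(1)]]
  obtain k where "a \<le> k" "final_angle k = pi / 2 + real n * pi" by blast
  then show ?thesis using a(1) by (intro exI[of _ k]) simp
qed

lemma final_angle_inj: "0 < k \<Longrightarrow> 0 < k' \<Longrightarrow> final_angle k = final_angle k' \<Longrightarrow> k = k'"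
  using final_angle_strict_mono[of k k'] final_angle_strict_mono[of k' k] by (metis less_irrefl linorder_neqE)

lemma final_angle_less_cancel: "0 < k \<Longrightarrow> 0 < k' \<Longrightarrow> final_angle k < final_angle k' \<Longrightarrow> k < k'"
  using final_angle_strict_mono[of k' k] by (metis less_asym less_irrefl linorder_neqE)

text \<open>
  A number \<open>k\<^sup>2\<close> with \<open>k > 0\<close> is an eigenvalue, and then a simple one, iff the final angle of \<open>k\<close> is
  \<open>pi/2 + n pi\<close> for some \<open>n\<close>, and each of these angles is attained at most once. The case distinction covers
  the lowest eigenvalue: it is 0, with constant eigenfunctions, iff there is no interaction.
\<close>

lemma eigval_eq_squares:
  assumes pos: "\<And>n. n > 0 \<or> (\<exists>j. \<sigma> j \<noteq> 0) \<Longrightarrow> \<kappa> n > 0 \<and> final_angle (\<kappa> n) = pi / 2 + real n * pi"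
    and free: "(\<And>j. \<sigma> j = 0) \<Longrightarrow> \<kappa> 0 = 0"
  shows "eigval L v \<sigma> = (\<lambda>n. (\<kappa> n)\<^sup>2)"
proof (rule eigval_eqI)
  have nonneg: "\<kappa> n \<ge> 0" for n
  proof (cases "n > 0 \<or> (\<exists>j. \<sigma> j \<noteq> 0)")
    case True then show ?thesis using pos[OF True] by simp
  next
    case False
    then have "n = 0" "\<And>j. \<sigma> j = 0" by auto
    then show ?thesis using free by simp
  qed
  have strict: "\<kappa> m < \<kappa> n" if "m < n" for m n
  proof (cases "m > 0 \<or> (\<exists>j. \<sigma> j \<noteq> 0)")
    case True
    have "n > 0 \<or> (\<exists>j. \<sigma> j \<noteq> 0)" using that by simp
    note m = pos[OF True] and n = pos[OF this]
    have "final_angle (\<kappa> m) < final_angle (\<kappa> n)" using m n that by simp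
    then show ?thesis by (rule final_angle_less_cancel[OF conjunct1[OF m] conjunct1[OF n]])
  next
    case False
    then have "m = 0" "\<And>j. \<sigma> j = 0" by auto
    then have "\<kappa> m = 0" using free by simp
    moreover have "\<kappa> n > 0" using pos[of n] that by simp
    ultimately show ?thesis by simp
  qed
  have inj: "\<kappa> m = \<kappa> n \<longleftrightarrow> m = n" for m n
    using strict[of m n] strict[of n m] by (cases m n rule: linorder_cases) auto
  show "eigenvalue_enum L v \<sigma> (\<lambda>n. (\<kappa> n)\<^sup>2)"
    unfolding eigenvalue_enum_def
  proof (intro conjI allI)
    show "mono (\<lambda>n. (\<kappa> n)\<^sup>2)"
      using strict nonneg by (intro monoI power_mono) (auto simp: le_less)
    fix t
    have "finite {n. (\<kappa> n)\<^sup>2 = t} \<and> card {n. (\<kappa> n)\<^sup>2 = t} = cfun.dim (eigenspace L v \<sigma> t)"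
    proof -
      consider "t > 0" | "t < 0 \<or> t = 0 \<and> (\<exists>j. \<sigma> j \<noteq> 0)" | "t = 0" "\<And>j. \<sigma> j = 0" by fastforce
      then show ?thesis
      proof cases
        case 1
        define k where "k = sqrt t"
        have k: "k > 0" "t = k\<^sup>2" using 1 by (auto simp: k_def)
        have set: "{n. (\<kappa> n)\<^sup>2 = t} = {n. final_angle k = pi / 2 + real n * pi}"
        proof -
          have "(\<kappa> n)\<^sup>2 = t \<longleftrightarrow> final_angle k = pi / 2 + real n * pi" for n
          proof (cases "n > 0 \<or> (\<exists>j. \<sigma> j \<noteq> 0)")
            case True
            then have "(\<kappa> n)\<^sup>2 = t \<longleftrightarrow> \<kappa> n = k" using nonneg[of n] k by (simp add: power2_eq_iff_nonneg)
            also have "\<dots> \<longleftrightarrow> final_angle k = final_angle (\<kappa> n)" using pos[OF True] k(1) final_angle_inj by metis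
            finally show ?thesis using pos[OF True] by simp
          next
            case False
            then have "n = 0" "\<And>j. \<sigma> j = 0" by auto
            then have "(\<kappa> n)\<^sup>2 \<noteq> t" using free k by simp
            moreover have "deficit k = 0" using \<open>\<And>j. \<sigma> j = 0\<close> by (simp add: deficit_def)
            then have "final_angle k \<noteq> pi / 2 + real n * pi" using final_angle_eq[OF k(1)] k(1) L_pos \<open>n = 0\<close> by simp
            ultimately show ?thesis by simp
          qed
          then show ?thesis by simp
        qed
        show ?thesis
        proof (cases "cos (final_angle k) = 0")
          case True
          then obtain i where i: "final_angle k = of_int i * pi + pi / 2" unfolding cos_zero_iff_int2 by blast
          have "i \<ge> 0"
          proof (rule ccontr)
            assume "\<not> i \<ge> 0"
            then have "real_of_int i * pi \<le> (-1) * pi" by (intro mult_right_mono) auto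
            then show False using i final_angle_nonneg[OF k(1)] pi_gt_zero by linarith
          qed
          then have "{n. final_angle k = pi / 2 + real n * pi} = {nat i}" using i by auto
          then show ?thesis unfolding set unfolding k(2) dim_eigenspace_pos[OF k(1)] using True by simp
        next
          case False
          have "final_angle k \<noteq> pi / 2 + real n * pi" for n :: nat
          proof
            assume "final_angle k = pi / 2 + real n * pi"
            then have "final_angle k = of_int (int n) * pi + pi / 2" by simp
            then show False using False cos_zero_iff_int2 by blast
          qed
          then have "{n. final_angle k = pi / 2 + real n * pi} = {}" by simp
          then show ?thesis unfolding set unfolding k(2) dim_eigenspace_pos[OF k(1)] using False by simp
        qed
      next
        case 2
        have "(\<kappa> n)\<^sup>2 \<noteq> t" for n
          using 2
        proof
          assume "t < 0" then show ?thesis using zero_le_power2[of "\<kappa> n"] by linarith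
        next
          assume "t = 0 \<and> (\<exists>j. \<sigma> j \<noteq> 0)" then show ?thesis using pos[of n] by auto
        qed
        then have "{n. (\<kappa> n)\<^sup>2 = t} = {}" by simp
        then show ?thesis using dim_eigenspace_nonpos[OF 2] by simp
      next
        case 3
        have "(\<kappa> n)\<^sup>2 = t \<longleftrightarrow> n = 0" for n
        proof (cases "n = 0")
          case True then show ?thesis using 3 free by simp
        next
          case False then show ?thesis using 3(1) pos[of n] by simp
        qed
        then have "{n. (\<kappa> n)\<^sup>2 = t} = {0}" by auto
        then show ?thesis using 3 dim_eigenspace_free_0 by simp
      qed
    qed
    then show "finite {n. (\<kappa> n)\<^sup>2 = t}" "card {n. (\<kappa> n)\<^sup>2 = t} = cfun.dim (eigenspace L v \<sigma> t)"
      by blast+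
  qed
qed

definition frequency :: "nat \<Rightarrow> real" where
  "frequency n = (SOME k. k > 0 \<and> final_angle k = pi / 2 + real n * pi)"

lemma frequency:
  assumes "n > 0 \<or> (\<exists>j. \<sigma> j \<noteq> 0)"
  shows "frequency n > 0" "final_angle (frequency n) = pi / 2 + real n * pi"
  using someI_ex[OF frequency_exists[OF assms, unfolded Bex_def]] unfolding frequency_def by auto

lemma eigval_frequency:
  assumes "\<exists>j. \<sigma> j \<noteq> 0" shows "eigval L v \<sigma> = (\<lambda>n. (frequency n)\<^sup>2)"
  using assms frequency by (intro eigval_eq_squares) auto

lemma eigval_free:
  assumes "\<And>j. \<sigma> j = 0" shows "eigval L v \<sigma> = (\<lambda>n. (real n * pi / L)\<^sup>2)"
proof (rule eigval_eq_squares)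
  fix n :: nat assume "n > 0 \<or> (\<exists>j. \<sigma> j \<noteq> 0)"
  then have k: "real n * pi / L > 0" using assms L_pos by auto
  moreover have "deficit (real n * pi / L) = 0" using assms by (simp add: deficit_def)
  then have "final_angle (real n * pi / L) = pi / 2 + real n * pi" using final_angle_eq[OF k] L_pos by simp
  ultimately show "real n * pi / L > 0 \<and> final_angle (real n * pi / L) = pi / 2 + real n * pi" by simp
qed simp

end

section \<open>Averages of trigonometric sequences\<close>

lemma averages_tendsto_0:
  fixes f :: "nat \<Rightarrow> real"
  assumes f: "f \<longlonglongrightarrow> 0"
  shows "(\<lambda>N. (1 / real N) * (\<Sum>n<N. f n)) \<longlonglongrightarrow> 0"
proof (rule LIMSEQ_I)
  fix e :: real assume e: "e > 0"
  obtain M where M: "\<And>n. n \<ge> M \<Longrightarrow> \<bar>f n\<bar> < e / 2" using LIMSEQ_D[OF f, of "e / 2"] e by auto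
  define C where "C = (\<Sum>n<M. \<bar>f n\<bar>)"
  have "(\<lambda>N. C * (1 / real N)) \<longlonglongrightarrow> C * 0" by (intro tendsto_intros lim_1_over_n)
  then have "(\<lambda>N. C * (1 / real N)) \<longlonglongrightarrow> 0" by simp
  from LIMSEQ_D[OF this, of "e / 2"] e obtain N0 where N0: "\<And>N. N \<ge> N0 \<Longrightarrow> \<bar>C * (1 / real N)\<bar> < e / 2" by auto
  show "\<exists>N0. \<forall>N\<ge>N0. norm ((1 / real N) * (\<Sum>n<N. f n) - 0) < e"
  proof (intro exI allI impI)
    fix N assume "N \<ge> max 1 (max M N0)"
    then have N: "N \<ge> 1" "N \<ge> M" "N \<ge> N0" by auto
    have "\<bar>\<Sum>n<N. f n\<bar> \<le> (\<Sum>n<N. \<bar>f n\<bar>)" by (rule sum_abs)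
    also have "\<dots> = C + (\<Sum>n=M..<N. \<bar>f n\<bar>)"
      using N(2) unfolding C_def by (simp add: sum.atLeastLessThan_concat[of 0 M N, symmetric] lessThan_atLeast0)
    also have "(\<Sum>n=M..<N. \<bar>f n\<bar>) \<le> (\<Sum>n=M..<N. e / 2)" using M by (intro sum_mono less_imp_le) auto
    also have "\<dots> \<le> real N * (e / 2)" using e by (simp add: mult_right_mono)
    finally have "(1 / real N) * \<bar>\<Sum>n<N. f n\<bar> \<le> (1 / real N) * (C + real N * (e / 2))"
      by (intro mult_left_mono) auto
    also have "\<dots> = C * (1 / real N) + e / 2" using N(1) by (simp add: field_simps)
    also have "\<dots> < e" using N0[OF N(3)] by linarith
    finally show "norm ((1 / real N) * (\<Sum>n<N. f n) - 0) < e" by (simp add: abs_mult)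
  qed
qed

lemma averages_cong_limit:
  fixes f g :: "nat \<Rightarrow> real"
  assumes "(\<lambda>n. f n - g n) \<longlonglongrightarrow> 0" "(\<lambda>N. (1 / real N) * (\<Sum>n<N. g n)) \<longlonglongrightarrow> c"
  shows "(\<lambda>N. (1 / real N) * (\<Sum>n<N. f n)) \<longlonglongrightarrow> c"
proof -
  have "(\<lambda>N. (1 / real N) * (\<Sum>n<N. f n - g n) + (1 / real N) * (\<Sum>n<N. g n)) \<longlonglongrightarrow> 0 + c"
    by (rule tendsto_add[OF averages_tendsto_0[OF assms(1)] assms(2)])
  then show ?thesis by (simp add: sum_subtractf right_diff_distrib)
qed

text \<open>
  Multiplied by \<open>2 sin x\<close> the sum telescopes.
\<close>

lemma abs_sum_cos_even_le:
  assumes "sin x \<noteq> 0" shows "\<bar>\<Sum>n<N. cos (2 * real n * x)\<bar> \<le> 1 / \<bar>sin x\<bar>"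
proof -
  have "2 * sin x * (\<Sum>n<N. cos (2 * real n * x)) = sin ((2 * real N - 1) * x) + sin x"
  proof (induction N)
    case (Suc N)
    have "2 * sin x * cos (2 * real N * x) = sin ((2 * real N + 1) * x) - sin ((2 * real N - 1) * x)"
      by (simp add: sin_add sin_diff algebra_simps)
    then show ?case using Suc by (simp add: distrib_left algebra_simps)
  qed simp
  then have "2 * \<bar>sin x\<bar> * \<bar>\<Sum>n<N. cos (2 * real n * x)\<bar> = \<bar>sin ((2 * real N - 1) * x) + sin x\<bar>"
    by (metis abs_mult abs_numeral)
  also have "\<dots> \<le> 2"
    using abs_sin_le_one[of "(2 * real N - 1) * x"] abs_sin_le_one[of x] by linarith
  finally have "\<bar>sin x\<bar> * \<bar>\<Sum>n<N. cos (2 * real n * x)\<bar> \<le> 1" by linarith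
  then show ?thesis using assms by (simp add: field_simps)
qed

lemma average_cos_squared:
  assumes "sin x \<noteq> 0"
  shows "(\<lambda>N. (1 / real N) * (\<Sum>n<N. (cos (real n * x))\<^sup>2)) \<longlonglongrightarrow> 1 / 2"
proof -
  have cos_sq: "(cos (real n * x))\<^sup>2 = (1 + cos (2 * real n * x)) / 2" for n
    using cos_double_cos[of "real n * x"] by (simp add: mult.assoc)
  have "(\<lambda>N. (1 / real N) * (\<Sum>n<N. cos (2 * real n * x))) \<longlonglongrightarrow> 0"
  proof (rule Lim_null_comparison)
    show "\<forall>\<^sub>F N in sequentially. norm ((1 / real N) * (\<Sum>n<N. cos (2 * real n * x))) \<le> (1 / real N) * (1 / \<bar>sin x\<bar>)"
    proof (intro always_eventually allI)
      fix N
      have "(1 / real N) * \<bar>\<Sum>n<N. cos (2 * real n * x)\<bar> \<le> (1 / real N) * (1 / \<bar>sin x\<bar>)"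
        using abs_sum_cos_even_le[OF assms] by (intro mult_left_mono) auto
      then show "norm ((1 / real N) * (\<Sum>n<N. cos (2 * real n * x))) \<le> (1 / real N) * (1 / \<bar>sin x\<bar>)"
        by (simp add: abs_mult)
    qed
    show "(\<lambda>N. (1 / real N) * (1 / \<bar>sin x\<bar>)) \<longlonglongrightarrow> 0"
      using tendsto_mult[OF lim_1_over_n tendsto_const[of "1 / \<bar>sin x\<bar>"]] by simp
  qed
  from tendsto_add[OF tendsto_const[of "1/2"] tendsto_mult[OF this tendsto_const[of "1/2"]]]
  have lim: "(\<lambda>N. 1 / 2 + (1 / real N) * (\<Sum>n<N. cos (2 * real n * x)) * (1 / 2)) \<longlonglongrightarrow> 1 / 2" by simp
  show ?thesis
  proof (rule Lim_transform_eventually[OF lim])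
    show "\<forall>\<^sub>F N in sequentially. 1 / 2 + (1 / real N) * (\<Sum>n<N. cos (2 * real n * x)) * (1 / 2) = (1 / real N) * (\<Sum>n<N. (cos (real n * x))\<^sup>2)"
      using eventually_gt_at_top[of 0]
    proof eventually_elim
      case (elim N)
      have "(\<Sum>n<N. (cos (real n * x))\<^sup>2) = (real N + (\<Sum>n<N. cos (2 * real n * x))) / 2"
        unfolding cos_sq by (simp add: sum.distrib flip: sum_divide_distrib)
      then show ?case using elim by (simp add: field_simps)
    qed
  qed
qed

lemma sin_sq_diff_le: "\<bar>(sin a)\<^sup>2 - (sin b)\<^sup>2\<bar> \<le> 2 * \<bar>a - b :: real\<bar>"
proof -
  have "\<bar>sin a - sin b\<bar> \<le> \<bar>a - b\<bar>"
  proof -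
    have "sin a - sin b = 2 * sin ((a - b) / 2) * cos ((a + b) / 2)" by (rule sin_diff_sin)
    then have "\<bar>sin a - sin b\<bar> = 2 * \<bar>sin ((a - b) / 2)\<bar> * \<bar>cos ((a + b) / 2)\<bar>" by (simp add: abs_mult)
    also have "\<dots> \<le> 2 * \<bar>(a - b) / 2\<bar> * 1" by (intro mult_mono abs_sin_x_le_abs_x) auto
    finally show ?thesis by simp
  qed
  moreover have "\<bar>sin a + sin b\<bar> \<le> 2" using abs_sin_le_one[of a] abs_sin_le_one[of b] by linarith
  moreover have "(sin a)\<^sup>2 - (sin b)\<^sup>2 = (sin a + sin b) * (sin a - sin b)" by (simp add: power2_eq_square algebra_simps)
  ultimately show ?thesis unfolding abs_mult by (simp only: abs_mult) (intro mult_mono, auto)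
qed

section \<open>Averaged eigenvalue gaps\<close>

context delta_chain
begin

context
  assumes nontrivial: "\<exists>j. \<sigma> j \<noteq> 0"
begin

lemma frequency_pos: "frequency n > 0"
  and frequency_angle: "final_angle (frequency n) = pi / 2 + real n * pi"
  using frequency[of n] nontrivial by auto

lemma frequency_L: "frequency n * L = real n * pi + deficit (frequency n)"
  using final_angle_eq[OF frequency_pos[of n]] frequency_angle[of n] by simp

lemma inverse_frequency_tendsto_0: "(\<lambda>n. 1 / frequency n) \<longlonglongrightarrow> 0"
proof (rule Lim_null_comparison)
  have "(\<lambda>n. L / pi * (1 / real n)) \<longlonglongrightarrow> L / pi * 0" by (intro tendsto_intros lim_1_over_n)
  then show "(\<lambda>n. L / pi * (1 / real n)) \<longlonglongrightarrow> 0" by simp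
  show "\<forall>\<^sub>F n in sequentially. norm (1 / frequency n) \<le> L / pi * (1 / real n)"
    using eventually_gt_at_top[of 0]
  proof eventually_elim
    case (elim n)
    have "real n * pi \<le> frequency n * L" using frequency_L[of n] deficit_bounds(1)[OF frequency_pos[of n]] by linarith
    then show ?case using elim frequency_pos[of n] L_pos by (simp add: field_simps)
  qed
qed

lemma deficit_tendsto_0: "(\<lambda>n. deficit (frequency n)) \<longlonglongrightarrow> 0"
proof (rule Lim_null_comparison)
  show "\<forall>\<^sub>F n in sequentially. norm (deficit (frequency n)) \<le> (\<Sum>n. \<sigma> n) * (1 / frequency n)"
    using deficit_bounds[OF frequency_pos] by (intro always_eventually allI) simp
  show "(\<lambda>n. (\<Sum>n. \<sigma> n) * (1 / frequency n)) \<longlonglongrightarrow> 0"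
    using tendsto_mult[OF tendsto_const inverse_frequency_tendsto_0] by simp
qed

text \<open>
  The share of the site \<open>j\<close> in the shift of the eigenvalue with index \<open>n\<close>, up to the factor \<open>2/L\<close>.
\<close>

definition site_shift :: "nat \<Rightarrow> nat \<Rightarrow> real" where
  "site_shift n j = - frequency n * kick (\<sigma> j / frequency n) (angle (frequency n) j)"

lemma site_shift_bounds: "0 \<le> site_shift n j" "site_shift n j \<le> \<sigma> j"
proof -
  have k: "frequency n > 0" by (rule frequency_pos)
  show "0 \<le> site_shift n j"
    using kick_nonpos[OF strength_nonneg[OF k]] k by (simp add: site_shift_def mult_nonneg_nonpos)
  have "frequency n * (- kick (\<sigma> j / frequency n) (angle (frequency n) j)) \<le> frequency n * (\<sigma> j / frequency n)"
    using kick_ge[OF strength_nonneg[OF k]] k by (intro mult_left_mono) (auto simp: minus_le_iff)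
  then show "site_shift n j \<le> \<sigma> j" using k by (simp add: site_shift_def)
qed

lemma summable_site_shift: "summable (site_shift n)"
  by (rule summable_comparison_test'[OF \<sigma>_summable]) (use site_shift_bounds in auto)

lemma frequency_times_deficit: "frequency n * deficit (frequency n) = (\<Sum>j. site_shift n j)"
  unfolding deficit_def site_shift_def
  by (subst suminf_mult[symmetric])
    (auto intro!: summable_minus summable_kick frequency_pos simp del: summable_minus_iff)

text \<open>
  The free frequency \<open>n pi/L\<close> falls short of the perturbed one by the deficit divided by \<open>L\<close>.
\<close>

lemma eigenvalue_gap:
  "(frequency n)\<^sup>2 - (real n * pi / L)\<^sup>2 = 2 / L * (\<Sum>j. site_shift n j) - (deficit (frequency n))\<^sup>2 / L\<^sup>2"
proof -
  have free: "real n * pi / L = frequency n - deficit (frequency n) / L"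
    using frequency_L[of n] L_pos by (simp add: field_simps)
  show ?thesis
    unfolding frequency_times_deficit[symmetric] free by (simp add: power2_eq_square algebra_simps)
qed

text \<open>
  First-order perturbation theory predicts \<open>\<sigma> j\<close> times the square of the free eigenfunction at the site.
  The first summand of the bound is the error of linearizing the kick. The second one comes from replacing
  the Pruefer angle by the free one, from which it differs by at most twice the deficit.
\<close>

lemma site_shift_limit:
  "(\<lambda>n. site_shift n j - \<sigma> j * (cos (real n * (pi * v j / L)))\<^sup>2) \<longlonglongrightarrow> 0"
proof (rule Lim_null_comparison)
  let ?k = frequency
  let ?B = "\<lambda>n. \<sigma> j * (\<sigma> j * (1 / ?k n) * (2 + \<sigma> j * (1 / ?k n))) + \<sigma> j * (2 * (2 * deficit (?k n)))"
  have "?B \<longlonglongrightarrow> \<sigma> j * (\<sigma> j * 0 * (2 + \<sigma> j * 0)) + \<sigma> j * (2 * (2 * 0))"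
    by (intro tendsto_intros inverse_frequency_tendsto_0 deficit_tendsto_0)
  then show "?B \<longlonglongrightarrow> 0" by simp
  show "\<forall>\<^sub>F n in sequentially. norm (site_shift n j - \<sigma> j * (cos (real n * (pi * v j / L)))\<^sup>2) \<le> ?B n"
  proof (intro always_eventually allI)
    fix n
    let ?\<theta> = "angle (?k n) j" let ?s = "\<sigma> j / ?k n" let ?\<theta>\<^sub>0 = "pi / 2 + real n * (pi * v j / L)"
    have k: "?k n > 0" by (rule frequency_pos)
    have "\<bar>site_shift n j - \<sigma> j * (sin ?\<theta>)\<^sup>2\<bar> = ?k n * \<bar>kick ?s ?\<theta> + ?s * (sin ?\<theta>)\<^sup>2\<bar>"
    proof -
      have "site_shift n j - \<sigma> j * (sin ?\<theta>)\<^sup>2 = - (?k n * (kick ?s ?\<theta> + ?s * (sin ?\<theta>)\<^sup>2))"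
        using k by (simp add: site_shift_def field_simps)
      then show ?thesis using k by (simp add: abs_mult)
    qed
    also have "\<dots> \<le> ?k n * (?s\<^sup>2 * (2 + ?s))"
      using k by (intro mult_left_mono kick_first_order strength_nonneg) auto
    also have "\<dots> = \<sigma> j * (\<sigma> j * (1 / ?k n) * (2 + \<sigma> j * (1 / ?k n)))"
      using k by (simp add: power2_eq_square)
    finally have 1: "\<bar>site_shift n j - \<sigma> j * (sin ?\<theta>)\<^sup>2\<bar> \<le> \<dots>" .
    have angle_diff: "\<bar>?\<theta> - ?\<theta>\<^sub>0\<bar> \<le> 2 * deficit (?k n)"
    proof -
      have "?k n * v j = (?k n * L) * (v j / L)" using L_pos by simp
      then have "?k n * v j - real n * (pi * v j / L) = deficit (?k n) * (v j / L)"
        unfolding frequency_L[of n] by (simp add: distrib_right add_divide_distrib)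
      moreover have "0 \<le> v j / L" "v j / L \<le> 1" using v_bounds[of j] L_pos by auto
      then have "0 \<le> deficit (?k n) * (v j / L)" "deficit (?k n) * (v j / L) \<le> deficit (?k n)"
        using deficit_bounds(1)[OF k] by (auto intro: mult_left_le mult_nonneg_nonneg simp del: times_divide_eq_right)
      ultimately show ?thesis using partial_deficit_bounds[OF k, of j] by (simp add: angle_def abs_le_iff)
    qed
    have "\<bar>(sin ?\<theta>)\<^sup>2 - (sin ?\<theta>\<^sub>0)\<^sup>2\<bar> \<le> 2 * \<bar>?\<theta> - ?\<theta>\<^sub>0\<bar>" by (rule sin_sq_diff_le)
    also have "\<dots> \<le> 2 * (2 * deficit (?k n))" using angle_diff by (rule mult_left_mono) simp
    finally have "\<bar>(sin ?\<theta>)\<^sup>2 - (sin ?\<theta>\<^sub>0)\<^sup>2\<bar> \<le> 2 * (2 * deficit (?k n))" .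
    then have "\<sigma> j * \<bar>(sin ?\<theta>)\<^sup>2 - (sin ?\<theta>\<^sub>0)\<^sup>2\<bar> \<le> \<sigma> j * (2 * (2 * deficit (?k n)))"
      using \<sigma>_nonneg by (intro mult_left_mono)
    moreover have "sin ?\<theta>\<^sub>0 = cos (real n * (pi * v j / L))" by (simp add: sin_add)
    ultimately have 2: "\<bar>\<sigma> j * (sin ?\<theta>)\<^sup>2 - \<sigma> j * (cos (real n * (pi * v j / L)))\<^sup>2\<bar> \<le> \<sigma> j * (2 * (2 * deficit (?k n)))"
      using \<sigma>_nonneg[of j] by (simp add: abs_mult flip: right_diff_distrib)
    show "norm (site_shift n j - \<sigma> j * (cos (real n * (pi * v j / L)))\<^sup>2) \<le> ?B n"
      using 1 2 unfolding real_norm_def by linarith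
  qed
qed

text \<open>
  At \<open>v 0 = 0\<close> the squared cosine is constantly 1, whereas at the other sites it averages to \<open>1/2\<close>.
\<close>

lemma average_site_shift:
  "(\<lambda>N. (1 / real N) * (\<Sum>n<N. site_shift n j)) \<longlonglongrightarrow> \<sigma> j * (if j = 0 then 1 else 1 / 2)"
proof (rule averages_cong_limit[OF site_shift_limit])
  have "(\<lambda>N. (1 / real N) * (\<Sum>n<N. (cos (real n * (pi * v j / L)))\<^sup>2)) \<longlonglongrightarrow> (if j = 0 then 1 else 1 / 2)"
  proof (cases "j = 0")
    case True
    have "\<forall>\<^sub>F N in sequentially. 1 = (1 / real N) * (\<Sum>n<N. (cos (real n * (pi * v j / L)))\<^sup>2)"
      using eventually_gt_at_top[of 0] by eventually_elim (simp add: True v0)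
    then show ?thesis using True by (simp add: Lim_transform_eventually[OF tendsto_const])
  next
    case False
    then have "0 < v j" using v_mono v0 by (metis gr0I strict_mono_less)
    then have "0 < pi * v j / L" "pi * v j / L < pi" using L_pos v_bounds[of j] by (auto simp: field_simps)
    then have "sin (pi * v j / L) \<noteq> 0" using sin_gt_zero by force
    from average_cos_squared[OF this] show ?thesis by (simp only: False if_False)
  qed
  from tendsto_mult[OF tendsto_const[of "\<sigma> j"] this]
  show "(\<lambda>N. (1 / real N) * (\<Sum>n<N. \<sigma> j * (cos (real n * (pi * v j / L)))\<^sup>2)) \<longlonglongrightarrow> \<sigma> j * (if j = 0 then 1 else 1 / 2)"
    by (simp add: mult.left_commute flip: sum_distrib_left)
qed

lemma average_total_shift:
  "(\<lambda>N. (1 / real N) * (\<Sum>n<N. \<Sum>j. site_shift n j)) \<longlonglongrightarrow> \<sigma> 0 + (\<Sum>j. \<sigma> (Suc j)) / 2"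
proof -
  let ?a = "\<lambda>j N. (1 / real N) * (\<Sum>n<N. site_shift n j)"
  let ?b = "\<lambda>j. \<sigma> j * (if j = 0 then 1 else 1 / 2)"
  have bd: "norm (?a j N) \<le> \<sigma> j" for j N
  proof -
    have "(\<Sum>n<N. site_shift n j) \<le> (\<Sum>n<N. \<sigma> j)" by (intro sum_mono site_shift_bounds)
    then have "?a j N \<le> (1 / real N) * (real N * \<sigma> j)" by (intro mult_left_mono) auto
    also have "\<dots> \<le> \<sigma> j" using \<sigma>_nonneg[of j] by simp
    finally show ?thesis using site_shift_bounds(1) by (simp add: sum_nonneg)
  qed
  have "(\<lambda>N. \<Sum>j. ?a j N) \<longlonglongrightarrow> (\<Sum>j. ?b j)"
    by (rule conjunct2[OF conjunct2[OF tannerys_theorem[OF average_site_shift _ \<sigma>_summable]]])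
      (use bd in \<open>auto intro: always_eventually\<close>)
  moreover have "(\<Sum>j. ?a j N) = (1 / real N) * (\<Sum>n<N. \<Sum>j. site_shift n j)" for N
    by (subst suminf_mult[OF summable_sum[OF summable_site_shift]])
       (simp add: suminf_sum[OF summable_site_shift])
  moreover have "(\<Sum>j. ?b j) = \<sigma> 0 + (\<Sum>j. \<sigma> (Suc j)) / 2"
  proof -
    have "summable (\<lambda>j. \<sigma> (Suc j))" using \<sigma>_summable summable_Suc_iff by blast
    from suminf_divide[OF this, of 2] have "(\<Sum>j. ?b (Suc j)) = (\<Sum>j. \<sigma> (Suc j)) / 2" by simp
    moreover have "summable ?b"
      by (rule summable_comparison_test'[OF \<sigma>_summable]) (use \<sigma>_nonneg in auto)
    ultimately show ?thesis using suminf_split_head[of ?b] by simp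
  qed
  ultimately show ?thesis by simp
qed

lemma average_eigenvalue_gap:
  "(\<lambda>N. (1 / real N) * (\<Sum>n<N. (frequency n)\<^sup>2 - (real n * pi / L)\<^sup>2))
     \<longlonglongrightarrow> 2 * \<sigma> 0 / L + (\<Sum>n. \<sigma> (Suc n)) / L"
proof (rule averages_cong_limit)
  have "(\<lambda>n. - ((deficit (frequency n))\<^sup>2 / L\<^sup>2)) \<longlonglongrightarrow> - (0\<^sup>2 / L\<^sup>2)"
    using L_pos by (intro tendsto_intros deficit_tendsto_0) auto
  then show "(\<lambda>n. (frequency n)\<^sup>2 - (real n * pi / L)\<^sup>2 - 2 / L * (\<Sum>j. site_shift n j)) \<longlonglongrightarrow> 0"
    unfolding eigenvalue_gap by simp
  have "(\<lambda>N. 2 / L * ((1 / real N) * (\<Sum>n<N. \<Sum>j. site_shift n j))) \<longlonglongrightarrow> 2 / L * (\<sigma> 0 + (\<Sum>j. \<sigma> (Suc j)) / 2)"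
    by (intro tendsto_intros average_total_shift)
  moreover have "2 / L * (\<sigma> 0 + (\<Sum>j. \<sigma> (Suc j)) / 2) = 2 * \<sigma> 0 / L + (\<Sum>n. \<sigma> (Suc n)) / L"
    by (simp add: distrib_left)
  moreover have "2 / L * ((1 / real N) * (\<Sum>n<N. \<Sum>j. site_shift n j)) = (1 / real N) * (\<Sum>n<N. 2 / L * (\<Sum>j. site_shift n j))" for N
    unfolding sum_distrib_left[symmetric] by (rule mult.left_commute)
  ultimately show "(\<lambda>N. (1 / real N) * (\<Sum>n<N. 2 / L * (\<Sum>j. site_shift n j))) \<longlonglongrightarrow> 2 * \<sigma> 0 / L + (\<Sum>n. \<sigma> (Suc n)) / L"
    by (simp only:)
qed

end

end

theorem theorem7:
  fixes L :: real and v \<sigma> :: "nat \<Rightarrow> real"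
  assumes "L > 0"
    and "v 0 = 0"
    and "strict_mono v"
    and "\<And>n. v n \<in> {0..<L}"
    and "(\<lambda>n. v (Suc n) - v n) sums L"
    and "\<And>n. \<sigma> n \<ge> 0"
    and "summable (\<lambda>n. \<bar>\<sigma> n\<bar>)"
  shows "(\<lambda>N. (1 / real N) * (\<Sum>n<N. eigval L v \<sigma> n - eigval L v (\<lambda>_. 0) n))
           \<longlonglongrightarrow> 2 * \<sigma> 0 / L + (\<Sum>n. \<sigma> (Suc n)) / L"
proof -
  interpret delta_chain L v \<sigma>
    using assms by unfold_locales auto
  interpret free: delta_chain L v "\<lambda>_. 0"
    using assms by unfold_locales auto
  have free: "eigval L v (\<lambda>_. 0) = (\<lambda>n. (real n * pi / L)\<^sup>2)"
    by (rule free.eigval_free) simp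
  show ?thesis
  proof (cases "\<exists>j. \<sigma> j \<noteq> 0")
    case True
    show ?thesis unfolding free eigval_frequency[OF True] by (rule average_eigenvalue_gap[OF True])
  next
    case False
    then have "\<sigma> = (\<lambda>_. 0)" by auto
    then show ?thesis by simp
  qed
qed

end
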